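(* Let $n=\{n_0,n_1,n_2\}$, $\mathbf G_{\mathrm b}=\{B,B_I\}$ and $\mathbf G_{\mathrm p}=\{A_0,A_1,A_2\}$ be PDE parameters such that $\{n,\mathbf G_{\mathrm b}\}$ is admissible, and let $\mathcal T,\mathcal A$ be the associated partial integral operators constructed from $\{n,\mathbf G_{\mathrm b},\mathbf G_{\mathrm p}\}$. Then for any $\mathbf x^0\in X$ and any $\mathbf x:\mathbb R_+\to X$: $\mathbf x$ satisfies the PDE defined by $\{n,\mathbf G_{\mathrm b},\mathbf G_{\mathrm p}\}$ with initial condition $\mathbf x^0$ if and only if $\mathcal D\mathbf x$ satisfies the PIE defined by $\{\mathcal T,\mathcal A\}$ with initial condition $\mathcal D\mathbf x^0\in L_2^{n_{\mathbf x}}[a,b]$, where $\mathcal D\mathbf x=\mathrm{col}(\mathbf x_0,\partial_s\mathbf x_1,\partial_s^2\mathbf x_2)$.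
   Context: **Basic notation.** $[a,b]$ is a compact real interval and $\mathbb R_+=[0,\infty)$. $L_2^m=L_2^m[a,b]$ is the Hilbert space of $\mathbb R^m$-valued square-integrable functions, and $W_k^m=\{\mathbf u\in L_2^m:\partial_s^l\mathbf u\in L_2^m\text{ for all }l\le k\}$. A matrix function $R(s,\theta)$ on $[a,b]^2$ is separable if $R(s,\theta)=F(s)^TG(\theta)$ with $F,G$ matrix-valued, measurable and essentially bounded. For matrix functions $R_0(s),R_1(s,\theta),R_2(s,\theta)$, $\mathcal P_{\{R_i\}}$ denotes the operator $$(\mathcal P_{\{R_i\}}\mathbf v)(s)=R_0(s)\mathbf v(s)+\int_a^sR_1(s,\theta)\mathbf v(\theta)\,d\theta+\int_s^bR_2(s,\theta)\mathbf v(\theta)\,d\theta .$$ **Continuity parameter.** $n=\{n_0,n_1,n_2\}$ are nonnegative integers; $n_{\mathbf x}=n_0+n_1+n_2$, $n_S=n_1+2n_2$, $W^n=W_0^{n_0}\times W_1^{n_1}\times W_2^{n_2}$. For $\mathbf x=\mathrm{col}(\mathbf x_0,\mathbf x_1,\mathbf x_2)\in W^n$ set $\mathbf x_c=\mathrm{col}(\mathbf x_1,\mathbf x_2,\partial_s\mathbf x_2)$ and $\mathbf x_D=\mathrm{col}(\mathbf x_0,\mathbf x_1,\mathbf x_2,\partial_s\mathbf x_1,\partial_s\mathbf x_2,\partial_s^2\mathbf x_2)$. **Boundary conditions.** $\mathbf G_{\mathrm b}=\{B,B_I\}$ with $B\in\mathbb R^{n_{BC}\times 2n_S}$ and $B_I:[a,b]\to\mathbb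 R^{n_{BC}\times(n_{\mathbf x}+n_S)}$ square integrable. Define $$X=\Big\{\mathbf x\in W^n: B\begin{bmatrix}\mathbf x_c(a)\\ \mathbf x_c(b)\end{bmatrix}=\int_a^bB_I(s)\mathbf x_D(s)\,ds\Big\}.$$ **Dynamics.** $\mathbf G_{\mathrm p}=\{A_0,A_1,A_2\}$, where $A_0(s),A_1(s,\theta),A_2(s,\theta)\in\mathbb R^{n_{\mathbf x}\times(n_{\mathbf x}+n_S)}$, $A_0$ is essentially bounded and $A_1,A_2$ are separable. The PDE is $$\dot{\mathbf x}(t,s)=A_0(s)\mathbf x_D(t,s)+\int_a^sA_1(s,\theta)\mathbf x_D(t,\theta)\,d\theta+\int_s^bA_2(s,\theta)\mathbf x_D(t,\theta)\,d\theta,\qquad \mathbf x(t)\in X.\qquad(\mathrm{PDE})$$ For $\mathbf x^0\in X$, $\mathbf x$ satisfies the PDE with initial condition $\mathbf x^0$ if: $\mathbf x(t)\in X$ for all $t\ge0$; $\mathbf x$ is Fréchet differentiable (in $t$) with respect to the $L_2$-norm almost everywhere on $\mathbb R_+$; $\mathbf x(0)=\mathbf x^0$; and (PDE) holds for almost all $t\ge0$. **PIE.** For operators $\mathcal T,\mathcal A$ on $L_2^{n_{\mathbf x}}$, the PIE is $\mathcal T\dot{\mathbf x}_f(t)=\mathcal A\mathbf x_f(t)$. Put $\|\mathbf x_f\|_{\mathcal T}=\|\mathcal T\mathbf x_f\|_{L_2}$. $\mathbf x_f$ satisfies the PIE with initial condition $\mathbf x_f^0\in L_2^{n_{\mathbf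 x}}$ if: $\mathbf x_f(t)\in L_2^{n_{\mathbf x}}$ for all $t\ge0$; $\mathbf x_f$ is Fréchet differentiable with respect to the $\mathcal T$-norm almost everywhere on $\mathbb R_+$; $\mathbf x_f(0)=\mathbf x_f^0$; and the PIE holds for almost all $t$. Here the derivative is taken in the completion for the $\mathcal T$-norm, i.e. differentiability means $t\mapsto\mathcal T\mathbf x_f(t)$ is differentiable in $L_2$, and $\mathcal T\dot{\mathbf x}_f(t)$ denotes that derivative. **Construction of $\mathcal T$, $\mathcal A$ and admissibility.** Blocks of rows/columns of size zero are omitted. $$T(s)=\begin{bmatrix}I_{n_1}&0&0\\ 0&I_{n_2}&sI_{n_2}\\ 0&0&I_{n_2}\end{bmatrix},\qquad Q(s)=\begin{bmatrix}0_{n_1\times n_0}&I_{n_1}&0\\ 0&0&sI_{n_2}\\ 0&0&I_{n_2}\end{bmatrix},$$ and $T_1(s),Q_1(s)$ are the first $n_1+n_2$ rows of $T(s),Q(s)$. The constant matrices $U_1\in\mathbb R^{(n_{\mathbf x}+n_S)\times n_{\mathbf x}}$ and $U_2\in\mathbb R^{(n_{\mathbf x}+n_S)\times n_S}$ are $U_1=\mathrm{diag}(U_{10},U_{11},U_{12})$ with $U_{10}=\begin{bmatrix}I_{n_0}\\ 0_{(n_1+n_2)\times n_0}\end{bmatrix}$, $U_{11}=\begin{bmatrix}I_{n_1}\\ 0_{n_2\times n_1}\end{bmatrix}$, $U_{12}=I_{n_2}$, and $U_2=\begin{bmatrix}\mathrm{diag}(U_{20},U_{21})\\ 0_{n_2\times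 n_S}\end{bmatrix}$ with $U_{20}=\begin{bmatrix}0_{n_0\times(n_1+n_2)}\\ I_{n_1+n_2}\end{bmatrix}$, $U_{21}=\begin{bmatrix}0_{n_1\times n_2}\\ I_{n_2}\end{bmatrix}$. Let $$B_T=B\begin{bmatrix}T(0)\\ T(b-a)\end{bmatrix}-\int_a^bB_I(s)U_2T(s-a)\,ds\in\mathbb R^{n_{BC}\times n_S}.$$ The pair $\{n,\mathbf G_{\mathrm b}\}$ is **admissible** if $B_T$ is invertible (in particular $n_{BC}=n_S$). In that case let $$B_Q(s)=B_T^{-1}\Big(B_I(s)U_1-B\begin{bmatrix}0\\ Q(b-s)\end{bmatrix}+\int_s^bB_I(\theta)U_2Q(\theta-s)\,d\theta\Big),$$ $$G_0=\begin{bmatrix}I_{n_0}&0\\ 0&0_{n_{\mathbf x}-n_0}\end{bmatrix},\quad G_2(s,\theta)=\begin{bmatrix}0_{n_0\times n_{\mathbf x}}\\ T_1(s-a)B_Q(\theta)\end{bmatrix},\quad G_1(s,\theta)=\begin{bmatrix}0_{n_0\times n_{\mathbf x}}\\ Q_1(s-\theta)\end{bmatrix}+G_2(s,\theta),$$ $$R_{D,2}(s,\theta)=U_2T(s-a)B_Q(\theta),\quad R_{D,1}(s,\theta)=R_{D,2}(s,\theta)+U_2Q(s-\theta),\quad\hat A_0(s)=A_0(s)U_1,$$ $$\hat A_1(s,\theta)=A_0(s)R_{D,1}(s,\theta)+A_1(s,\theta)U_1+\int_a^\theta A_1(s,\beta)R_{D,2}(\beta,\theta)d\beta+\int_\theta^sA_1(s,\beta)R_{D,1}(\beta,\theta)d\beta+\int_s^bA_2(s,\beta)R_{D,1}(\beta,\theta)d\beta,$$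 $$\hat A_2(s,\theta)=A_0(s)R_{D,2}(s,\theta)+A_2(s,\theta)U_1+\int_a^sA_1(s,\beta)R_{D,2}(\beta,\theta)d\beta+\int_s^\theta A_2(s,\beta)R_{D,2}(\beta,\theta)d\beta+\int_\theta^bA_2(s,\beta)R_{D,1}(\beta,\theta)d\beta,$$ and $\mathcal T=\mathcal P_{\{G_i\}}$, $\mathcal A=\mathcal P_{\{\hat A_i\}}$. *)

theory Defs
  imports "HOL-Analysis.Analysis" "Jordan_Normal_Form.Gauss_Jordan_Elimination"
begin

unbundle no vec_syntax
no_notation inner (infixl "\<bullet>" 70)

text \<open>
  The block sizes are natural numbers that may be zero, so vectors and matrices are taken from
  \<^theory>\<open>Jordan_Normal_Form.Matrix\<close> (dimensions are values, empty blocks are allowed).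
  Elements of \<open>L\<^sub>2\<close> are represented by functions \<open>u :: real \<Rightarrow> real vec\<close>, of which only the
  restriction to \<open>[a,b]\<close> matters; equality in \<open>L\<^sub>2\<close> is \<open>L2_eq\<close>.
\<close>

definition L2 :: "real \<Rightarrow> real \<Rightarrow> nat \<Rightarrow> (real \<Rightarrow> real Matrix.vec) set" where
  "L2 a b m = {u. (\<forall>s\<in>{a..b}. u s \<in> carrier_vec m) \<and>
     (\<forall>i<m. (\<lambda>s. u s $ i) \<in> borel_measurable (lebesgue_on {a..b}) \<and>
            integrable (lebesgue_on {a..b}) (\<lambda>s. (u s $ i)\<^sup>2))}"

definition L2_norm :: "real \<Rightarrow> real \<Rightarrow> (real \<Rightarrow> real Matrix.vec) \<Rightarrow> real" where
  "L2_norm a b u = sqrt (LINT s|lebesgue_on {a..b}. u s \<bullet> u s)"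

definition L2_eq :: "real \<Rightarrow> real \<Rightarrow> (real \<Rightarrow> real Matrix.vec) \<Rightarrow> (real \<Rightarrow> real Matrix.vec) \<Rightarrow> bool" where
  "L2_eq a b u v \<longleftrightarrow> (AE s in lebesgue_on {a..b}. u s = v s)"

text \<open>Weak derivatives are tested against \<open>C\<^sup>1\<close> functions with compact support in \<open>(a,b)\<close>, as in
  Brezis, Functional Analysis, Sobolev Spaces and PDEs, Section 8.2; smooth test functions
  give the same derivative.\<close>

definition test_function :: "real \<Rightarrow> real \<Rightarrow> (real \<Rightarrow> real) \<Rightarrow> (real \<Rightarrow> real) \<Rightarrow> bool" where
  "test_function a b \<phi> \<phi>' \<longleftrightarrow>
     (\<forall>s. (\<phi> has_real_derivative \<phi>' s) (at s)) \<and> continuous_on UNIV \<phi>' \<and>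
     (\<exists>c d. a < c \<and> d < b \<and> (\<forall>s. s \<notin> {c..d} \<longrightarrow> \<phi> s = 0))"

definition has_weak_deriv ::
    "real \<Rightarrow> real \<Rightarrow> nat \<Rightarrow> (real \<Rightarrow> real Matrix.vec) \<Rightarrow> (real \<Rightarrow> real Matrix.vec) \<Rightarrow> bool" where
  "has_weak_deriv a b m u v \<longleftrightarrow> u \<in> L2 a b m \<and> v \<in> L2 a b m \<and>
     (\<forall>i<m. \<forall>\<phi> \<phi>'. test_function a b \<phi> \<phi>' \<longrightarrow>
        (LINT s|lebesgue_on {a..b}. u s $ i * \<phi>' s) = - (LINT s|lebesgue_on {a..b}. v s $ i * \<phi> s))"

text \<open>The weak derivative is unique only up to null sets; the choice below picks a representative.\<close>

definition weak_deriv ::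
    "real \<Rightarrow> real \<Rightarrow> nat \<Rightarrow> (real \<Rightarrow> real Matrix.vec) \<Rightarrow> (real \<Rightarrow> real Matrix.vec)" where
  "weak_deriv a b m u = (SOME v. has_weak_deriv a b m u v)"

primrec sobolev :: "real \<Rightarrow> real \<Rightarrow> nat \<Rightarrow> nat \<Rightarrow> (real \<Rightarrow> real Matrix.vec) set" where
  "sobolev a b 0 m = L2 a b m"
| "sobolev a b (Suc k) m = {u \<in> L2 a b m. \<exists>v \<in> sobolev a b k m. has_weak_deriv a b m u v}"

text \<open>Point values of a function in \<open>W\<^sub>1\<close> are those of its continuous representative, which is
  uniquely determined on \<open>[a,b]\<close> for \<open>a < b\<close>.\<close>

definition cont_rep ::
    "real \<Rightarrow> real \<Rightarrow> nat \<Rightarrow> (real \<Rightarrow> real Matrix.vec) \<Rightarrow> (real \<Rightarrow> real Matrix.vec)" where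
  "cont_rep a b m u = (SOME v. (\<forall>s\<in>{a..b}. v s \<in> carrier_vec m) \<and>
     (\<forall>i<m. continuous_on {a..b} (\<lambda>s. v s $ i)) \<and> L2_eq a b v u)"

definition has_L2_deriv ::
    "real \<Rightarrow> real \<Rightarrow> nat \<Rightarrow> (real \<Rightarrow> real \<Rightarrow> real Matrix.vec) \<Rightarrow> (real \<Rightarrow> real Matrix.vec) \<Rightarrow> real \<Rightarrow> bool" where
  "has_L2_deriv a b m x v t \<longleftrightarrow> v \<in> L2 a b m \<and>
     ((\<lambda>\<tau>. L2_norm a b (\<lambda>s. x \<tau> s - x t s - (\<tau> - t) \<cdot>\<^sub>v v s) / \<bar>\<tau> - t\<bar>) \<longlongrightarrow> 0) (at t within {0..})"

definition L2_differentiable :: "real \<Rightarrow> real \<Rightarrow> nat \<Rightarrow> (real \<Rightarrow> real \<Rightarrow> real Matrix.vec) \<Rightarrow> real \<Rightarrow> bool" where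
  "L2_differentiable a b m x t \<longleftrightarrow> (\<exists>v. has_L2_deriv a b m x v t)"

definition L2_deriv ::
    "real \<Rightarrow> real \<Rightarrow> nat \<Rightarrow> (real \<Rightarrow> real \<Rightarrow> real Matrix.vec) \<Rightarrow> real \<Rightarrow> (real \<Rightarrow> real Matrix.vec)" where
  "L2_deriv a b m x t = (SOME v. has_L2_deriv a b m x v t)"

definition square_integrable_mat :: "real \<Rightarrow> real \<Rightarrow> nat \<Rightarrow> nat \<Rightarrow> (real \<Rightarrow> real Matrix.mat) \<Rightarrow> bool" where
  "square_integrable_mat a b r c F \<longleftrightarrow> (\<forall>s\<in>{a..b}. F s \<in> carrier_mat r c) \<and>
     (\<forall>i<r. \<forall>j<c. (\<lambda>s. F s $$ (i,j)) \<in> borel_measurable (lebesgue_on {a..b}) \<and>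
                  integrable (lebesgue_on {a..b}) (\<lambda>s. (F s $$ (i,j))\<^sup>2))"

definition ess_bounded_mat :: "real \<Rightarrow> real \<Rightarrow> nat \<Rightarrow> nat \<Rightarrow> (real \<Rightarrow> real Matrix.mat) \<Rightarrow> bool" where
  "ess_bounded_mat a b r c F \<longleftrightarrow> (\<forall>s\<in>{a..b}. F s \<in> carrier_mat r c) \<and>
     (\<forall>i<r. \<forall>j<c. (\<lambda>s. F s $$ (i,j)) \<in> borel_measurable (lebesgue_on {a..b}) \<and>
                  (\<exists>K. AE s in lebesgue_on {a..b}. \<bar>F s $$ (i,j)\<bar> \<le> K))"

definition separable_mat :: "real \<Rightarrow> real \<Rightarrow> nat \<Rightarrow> nat \<Rightarrow> (real \<Rightarrow> real \<Rightarrow> real Matrix.mat) \<Rightarrow> bool" where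
  "separable_mat a b r c R \<longleftrightarrow> (\<exists>k F G. ess_bounded_mat a b k r F \<and> ess_bounded_mat a b k c G \<and>
     (\<forall>s\<in>{a..b}. \<forall>\<theta>\<in>{a..b}. R s \<theta> = transpose_mat (F s) * G \<theta>))"

definition vec_integral :: "nat \<Rightarrow> real set \<Rightarrow> (real \<Rightarrow> real Matrix.vec) \<Rightarrow> real Matrix.vec" where
  "vec_integral m S f = Matrix.vec m (\<lambda>i. LINT s|lebesgue_on S. f s $ i)"

definition mat_integral :: "nat \<Rightarrow> nat \<Rightarrow> real set \<Rightarrow> (real \<Rightarrow> real Matrix.mat) \<Rightarrow> real Matrix.mat" where
  "mat_integral r c S F = Matrix.mat r c (\<lambda>(i,j). LINT s|lebesgue_on S. F s $$ (i,j))"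

definition PI_op ::
    "real \<Rightarrow> real \<Rightarrow> nat \<Rightarrow> (real \<Rightarrow> real Matrix.mat) \<Rightarrow> (real \<Rightarrow> real \<Rightarrow> real Matrix.mat) \<Rightarrow>
     (real \<Rightarrow> real \<Rightarrow> real Matrix.mat) \<Rightarrow> (real \<Rightarrow> real Matrix.vec) \<Rightarrow> (real \<Rightarrow> real Matrix.vec)" where
  "PI_op a b m R0 R1 R2 v = (\<lambda>s. R0 s *\<^sub>v v s
     + vec_integral m {a..s} (\<lambda>\<theta>. R1 s \<theta> *\<^sub>v v \<theta>)
     + vec_integral m {s..b} (\<lambda>\<theta>. R2 s \<theta> *\<^sub>v v \<theta>))"

definition append_cols :: "real Matrix.mat \<Rightarrow> real Matrix.mat \<Rightarrow> real Matrix.mat" (infixr "@\<^sub>c" 66) where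
  "M @\<^sub>c N = four_block_mat M N (0\<^sub>m 0 (dim_col M)) (0\<^sub>m 0 (dim_col N))"

definition first_rows :: "nat \<Rightarrow> real Matrix.mat \<Rightarrow> real Matrix.mat" where
  "first_rows k M = Matrix.mat k (dim_col M) (\<lambda>(i,j). M $$ (i,j))"

definition slice :: "nat \<Rightarrow> nat \<Rightarrow> (real \<Rightarrow> real Matrix.vec) \<Rightarrow> (real \<Rightarrow> real Matrix.vec)" where
  "slice k m u = (\<lambda>s. Matrix.vec m (\<lambda>i. u s $ (k + i)))"

text \<open>The locale only fixes the parameters; it makes no assumptions on them.\<close>

locale pde =
  fixes a b :: real
    and n0 n1 n2 nBC :: nat
    and B :: "real Matrix.mat" and BI :: "real \<Rightarrow> real Matrix.mat"
    and A0 :: "real \<Rightarrow> real Matrix.mat" and A1 A2 :: "real \<Rightarrow> real \<Rightarrow> real Matrix.mat"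
begin

definition nx :: nat where "nx = n0 + n1 + n2"
definition nS :: nat where "nS = n1 + 2 * n2"

definition x0_part :: "(real \<Rightarrow> real Matrix.vec) \<Rightarrow> (real \<Rightarrow> real Matrix.vec)" where
  "x0_part x = slice 0 n0 x"
definition x1_part :: "(real \<Rightarrow> real Matrix.vec) \<Rightarrow> (real \<Rightarrow> real Matrix.vec)" where
  "x1_part x = slice n0 n1 x"
definition x2_part :: "(real \<Rightarrow> real Matrix.vec) \<Rightarrow> (real \<Rightarrow> real Matrix.vec)" where
  "x2_part x = slice (n0 + n1) n2 x"

definition dx1 :: "(real \<Rightarrow> real Matrix.vec) \<Rightarrow> (real \<Rightarrow> real Matrix.vec)" where
  "dx1 x = weak_deriv a b n1 (x1_part x)"
definition dx2 :: "(real \<Rightarrow> real Matrix.vec) \<Rightarrow> (real \<Rightarrow> real Matrix.vec)" where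
  "dx2 x = weak_deriv a b n2 (x2_part x)"
definition ddx2 :: "(real \<Rightarrow> real Matrix.vec) \<Rightarrow> (real \<Rightarrow> real Matrix.vec)" where
  "ddx2 x = weak_deriv a b n2 (dx2 x)"

definition Wn :: "(real \<Rightarrow> real Matrix.vec) set" where
  "Wn = {x. (\<forall>s\<in>{a..b}. x s \<in> carrier_vec nx) \<and> x0_part x \<in> sobolev a b 0 n0 \<and>
            x1_part x \<in> sobolev a b 1 n1 \<and> x2_part x \<in> sobolev a b 2 n2}"

definition xc :: "(real \<Rightarrow> real Matrix.vec) \<Rightarrow> (real \<Rightarrow> real Matrix.vec)" where
  "xc x = (\<lambda>s. x1_part x s @\<^sub>v x2_part x s @\<^sub>v dx2 x s)"

definition xD :: "(real \<Rightarrow> real Matrix.vec) \<Rightarrow> (real \<Rightarrow> real Matrix.vec)" where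
  "xD x = (\<lambda>s. x0_part x s @\<^sub>v x1_part x s @\<^sub>v x2_part x s @\<^sub>v dx1 x s @\<^sub>v dx2 x s @\<^sub>v ddx2 x s)"

definition D_op :: "(real \<Rightarrow> real Matrix.vec) \<Rightarrow> (real \<Rightarrow> real Matrix.vec)" where
  "D_op x = (\<lambda>s. x0_part x s @\<^sub>v dx1 x s @\<^sub>v ddx2 x s)"

definition X :: "(real \<Rightarrow> real Matrix.vec) set" where
  "X = {x \<in> Wn. B *\<^sub>v (cont_rep a b nS (xc x) a @\<^sub>v cont_rep a b nS (xc x) b)
                = vec_integral nBC {a..b} (\<lambda>s. BI s *\<^sub>v xD x s)}"

definition satisfies_PDE :: "(real \<Rightarrow> real Matrix.vec) \<Rightarrow> (real \<Rightarrow> real \<Rightarrow> real Matrix.vec) \<Rightarrow> bool" where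
  "satisfies_PDE x0 x \<longleftrightarrow>
     (\<forall>t\<ge>0. x t \<in> X) \<and>
     (AE t in lebesgue_on {0..}. L2_differentiable a b nx x t) \<and>
     L2_eq a b (x 0) x0 \<and>
     (AE t in lebesgue_on {0..}. L2_eq a b (L2_deriv a b nx x t) (PI_op a b nx A0 A1 A2 (xD (x t))))"

definition Tmat :: "real \<Rightarrow> real Matrix.mat" where
  "Tmat s = (1\<^sub>m n1 @\<^sub>c 0\<^sub>m n1 n2 @\<^sub>c 0\<^sub>m n1 n2) @\<^sub>r
            (0\<^sub>m n2 n1 @\<^sub>c 1\<^sub>m n2 @\<^sub>c s \<cdot>\<^sub>m 1\<^sub>m n2) @\<^sub>r
            (0\<^sub>m n2 n1 @\<^sub>c 0\<^sub>m n2 n2 @\<^sub>c 1\<^sub>m n2)"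

definition Qmat :: "real \<Rightarrow> real Matrix.mat" where
  "Qmat s = (0\<^sub>m n1 n0 @\<^sub>c 1\<^sub>m n1 @\<^sub>c 0\<^sub>m n1 n2) @\<^sub>r
            (0\<^sub>m n2 n0 @\<^sub>c 0\<^sub>m n2 n1 @\<^sub>c s \<cdot>\<^sub>m 1\<^sub>m n2) @\<^sub>r
            (0\<^sub>m n2 n0 @\<^sub>c 0\<^sub>m n2 n1 @\<^sub>c 1\<^sub>m n2)"

definition U1 :: "real Matrix.mat" where
  "U1 = diag_block_mat [1\<^sub>m n0 @\<^sub>r 0\<^sub>m (n1 + n2) n0, 1\<^sub>m n1 @\<^sub>r 0\<^sub>m n2 n1, 1\<^sub>m n2]"

definition U2 :: "real Matrix.mat" where
  "U2 = diag_block_mat [0\<^sub>m n0 (n1 + n2) @\<^sub>r 1\<^sub>m (n1 + n2), 0\<^sub>m n1 n2 @\<^sub>r 1\<^sub>m n2] @\<^sub>r 0\<^sub>m n2 nS"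

definition BT :: "real Matrix.mat" where
  "BT = B * (Tmat 0 @\<^sub>r Tmat (b - a))
        - mat_integral nBC nS {a..b} (\<lambda>s. BI s * U2 * Tmat (s - a))"

text \<open>\<^const>\<open>invertible_mat\<close> requires a square matrix, hence \<open>nBC = nS\<close>.\<close>

definition admissible :: bool where
  "admissible \<longleftrightarrow> invertible_mat BT"

definition BQ :: "real \<Rightarrow> real Matrix.mat" where
  "BQ s = the (mat_inverse BT) *
     (BI s * U1 - B * (0\<^sub>m nS nx @\<^sub>r Qmat (b - s))
      + mat_integral nBC nx {s..b} (\<lambda>\<theta>. BI \<theta> * U2 * Qmat (\<theta> - s)))"

definition G0 :: "real \<Rightarrow> real Matrix.mat" where
  "G0 s = diag_block_mat [1\<^sub>m n0, 0\<^sub>m (nx - n0) (nx - n0)]"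

definition G2 :: "real \<Rightarrow> real \<Rightarrow> real Matrix.mat" where
  "G2 s \<theta> = 0\<^sub>m n0 nx @\<^sub>r (first_rows (n1 + n2) (Tmat (s - a)) * BQ \<theta>)"

definition G1 :: "real \<Rightarrow> real \<Rightarrow> real Matrix.mat" where
  "G1 s \<theta> = (0\<^sub>m n0 nx @\<^sub>r first_rows (n1 + n2) (Qmat (s - \<theta>))) + G2 s \<theta>"

definition RD2 :: "real \<Rightarrow> real \<Rightarrow> real Matrix.mat" where
  "RD2 s \<theta> = U2 * Tmat (s - a) * BQ \<theta>"

definition RD1 :: "real \<Rightarrow> real \<Rightarrow> real Matrix.mat" where
  "RD1 s \<theta> = RD2 s \<theta> + U2 * Qmat (s - \<theta>)"

definition A0_hat :: "real \<Rightarrow> real Matrix.mat" where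
  "A0_hat s = A0 s * U1"

text \<open>\<open>A1_hat s \<theta>\<close> is only used for \<open>\<theta> \<le> s\<close> and \<open>A2_hat s \<theta>\<close> only for \<open>s \<le> \<theta>\<close>, so every interval of
  integration below is correctly oriented.\<close>

definition A1_hat :: "real \<Rightarrow> real \<Rightarrow> real Matrix.mat" where
  "A1_hat s \<theta> = A0 s * RD1 s \<theta> + A1 s \<theta> * U1
     + mat_integral nx nx {a..\<theta>} (\<lambda>\<beta>. A1 s \<beta> * RD2 \<beta> \<theta>)
     + mat_integral nx nx {\<theta>..s} (\<lambda>\<beta>. A1 s \<beta> * RD1 \<beta> \<theta>)
     + mat_integral nx nx {s..b} (\<lambda>\<beta>. A2 s \<beta> * RD1 \<beta> \<theta>)"

definition A2_hat :: "real \<Rightarrow> real \<Rightarrow> real Matrix.mat" where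
  "A2_hat s \<theta> = A0 s * RD2 s \<theta> + A2 s \<theta> * U1
     + mat_integral nx nx {a..s} (\<lambda>\<beta>. A1 s \<beta> * RD2 \<beta> \<theta>)
     + mat_integral nx nx {s..\<theta>} (\<lambda>\<beta>. A2 s \<beta> * RD2 \<beta> \<theta>)
     + mat_integral nx nx {\<theta>..b} (\<lambda>\<beta>. A2 s \<beta> * RD1 \<beta> \<theta>)"

definition T_op :: "(real \<Rightarrow> real Matrix.vec) \<Rightarrow> (real \<Rightarrow> real Matrix.vec)" where
  "T_op = PI_op a b nx G0 G1 G2"

definition A_op :: "(real \<Rightarrow> real Matrix.vec) \<Rightarrow> (real \<Rightarrow> real Matrix.vec)" where
  "A_op = PI_op a b nx A0_hat A1_hat A2_hat"

end

text \<open>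
  Solutions of \<open>\<T> (d/dt) xf = \<A> xf\<close> for operators on \<open>L\<^sub>2\<^sup>m\<close>. Since the derivative of \<open>xf\<close> is
  taken in the completion for the norm \<open>\<parallel>\<T> u\<parallel>\<close>, which \<open>\<T>\<close> maps isometrically into \<open>L\<^sub>2\<close>,
  differentiability of \<open>xf\<close> means differentiability of \<open>t \<mapsto> \<T> (xf t)\<close> in \<open>L\<^sub>2\<close>, and
  \<open>\<T> (d/dt) xf\<close> denotes the derivative of the latter.
\<close>

definition satisfies_PIE ::
    "real \<Rightarrow> real \<Rightarrow> nat \<Rightarrow> ((real \<Rightarrow> real Matrix.vec) \<Rightarrow> (real \<Rightarrow> real Matrix.vec)) \<Rightarrow>
     ((real \<Rightarrow> real Matrix.vec) \<Rightarrow> (real \<Rightarrow> real Matrix.vec)) \<Rightarrow>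
     (real \<Rightarrow> real Matrix.vec) \<Rightarrow> (real \<Rightarrow> real \<Rightarrow> real Matrix.vec) \<Rightarrow> bool" where
  "satisfies_PIE a b m \<T> \<A> xf0 xf \<longleftrightarrow>
     (\<forall>t\<ge>0. xf t \<in> L2 a b m) \<and>
     (AE t in lebesgue_on {0..}. L2_differentiable a b m (\<lambda>\<tau>. \<T> (xf \<tau>)) t) \<and>
     L2_eq a b (xf 0) xf0 \<and>
     (AE t in lebesgue_on {0..}. L2_eq a b (L2_deriv a b m (\<lambda>\<tau>. \<T> (xf \<tau>)) t) (\<A> (xf t)))"

end

theory Submission
  imports Defs
begin

text \<open>
  Put \<open>f = D_op x\<close>, the fundamental state \<open>col(x0, d x1, d^2 x2)\<close>. The theorem rests on two identities,
  valid almost everywhere on \<open>[a,b]\<close> for every \<open>x\<close> in \<open>X\<close>: \<open>T_op f = x\<close> (\<open>T_op_D_op\<close>), and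
  \<open>A_op f = PI_op A0 A1 A2 (xD x)\<close>, the right-hand side of the PDE (\<open>A_op_D_op\<close>). Given these, \<open>t \<mapsto> x t\<close> and
  \<open>t \<mapsto> T_op (D_op (x t))\<close> are the same curve in \<open>L\<^sub>2\<close>, so they have the same derivatives, and the two
  equations say the same. The initial conditions match because almost everywhere equal states have
  equal weak derivatives, and conversely \<open>T_op\<close> recovers the state from its fundamental state.

  For the first identity, a weakly differentiable function on an interval is almost everywhere a
  constant plus the integral of its weak derivative (\<open>weak_derivative_primitive\<close>, from the lemma of
  du Bois-Reymond). Hence the continuous part \<open>xc = col(x1, x2, d x2)\<close> obeys Taylor's formula
  \<open>xc(s) = Tmat(s-a) xc(a) + \<integral>\<^sub>a\<^sup>s Qmat(s-\<theta>) f(\<theta>) d\<theta>\<close> (\<open>xc_representation\<close>). Inserted into the boundary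
  conditions, this is a linear system with matrix \<open>BT\<close> for \<open>xc(a)\<close>; admissibility means that it can be
  solved, with the result \<open>xc(a) = \<integral>\<^sub>a\<^sup>b BQ f\<close> (\<open>boundary_value\<close>). So \<open>xc\<close>, and with it every constant
  linear combination of \<open>xc\<close> and \<open>f\<close>, is a partial integral operator applied to \<open>f\<close>
  (\<open>fundamental_state_PI\<close>). The state \<open>x\<close> and the vector \<open>xD\<close> are such combinations.

  The second identity then is the formula for the composition of two partial integral operators
  (\<open>PI_op_compose\<close>), which is Fubini's theorem on the square together with a case distinction on
  which side of the diagonal the kernels are evaluated. The integrals may be exchanged for one class
  of kernels that contains all those needed: those bounded, uniformly in the first variable, by a square integrable function
  of the second (\<open>L2_kernel\<close>).
\<close>

section \<open>Scalar integrals on a compact interval\<close>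

lemma lebesgue_on_AE_subset:
  fixes S T :: "real set"
  assumes "AE x in lebesgue_on S. P x" "T \<subseteq> S" "S \<in> sets lebesgue" "T \<in> sets lebesgue"
  shows "AE x in lebesgue_on T. P x"
proof -
  have "AE x in lebesgue. x \<in> S \<longrightarrow> P x"
    using assms by (simp add: AE_restrict_space_iff)
  then have "AE x in lebesgue. x \<in> T \<longrightarrow> P x"
    by eventually_elim (use assms(2) in auto)
  then show ?thesis
    using assms by (simp add: AE_restrict_space_iff)
qed

lemma LINT_cong_AE:
  fixes f g :: "real \<Rightarrow> real"
  assumes ae: "AE x in lebesgue_on S. f x = g x" and S: "S \<in> sets lebesgue"
  shows "integral\<^sup>L (lebesgue_on S) f = integral\<^sup>L (lebesgue_on S) g"
    and "integrable (lebesgue_on S) f = integrable (lebesgue_on S) g"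
    and "f \<in> borel_measurable (lebesgue_on S) \<longleftrightarrow> g \<in> borel_measurable (lebesgue_on S)"
proof -
  let ?f = "\<lambda>x. indicator S x *\<^sub>R f x" and ?g = "\<lambda>x. indicator S x *\<^sub>R g x"
  have ae': "AE x in lebesgue. ?f x = ?g x"
    using ae S by (simp add: AE_restrict_space_iff) (erule eventually_mono, simp add: indicator_def)
  then have ae'': "AE x in lebesgue. ?g x = ?f x"
    by eventually_elim metis
  have restr: "h \<in> borel_measurable (lebesgue_on S) \<longleftrightarrow> (\<lambda>x. indicator S x *\<^sub>R h x) \<in> borel_measurable lebesgue"
    for h :: "real \<Rightarrow> real"
    by (rule borel_measurable_restrict_space_iff) (use S in simp)
  show m: "f \<in> borel_measurable (lebesgue_on S) \<longleftrightarrow> g \<in> borel_measurable (lebesgue_on S)"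
    unfolding restr using borel_measurable_AE[OF _ ae'] borel_measurable_AE[OF _ ae''] by blast
  show i: "integrable (lebesgue_on S) f = integrable (lebesgue_on S) g"
    using m ae integrable_cong_AE[of f "lebesgue_on S" g] borel_measurable_integrable by blast
  show "integral\<^sup>L (lebesgue_on S) f = integral\<^sup>L (lebesgue_on S) g"
    using m i ae integral_cong_AE[of f "lebesgue_on S" g]
    by (metis borel_measurable_integrable not_integrable_integral_eq)
qed

lemma integrable_mult_square:
  fixes f g :: "'a \<Rightarrow> real"
  assumes [measurable]: "f \<in> borel_measurable M" "g \<in> borel_measurable M"
    and "integrable M (\<lambda>x. (f x)\<^sup>2)" "integrable M (\<lambda>x. (g x)\<^sup>2)"
  shows "integrable M (\<lambda>x. f x * g x)"
proof (rule Bochner_Integration.integrable_bound)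
  show "integrable M (\<lambda>x. (f x)\<^sup>2 + (g x)\<^sup>2)"
    using assms by auto
  have "\<bar>u * v\<bar> \<le> u\<^sup>2 + v\<^sup>2" for u v :: real
    using sum_squares_bound[of "\<bar>u\<bar>" "\<bar>v\<bar>"] mult_nonneg_nonneg[of "\<bar>u\<bar>" "\<bar>v\<bar>"]
    unfolding abs_mult power2_abs by linarith
  then show "AE x in M. norm (f x * g x) \<le> norm ((f x)\<^sup>2 + (g x)\<^sup>2)"
    by (intro AE_I2) (metis abs_ge_self order_trans real_norm_def)
qed simp

lemma integrable_square_sum:
  fixes f g :: "'a \<Rightarrow> real"
  assumes [measurable]: "f \<in> borel_measurable M" "g \<in> borel_measurable M"
    and "integrable M (\<lambda>x. (f x)\<^sup>2)" "integrable M (\<lambda>x. (g x)\<^sup>2)"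
  shows "integrable M (\<lambda>x. (f x + g x)\<^sup>2)"
  using assms integrable_mult_square[OF assms] by (auto simp: power2_sum mult.assoc)

lemma (in finite_measure) integrable_square_imp_integrable:
  fixes f :: "'a \<Rightarrow> real"
  assumes "f \<in> borel_measurable M" "integrable M (\<lambda>x. (f x)\<^sup>2)"
  shows "integrable M f"
  using integrable_mult_square[OF assms(1) _ assms(2), of "\<lambda>_. 1"] by simp

lemma finite_measure_lebesgue_on_Icc: "finite_measure (lebesgue_on {a..b::real})"
  by (rule finite_measure_lebesgue_on) (metis cbox_interval lmeasurable_cbox)

lemma integrable_bounded_mult:
  fixes f g :: "'a \<Rightarrow> real"
  assumes "integrable M f" "g \<in> borel_measurable M" "AE x in M. \<bar>g x\<bar> \<le> K"
  shows "integrable M (\<lambda>x. g x * f x)"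
proof (rule Bochner_Integration.integrable_bound[where f = "\<lambda>x. K * f x"])
  show "AE x in M. norm (g x * f x) \<le> norm (K * f x)"
    using assms(3) by eventually_elim (auto simp: abs_mult intro!: mult_right_mono)
qed (use assms in auto)

text \<open>Fubini's theorem for a product \<open>p(t) k(t,\<theta>)\<close> whose second factor is dominated by an
  integrable function of \<open>\<theta>\<close>. Measurability of \<open>k\<close> refers to the product of the two completed measures,
  which is not completed again.\<close>

lemma fubini_dominated:
  fixes p g :: "real \<Rightarrow> real" and k :: "real \<Rightarrow> real \<Rightarrow> real"
  assumes p: "integrable (lebesgue_on {a..b}) p" and g: "integrable (lebesgue_on {a..b}) g"
    and k: "case_prod k \<in> borel_measurable (lebesgue_on {a..b} \<Otimes>\<^sub>M lebesgue_on {a..b})"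
    and bnd: "\<And>t \<theta>. t \<in> {a..b} \<Longrightarrow> \<theta> \<in> {a..b} \<Longrightarrow> \<bar>k t \<theta>\<bar> \<le> g \<theta>"
  shows "(LINT t|lebesgue_on {a..b}. p t * (LINT \<theta>|lebesgue_on {a..b}. k t \<theta>))
       = (LINT \<theta>|lebesgue_on {a..b}. LINT t|lebesgue_on {a..b}. p t * k t \<theta>)"
    and "\<And>t. t \<in> {a..b} \<Longrightarrow> integrable (lebesgue_on {a..b}) (k t)"
    and "integrable (lebesgue_on {a..b}) (\<lambda>t. p t * (LINT \<theta>|lebesgue_on {a..b}. k t \<theta>))"
    and "integrable (lebesgue_on {a..b}) (\<lambda>\<theta>. LINT t|lebesgue_on {a..b}. p t * k t \<theta>)"
proof -
  let ?M = "lebesgue_on {a..b}"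
  interpret M: finite_measure ?M by (rule finite_measure_lebesgue_on_Icc)
  interpret P: pair_sigma_finite ?M ?M by standard
  note [measurable] = k borel_measurable_integrable[OF p] borel_measurable_integrable[OF g]
  show k1: "integrable ?M (k t)" if "t \<in> {a..b}" for t
  proof (rule Bochner_Integration.integrable_bound[OF g])
    show "k t \<in> borel_measurable ?M"
      using measurable_Pair2[OF k, of t] that by simp
    show "AE \<theta> in ?M. norm (k t \<theta>) \<le> norm (g \<theta>)"
      using bnd[OF that] by (intro AE_I2) force
  qed
  have int: "integrable (?M \<Otimes>\<^sub>M ?M) (\<lambda>(t, \<theta>). p t * k t \<theta>)"
  proof (rule P.Fubini_integrable)
    show "(\<lambda>(t, \<theta>). p t * k t \<theta>) \<in> borel_measurable (?M \<Otimes>\<^sub>M ?M)"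
      by measurable
    show "AE t in ?M. integrable ?M (\<lambda>\<theta>. case (t, \<theta>) of (t, \<theta>) \<Rightarrow> p t * k t \<theta>)"
      using k1 by (intro AE_I2) auto
    have eq: "(LINT \<theta>|?M. norm (case (t, \<theta>) of (t, \<theta>) \<Rightarrow> p t * k t \<theta>))
        = \<bar>p t\<bar> * (LINT \<theta>|?M. \<bar>k t \<theta>\<bar>)" for t
      by (simp add: abs_mult)
    show "integrable ?M (\<lambda>t. LINT \<theta>|?M. norm (case (t, \<theta>) of (t, \<theta>) \<Rightarrow> p t * k t \<theta>))"
      unfolding eq
    proof (rule Bochner_Integration.integrable_bound)
      show "integrable ?M (\<lambda>t. \<bar>p t\<bar> * (LINT \<theta>|?M. g \<theta>))" using p by simp
      have "(LINT \<theta>|?M. \<bar>k t \<theta>\<bar>) \<le> (LINT \<theta>|?M. g \<theta>)" if "t \<in> {a..b}" for t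
        using k1[OF that] g bnd[OF that] by (intro integral_mono) auto
      then show "AE t in ?M. norm (\<bar>p t\<bar> * (LINT \<theta>|?M. \<bar>k t \<theta>\<bar>)) \<le> norm (\<bar>p t\<bar> * (LINT \<theta>|?M. g \<theta>))"
        by (intro AE_I2, simp only: real_norm_def abs_mult abs_abs space_lebesgue_on)
          (intro mult_left_mono, auto intro: order_trans[OF _ abs_ge_self])
    qed measurable
  qed
  show "(LINT t|?M. p t * (LINT \<theta>|?M. k t \<theta>)) = (LINT \<theta>|?M. LINT t|?M. p t * k t \<theta>)"
    using P.Fubini_integral[OF int] by simp
  show "integrable ?M (\<lambda>t. p t * (LINT \<theta>|?M. k t \<theta>))"
    using P.integrable_fst[OF int] by simp
  show "integrable ?M (\<lambda>\<theta>. LINT t|?M. p t * k t \<theta>)"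
    using P.integrable_snd[OF int] by simp
qed

lemma measurable_lebesgue_on_ident [measurable]: "(\<lambda>x. x::real) \<in> borel_measurable (lebesgue_on S)"
  using id_borel_measurable_lebesgue_on[of S] by (simp add: id_def)

lemma measurable_snd_le_fst [measurable]:
  "Measurable.pred (lebesgue_on S \<Otimes>\<^sub>M lebesgue_on T) (\<lambda>z. snd z \<le> (fst z :: real))"
proof -
  note [measurable] = measurable_compose[OF measurable_fst measurable_lebesgue_on_ident]
    measurable_compose[OF measurable_snd measurable_lebesgue_on_ident]
  show ?thesis by measurable
qed

lemma AE_lebesgue_on_neq:
  "S \<in> sets lebesgue \<Longrightarrow> AE x in lebesgue_on S. x \<noteq> (c::real)"
  using AE_completion[OF AE_lborel_singleton[of c]] by (auto simp: AE_restrict_space_iff elim!: eventually_mono)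

lemma integral_split_at:
  fixes g h :: "real \<Rightarrow> real"
  assumes "s \<in> {a..b}"
    and int: "integrable (lebesgue_on {a..b}) (\<lambda>\<theta>. if \<theta> \<le> s then g \<theta> else h \<theta>)"
  shows "(LINT \<theta>|lebesgue_on {a..b}. (if \<theta> \<le> s then g \<theta> else h \<theta>))
     = (LINT \<theta>|lebesgue_on {a..s}. g \<theta>) + (LINT \<theta>|lebesgue_on {s..b}. h \<theta>)"
    and "integrable (lebesgue_on {a..s}) g" and "integrable (lebesgue_on {s..b}) h"
proof -
  let ?f = "\<lambda>\<theta>. if \<theta> \<le> s then g \<theta> else h \<theta>"
  have ae: "AE \<theta> in lebesgue_on {s..b}. ?f \<theta> = h \<theta>"
    using AE_lebesgue_on_neq[of "{s..b}" s, simplified] AE_space[of "lebesgue_on {s..b}"]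
    by eventually_elim auto
  have ae': "AE \<theta> in lebesgue_on {a..s}. ?f \<theta> = g \<theta>"
    using AE_space[of "lebesgue_on {a..s}"] by eventually_elim auto
  have i: "integrable (lebesgue_on {a..s}) ?f" "integrable (lebesgue_on {s..b}) ?f"
    using assms integrable_subinterval[OF int] by auto
  show "integrable (lebesgue_on {a..s}) g" and "integrable (lebesgue_on {s..b}) h"
    using i LINT_cong_AE(2)[OF ae] LINT_cong_AE(2)[OF ae'] by auto
  show "integral\<^sup>L (lebesgue_on {a..b}) ?f
     = (LINT \<theta>|lebesgue_on {a..s}. g \<theta>) + (LINT \<theta>|lebesgue_on {s..b}. h \<theta>)"
    using integral_combine[OF int, of s] assms(1)
      LINT_cong_AE(1)[OF ae] LINT_cong_AE(1)[OF ae'] by auto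
qed

text \<open>Integration by parts against the absolutely continuous primitive of \<open>v\<close>.\<close>

lemma integral_primitive_mult_deriv:
  fixes v \<phi> \<phi>' :: "real \<Rightarrow> real"
  assumes v: "integrable (lebesgue_on {a..b}) v"
    and \<phi>: "\<And>s. (\<phi> has_real_derivative \<phi>' s) (at s)" and \<phi>': "continuous_on UNIV \<phi>'"
  shows "(LINT t|lebesgue_on {a..b}. \<phi>' t * (LINT \<theta>|lebesgue_on {a..t}. v \<theta>))
       = (LINT \<theta>|lebesgue_on {a..b}. v \<theta> * (\<phi> b - \<phi> \<theta>))"
    and "integrable (lebesgue_on {a..b}) (\<lambda>t. \<phi>' t * (LINT \<theta>|lebesgue_on {a..t}. v \<theta>))"
    and "integrable (lebesgue_on {a..b}) (\<lambda>\<theta>. v \<theta> * (\<phi> b - \<phi> \<theta>))"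
proof -
  let ?M = "lebesgue_on {a..b}"
  let ?k = "\<lambda>t \<theta>. if \<theta> \<le> t then v \<theta> else 0"
  have cont: "continuous_on S \<phi>'" for S
    using \<phi>' continuous_on_subset by blast
  have p: "integrable ?M \<phi>'"
    by (rule continuous_imp_integrable_real[OF cont])
  have [measurable]: "v \<in> borel_measurable ?M" using v by simp
  have k: "case_prod ?k \<in> borel_measurable (?M \<Otimes>\<^sub>M ?M)"
    unfolding case_prod_beta by measurable
  have bnd: "\<bar>?k t \<theta>\<bar> \<le> \<bar>v \<theta>\<bar>" for t \<theta> by simp
  have g: "integrable ?M (\<lambda>\<theta>. \<bar>v \<theta>\<bar>)" using v by simp
  note F = fubini_dominated[OF p g k bnd]
  have inner: "(LINT \<theta>|?M. ?k t \<theta>) = (LINT \<theta>|lebesgue_on {a..t}. v \<theta>)" if "t \<in> {a..b}" for t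
    using integral_split_at(1)[OF that F(2)[OF that]] by simp
  have outer: "(LINT t|?M. \<phi>' t * ?k t \<theta>) = v \<theta> * (\<phi> b - \<phi> \<theta>)" if t: "\<theta> \<in> {a..b}" for \<theta>
  proof -
    have "(LINT t|?M. \<phi>' t * ?k t \<theta>) = (LINT t|?M. (if t \<in> {\<theta>..b} then v \<theta> * \<phi>' t else 0))"
      using t by (intro Bochner_Integration.integral_cong) auto
    also have "\<dots> = (LINT t|lebesgue_on {\<theta>..b}. v \<theta> * \<phi>' t)"
      using t by (intro integral_restrict) auto
    also have "\<dots> = v \<theta> * integral {\<theta>..b} \<phi>'"
      using lebesgue_integral_eq_integral[OF continuous_imp_integrable_real[OF cont]] by simp
    also have "integral {\<theta>..b} \<phi>' = \<phi> b - \<phi> \<theta>"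
      using t \<phi> by (intro integral_unique fundamental_theorem_of_calculus)
        (auto simp: has_real_derivative_iff_has_vector_derivative[symmetric]
          intro: has_field_derivative_at_within)
    finally show ?thesis .
  qed
  have "(LINT t|?M. \<phi>' t * (LINT \<theta>|?M. ?k t \<theta>)) = (LINT t|?M. \<phi>' t * (LINT \<theta>|lebesgue_on {a..t}. v \<theta>))"
    by (rule Bochner_Integration.integral_cong) (simp_all add: inner)
  moreover have "(LINT \<theta>|?M. LINT t|?M. \<phi>' t * ?k t \<theta>) = (LINT \<theta>|?M. v \<theta> * (\<phi> b - \<phi> \<theta>))"
    by (rule Bochner_Integration.integral_cong) (simp_all only: outer space_lebesgue_on)
  ultimately show "(LINT t|?M. \<phi>' t * (LINT \<theta>|lebesgue_on {a..t}. v \<theta>)) = (LINT \<theta>|?M. v \<theta> * (\<phi> b - \<phi> \<theta>))"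
    using F(1) by metis
  show "integrable ?M (\<lambda>t. \<phi>' t * (LINT \<theta>|lebesgue_on {a..t}. v \<theta>))"
    using F(3) by (rule Bochner_Integration.integrable_cong[THEN iffD1, rotated 2]) (simp_all add: inner)
  show "integrable ?M (\<lambda>\<theta>. v \<theta> * (\<phi> b - \<phi> \<theta>))"
    using F(4) by (rule Bochner_Integration.integrable_cong[THEN iffD1, rotated 2]) (simp_all only: outer space_lebesgue_on)
qed

section \<open>Weak derivatives in one dimension\<close>

lemma continuous_AE_eq_imp_eq:
  fixes f g :: "real \<Rightarrow> real"
  assumes "a < b" "continuous_on {a..b} f" "continuous_on {a..b} g"
    and ae: "AE s in lebesgue_on {a..b}. f s = g s" and "s \<in> {a..b}"
  shows "f s = g s"
proof -
  let ?C = "{s \<in> {a..b}. f s = g s}"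
  have C: "closed ?C"
    using continuous_closed_preimage_constant[of "{a..b}" "\<lambda>s. f s - g s" 0] assms
    by (auto intro: continuous_on_diff)
  have "AE s \<in> {a<..<b} in lebesgue. s \<in> ?C"
    using ae by (auto simp: AE_restrict_space_iff elim!: eventually_mono)
  then have "{a<..<b} \<subseteq> ?C"
    using mem_closed_if_AE_lebesgue_open[OF open_greaterThanLessThan C] by blast
  then have "closure {a<..<b} \<subseteq> ?C"
    using C by (rule closure_minimal)
  then show ?thesis
    using assms(1,5) by (auto simp: closure_greaterThanLessThan)
qed

text \<open>By Lebesgue's differentiation theorem, \<open>g\<close> is almost everywhere the limit of its averages over
  shrinking intervals.\<close>

lemma AE_zero_if_interval_integrals_zero:
  fixes g :: "real \<Rightarrow> real"
  assumes g: "integrable (lebesgue_on {a..b}) g"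
    and zero: "\<And>c d. a < c \<Longrightarrow> c < d \<Longrightarrow> d < b \<Longrightarrow> integral\<^sup>L (lebesgue_on {c..d}) g = 0"
  shows "AE x in lebesgue_on {a..b}. g x = 0"
proof -
  let ?f = "\<lambda>x. if x \<in> {a..b} then g x else 0"
  let ?A = "\<lambda>x e. \<exists>d>0. \<forall>h. 0 < h \<and> h < d \<longrightarrow>
       norm (integral (cbox x (x + h *\<^sub>R One)) ?f /\<^sub>R h ^ DIM(real) - ?f x) < e"
  have cbox: "?f integrable_on cbox c d" for c d
  proof -
    have "g integrable_on {a..b}" by (rule integrable_on_lebesgue_on[OF g]) simp
    then have "?f integrable_on UNIV" by (rule integrable_restrict_UNIV[THEN iffD2])
    then show ?thesis by (rule integrable_on_subcbox) simp
  qed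
  have "\<exists>N. negligible N \<and> (\<forall>x e. x \<notin> N \<longrightarrow> 0 < e \<longrightarrow> ?A x e)"
  proof (rule integrable_ccontinuous_explicit[OF cbox])
    fix N :: "real set"
    assume N: "negligible N" and l: "\<And>x e. x \<notin> N \<Longrightarrow> 0 < e \<Longrightarrow> ?A x e"
    show ?thesis by (intro exI[of _ N] conjI allI impI N l)
  qed
  then obtain N where N: "negligible N" and
    lim: "\<forall>x e. x \<notin> N \<longrightarrow> 0 < e \<longrightarrow> ?A x e"
    by (elim exE conjE) (rule that)
  have "g x = 0" if x: "x \<notin> N" "a < x" "x < b" for x
  proof -
    have "\<bar>g x\<bar> < e" if e: "0 < e" for e
    proof -
      obtain d where d: "d > 0" "\<And>h. 0 < h \<Longrightarrow> h < d \<Longrightarrow> norm (integral {x..x+h} ?f /\<^sub>R h - ?f x) < e"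
        using lim[rule_format, OF x(1) e] by auto
      define h where "h = min (d/2) ((b-x)/2)"
      have h: "0 < h" "h < d" "x + h < b" using d(1) x by (auto simp: h_def min_def field_simps)
      have "integral {x..x+h} ?f = integral {x..x+h} g"
        using x h by (intro Henstock_Kurzweil_Integration.integral_cong) auto
      also have "\<dots> = integral\<^sup>L (lebesgue_on {x..x+h}) g"
        using x h integrable_subinterval[OF g, of x "x+h"]
        by (intro lebesgue_integral_eq_integral[symmetric]) auto
      also have "\<dots> = 0" using x h by (intro zero) auto
      finally show ?thesis using d(2)[OF h(1,2)] x by simp
    qed
    then show ?thesis by (meson abs_ge_zero less_irrefl linorder_neqE_linordered_idom zero_less_abs_iff)
  qed
  then have "x \<notin> N \<and> x \<noteq> a \<and> x \<noteq> b \<Longrightarrow> x \<in> {a..b} \<Longrightarrow> g x = 0" for x by auto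
  moreover have "AE x in lebesgue. x \<notin> N \<union> {a,b}"
    by (rule AE_not_in) (use N in \<open>simp only: negligible_iff_null_sets[symmetric] negligible_Un negligible_finite finite.intros\<close>)
  ultimately have "AE x in lebesgue. x \<in> {a..b} \<longrightarrow> g x = 0"
    by (elim eventually_mono) blast
  then show ?thesis
    by (simp add: AE_restrict_space_iff)
qed

text \<open>A continuous function with compact support in \<open>(a,b)\<close> and mean zero is the derivative of a test
  function, namely of its primitive.\<close>

lemma test_function_of_mean_zero:
  assumes "a < c" "c < d" "d < b" and cont: "continuous_on UNIV \<psi>"
    and supp: "\<And>s. s \<notin> {c..d} \<Longrightarrow> \<psi> s = 0" and zero: "(LINT s|lebesgue_on {a..b}. \<psi> s) = 0"
  shows "\<exists>\<phi>. test_function a b \<phi> \<psi>"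
proof -
  obtain F where F: "\<And>x. (F has_vector_derivative \<psi> x) (at x)"
    using einterval_antiderivative[of "-\<infinity>" \<infinity> \<psi>] cont by (auto simp: continuous_on_eq_continuous_at)
  have F': "(F has_real_derivative \<psi> x) (at x)" for x
    using F by (simp add: has_real_derivative_iff_has_vector_derivative)
  have cF: "continuous_on S F" for S
    using F' by (meson DERIV_isCont continuous_at_imp_continuous_on)
  have const: "F u = F t" if "t < u" "\<And>s. t < s \<Longrightarrow> s < u \<Longrightarrow> \<psi> s = 0" for t u
    by (rule DERIV_isconst_end[OF that(1) cF]) (metis F' that(2))
  have left: "F s = F c" if "s < c" for s
    using const[OF that] supp by force
  have right: "F s = F d" if "d < s" for s
    using const[OF that] supp by force
  have "(LINT s|lebesgue_on {a..b}. \<psi> s) = integral {a..b} \<psi>"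
    using cont by (intro lebesgue_integral_eq_integral continuous_imp_integrable_real)
      (auto intro: continuous_on_subset)
  also have "\<dots> = F b - F a"
    using assms F by (intro integral_unique fundamental_theorem_of_calculus)
      (auto intro: has_vector_derivative_at_within)
  finally have "F d = F c" using zero left[of a] right[of b] assms by simp
  then have "test_function a b (\<lambda>s. F s - F c) \<psi>"
    unfolding test_function_def using assms cont left right
    by (intro conjI exI[of _ c] exI[of _ d]) (auto intro!: derivative_eq_intros F' simp: not_le)
  then show ?thesis by blast
qed

text \<open>The functions \<open>\<psi> k\<close> are continuous, vanish outside \<open>[c,d]\<close>, and converge boundedly to the indicator
  of \<open>(c,d)\<close>.\<close>

lemma tent_integrals:
  assumes "a < c" "c < d" "d < b"
  defines "\<psi> \<equiv> \<lambda>k s. max 0 (min 1 (real k * min (s - c) (d - s)))"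
  shows "continuous_on UNIV (\<psi> k)" and "\<And>s. s \<notin> {c..d} \<Longrightarrow> \<psi> k s = 0"
    and "\<And>w. integrable (lebesgue_on {a..b}) w \<Longrightarrow> integrable (lebesgue_on {a..b}) (\<lambda>s. w s * \<psi> k s)"
    and "\<And>w. integrable (lebesgue_on {a..b}) w \<Longrightarrow>
      (\<lambda>k. LINT s|lebesgue_on {a..b}. w s * \<psi> k s) \<longlonglongrightarrow> integral\<^sup>L (lebesgue_on {c..d}) w"
proof -
  show cont: "continuous_on UNIV (\<psi> k)" for k
    unfolding \<psi>_def by (intro continuous_intros)
  have out: "\<psi> k s = 0" if "s \<notin> {c<..<d}" for s k
  proof -
    have "real k * min (s - c) (d - s) \<le> 0"
      using that by (intro mult_nonneg_nonpos) auto
    then show ?thesis unfolding \<psi>_def by linarith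
  qed
  show "\<psi> k s = 0" if "s \<notin> {c..d}" for s k
    by (rule out) (use that in force)
  have bnd: "0 \<le> \<psi> k s" "\<psi> k s \<le> 1" for k s
    by (auto simp: \<psi>_def)
  have meas [measurable]: "\<psi> k \<in> borel_measurable (lebesgue_on {a..b})" for k
    using continuous_imp_integrable_real[OF continuous_on_subset[OF cont]] by blast
  fix w :: "real \<Rightarrow> real" assume w: "integrable (lebesgue_on {a..b}) w"
  show "integrable (lebesgue_on {a..b}) (\<lambda>s. w s * \<psi> k s)" for k
    using integrable_bounded_mult[OF w meas, of k 1] bnd by (simp add: mult.commute)
  have lim: "(\<lambda>k. \<psi> k s) \<longlonglongrightarrow> (if s \<in> {c<..<d} then 1 else 0)" for s
  proof (cases "s \<in> {c<..<d}")
    case True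
    then have pos: "min (s - c) (d - s) > 0" by auto
    obtain N where N: "1 < real N * min (s - c) (d - s)"
      using ex_less_of_nat_mult[OF pos] by blast
    have "\<psi> k s = 1" if "k \<ge> N" for k
    proof -
      have "real N * min (s - c) (d - s) \<le> real k * min (s - c) (d - s)"
        using that pos by (intro mult_right_mono) auto
      then show ?thesis using N unfolding \<psi>_def by linarith
    qed
    then have "eventually (\<lambda>k. \<psi> k s = 1) sequentially"
      by (auto simp: eventually_sequentially)
    then show ?thesis using True by (simp add: tendsto_eventually)
  next
    case False
    then have "\<psi> k s = 0" for k by (rule out)
    then show ?thesis by (simp only: False if_False tendsto_const)
  qed
  have "(\<lambda>k. LINT s|lebesgue_on {a..b}. w s * \<psi> k s)
      \<longlonglongrightarrow> (LINT s|lebesgue_on {a..b}. w s * (if s \<in> {c<..<d} then 1 else 0))"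
  proof (rule integral_dominated_convergence[where w = "\<lambda>s. \<bar>w s\<bar>"])
    show "AE s in lebesgue_on {a..b}. (\<lambda>k. w s * \<psi> k s) \<longlonglongrightarrow> w s * (if s \<in> {c<..<d} then 1 else 0)"
      by (intro AE_I2 tendsto_mult_left lim)
    show "AE s in lebesgue_on {a..b}. norm (w s * \<psi> k s) \<le> \<bar>w s\<bar>" for k
      using bnd by (intro AE_I2) (simp add: abs_mult mult_left_le)
    show "(\<lambda>s. w s * (if s \<in> {c<..<d} then 1 else 0)) \<in> borel_measurable (lebesgue_on {a..b})"
      using borel_measurable_integrable[OF w] by measurable
    show "(\<lambda>s. w s * \<psi> k s) \<in> borel_measurable (lebesgue_on {a..b})" for k
      using borel_measurable_integrable[OF w] by measurable
  qed (use w in simp)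
  also have "(LINT s|lebesgue_on {a..b}. w s * (if s \<in> {c<..<d} then 1 else 0))
      = (LINT s|lebesgue_on {a..b}. (if s \<in> {c..d} then w s else 0))"
  proof (rule LINT_cong_AE(1))
    show "AE s in lebesgue_on {a..b}. w s * (if s \<in> {c<..<d} then 1 else 0) = (if s \<in> {c..d} then w s else 0)"
      using AE_lebesgue_on_neq[of "{a..b}" c, simplified] AE_lebesgue_on_neq[of "{a..b}" d, simplified]
      by eventually_elim auto
  qed simp
  also have "\<dots> = integral\<^sup>L (lebesgue_on {c..d}) w"
    using assms(1-3) by (intro integral_restrict) auto
  finally show "(\<lambda>k. LINT s|lebesgue_on {a..b}. w s * \<psi> k s) \<longlonglongrightarrow> integral\<^sup>L (lebesgue_on {c..d}) w" .
qed

text \<open>The lemma of du Bois-Reymond: subtracting a multiple of a fixed bump makes any bump have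
  mean zero, hence a derivative of a test function; letting the bumps increase to indicators of
  intervals, the averages of \<open>w\<close> over all intervals agree.\<close>

lemma du_Bois_Reymond:
  fixes w :: "real \<Rightarrow> real"
  assumes "a < b" and w: "integrable (lebesgue_on {a..b}) w"
    and zero: "\<And>\<phi> \<phi>'. test_function a b \<phi> \<phi>' \<Longrightarrow> (LINT s|lebesgue_on {a..b}. w s * \<phi>' s) = 0"
  shows "\<exists>K. AE s in lebesgue_on {a..b}. w s = K"
proof -
  let ?M = "lebesgue_on {a..b}"
  interpret M: finite_measure ?M by (rule finite_measure_lebesgue_on_Icc)
  define \<psi> where "\<psi> = (\<lambda>c d k s. max 0 (min 1 (real k * min (s - c) (d - s))))"
  have tent: "continuous_on UNIV (\<psi> c d k)" "s \<notin> {c..d} \<Longrightarrow> \<psi> c d k s = 0"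
    "integrable ?M g \<Longrightarrow> integrable ?M (\<lambda>s. g s * \<psi> c d k s)"
    "integrable ?M g \<Longrightarrow> (\<lambda>k. LINT s|?M. g s * \<psi> c d k s) \<longlonglongrightarrow> integral\<^sup>L (lebesgue_on {c..d}) g"
    if "a < c" "c < d" "d < b" for c d k s g
    using tent_integrals[OF that] unfolding \<psi>_def by blast+
  \<comment> \<open>the fixed bump, on the middle third of the interval, and its mass \<open>m\<close>\<close>
  define c0 d0 where "c0 = a + (b-a)/3" and "d0 = a + 2*(b-a)/3"
  have cd0: "a < c0" "c0 < d0" "d0 < b" using \<open>a < b\<close> by (auto simp: c0_def d0_def field_simps)
  have int1: "integrable ?M (\<psi> c d k)" if "a < c" "c < d" "d < b" for c d k
    using tent(3)[OF that, of "\<lambda>_. 1"] by simp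
  have "(\<lambda>k. integral\<^sup>L ?M (\<psi> c0 d0 k)) \<longlonglongrightarrow> integral\<^sup>L (lebesgue_on {c0..d0}) (\<lambda>_. 1)"
    using tent(4)[OF cd0, of "\<lambda>_. 1"] by simp
  moreover have "integral\<^sup>L (lebesgue_on {c0..d0}) (\<lambda>_. 1) > (0::real)"
    using cd0 by (simp add: measure_restrict_space)
  ultimately have "eventually (\<lambda>k. integral\<^sup>L ?M (\<psi> c0 d0 k) > 0) sequentially"
    by (rule order_tendstoD(1))
  then obtain k0 where m: "integral\<^sup>L ?M (\<psi> c0 d0 k0) > 0"
    by (auto simp: eventually_sequentially)
  define m where "m = integral\<^sup>L ?M (\<psi> c0 d0 k0)"
  define K where "K = (LINT s|?M. w s * \<psi> c0 d0 k0 s) / m"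
  have key: "(LINT s|?M. (w s - K) * \<psi> c d k s) = 0" if cd: "a < c" "c < d" "d < b" for c d k
  proof -
    define r where "r = integral\<^sup>L ?M (\<psi> c d k) / m"
    let ?\<eta> = "\<lambda>s. \<psi> c d k s - r * \<psi> c0 d0 k0 s"
    have "\<exists>\<phi>. test_function a b \<phi> ?\<eta>"
    proof (rule test_function_of_mean_zero[of a "min c c0" "max d d0"])
      show "continuous_on UNIV ?\<eta>"
        by (intro continuous_intros tent(1) cd cd0)
      show "?\<eta> s = 0" if "s \<notin> {min c c0..max d d0}" for s
      proof -
        have "s \<notin> {c..d}" "s \<notin> {c0..d0}" using that by (auto simp: min_le_iff_disj le_max_iff_disj)
        then show ?thesis using tent(2)[OF cd] tent(2)[OF cd0] by simp
      qed
      show "integral\<^sup>L ?M ?\<eta> = 0"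
        using int1[OF cd] int1[OF cd0] m by (simp add: r_def m_def)
    qed (use cd cd0 in auto)
    then have "(LINT s|?M. w s * ?\<eta> s) = 0" using zero by blast
    moreover have "(LINT s|?M. w s * ?\<eta> s) = (LINT s|?M. w s * \<psi> c d k s - r * (w s * \<psi> c0 d0 k0 s))"
      by (simp add: algebra_simps)
    ultimately have "(LINT s|?M. w s * \<psi> c d k s) = r * (LINT s|?M. w s * \<psi> c0 d0 k0 s)"
      using tent(3)[OF cd w] tent(3)[OF cd0 w] by simp
    also have "\<dots> = K * integral\<^sup>L ?M (\<psi> c d k)"
      by (simp add: r_def K_def)
    finally show ?thesis
      using tent(3)[OF cd w] int1[OF cd] by (simp add: left_diff_distrib)
  qed
  have wK: "integrable ?M (\<lambda>s. w s - K)" using w by simp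
  have "integral\<^sup>L (lebesgue_on {c..d}) (\<lambda>s. w s - K) = 0" if cd: "a < c" "c < d" "d < b" for c d
    using tent(4)[OF cd wK] by (simp add: key[OF cd] LIMSEQ_const_iff)
  from AE_zero_if_interval_integrals_zero[OF wK this]
  have "AE s in ?M. w s - K = 0" by simp
  then show ?thesis by (intro exI[of _ K]) simp
qed

text \<open>Integration by parts shows that \<open>u\<close> minus the primitive of \<open>v\<close> is orthogonal to all derivatives of
  test functions.\<close>

lemma weak_derivative_primitive:
  fixes u v :: "real \<Rightarrow> real"
  assumes "a < b" and u: "integrable (lebesgue_on {a..b}) u" and v: "integrable (lebesgue_on {a..b}) v"
    and weak: "\<And>\<phi> \<phi>'. test_function a b \<phi> \<phi>' \<Longrightarrow>
      (LINT s|lebesgue_on {a..b}. u s * \<phi>' s) = - (LINT s|lebesgue_on {a..b}. v s * \<phi> s)"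
  shows "\<exists>C. AE s in lebesgue_on {a..b}. u s = C + (LINT \<theta>|lebesgue_on {a..s}. v \<theta>)"
proof -
  let ?M = "lebesgue_on {a..b}"
  let ?V = "\<lambda>s. LINT \<theta>|lebesgue_on {a..s}. v \<theta>"
  have V: "integrable ?M ?V"
    by (rule continuous_imp_integrable_real[OF indefinite_integral_continuous_real[OF v]])
  have "\<exists>K. AE s in ?M. u s - ?V s = K"
  proof (rule du_Bois_Reymond[OF \<open>a < b\<close>])
    show "integrable ?M (\<lambda>s. u s - ?V s)" using u V by simp
    fix \<phi> \<phi>' assume t: "test_function a b \<phi> \<phi>'"
    then have \<phi>: "\<And>s. (\<phi> has_real_derivative \<phi>' s) (at s)" and \<phi>': "continuous_on UNIV \<phi>'" and b: "\<phi> b = 0"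
      unfolding test_function_def by auto
    note I = integral_primitive_mult_deriv[OF v \<phi> \<phi>']
    have "\<exists>C. \<forall>s\<in>{a..b}. \<bar>\<phi>' s\<bar> \<le> C"
      using compact_continuous_image[OF continuous_on_subset[OF \<phi>'], of "{a..b}"]
      by (force dest!: compact_imp_bounded simp: bounded_iff)
    then obtain C where C: "\<And>s. s \<in> {a..b} \<Longrightarrow> \<bar>\<phi>' s\<bar> \<le> C" by blast
    have m: "\<phi>' \<in> borel_measurable ?M"
      using continuous_imp_integrable_real[OF continuous_on_subset[OF \<phi>']] by blast
    have u': "integrable ?M (\<lambda>s. \<phi>' s * u s)"
      using C by (intro integrable_bounded_mult[OF u m, of C]) (auto intro!: AE_I2)
    have "(LINT s|?M. (u s - ?V s) * \<phi>' s) = (LINT s|?M. \<phi>' s * u s - \<phi>' s * ?V s)"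
      by (simp add: algebra_simps)
    also have "\<dots> = (LINT s|?M. u s * \<phi>' s) - (LINT \<theta>|?M. v \<theta> * (\<phi> b - \<phi> \<theta>))"
      using u' I by (simp add: mult.commute)
    also have "\<dots> = 0" using weak[OF t] b by simp
    finally show "(LINT s|?M. (u s - ?V s) * \<phi>' s) = 0" .
  qed
  then obtain K where "AE s in ?M. u s - ?V s = K" ..
  then have "AE s in ?M. u s = K + ?V s" by eventually_elim simp
  then show ?thesis ..
qed

text \<open>Both sides of the assumed equality are continuous, so it holds everywhere, and \<open>v - v'\<close> integrates
  to zero over every interval.\<close>

lemma primitive_unique:
  fixes v v' :: "real \<Rightarrow> real"
  assumes "a < b" and v: "integrable (lebesgue_on {a..b}) v" and v': "integrable (lebesgue_on {a..b}) v'"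
    and eq: "AE s in lebesgue_on {a..b}. C + (LINT \<theta>|lebesgue_on {a..s}. v \<theta>) = C' + (LINT \<theta>|lebesgue_on {a..s}. v' \<theta>)"
  shows "AE s in lebesgue_on {a..b}. v s = v' s"
proof -
  have e: "C + (LINT \<theta>|lebesgue_on {a..s}. v \<theta>) = C' + (LINT \<theta>|lebesgue_on {a..s}. v' \<theta>)" if "s \<in> {a..b}" for s
    by (rule continuous_AE_eq_imp_eq[OF \<open>a < b\<close> _ _ eq that])
      (intro continuous_intros indefinite_integral_continuous_real v v')+
  have "integral\<^sup>L (lebesgue_on {c..d}) (\<lambda>s. v s - v' s) = 0" if cd: "a < c" "c < d" "d < b" for c d
  proof -
    have i: "integrable (lebesgue_on {c'..d'}) v" "integrable (lebesgue_on {c'..d'}) v'" if "a \<le> c'" "d' \<le> b" for c' d'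
      using that by (auto intro: integrable_subinterval[OF v] integrable_subinterval[OF v'])
    show ?thesis
      using integral_combine[OF i(1)[of a d], of c] integral_combine[OF i(2)[of a d], of c] i[of c d]
        e[of c] e[of d] cd by simp
  qed
  from AE_zero_if_interval_integrals_zero[OF _ this] v v'
  have "AE s in lebesgue_on {a..b}. v s - v' s = 0" by simp
  then show ?thesis by simp
qed

section \<open>Componentwise integrals of vector and matrix functions\<close>

lemma mult_mat_vec_index:
  assumes "M \<in> carrier_mat r c" "v \<in> carrier_vec c" "i < r"
  shows "(M *\<^sub>v v) $ i = (\<Sum>j<c. M $$ (i,j) * v $ j)"
  using assms by (auto simp: scalar_prod_def atLeast0LessThan intro!: sum.cong)

lemma mult_mat_index:
  assumes "M \<in> carrier_mat r m" "N \<in> carrier_mat m c" "i < r" "k < c"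
  shows "(M * N) $$ (i,k) = (\<Sum>j<m. M $$ (i,j) * N $$ (j,k))"
  using assms by (auto simp: scalar_prod_def atLeast0LessThan intro!: sum.cong)

text \<open>Componentwise integrability on \<open>S\<close>, for vectors and matrices. The dimension is required at every
  point of \<open>S\<close>, nothing outside.\<close>

definition vec_integrable :: "nat \<Rightarrow> real set \<Rightarrow> (real \<Rightarrow> real Matrix.vec) \<Rightarrow> bool" where
  "vec_integrable m S f \<longleftrightarrow> (\<forall>s\<in>S. f s \<in> carrier_vec m) \<and>
     (\<forall>i<m. integrable (lebesgue_on S) (\<lambda>s. f s $ i))"

definition mat_integrable :: "nat \<Rightarrow> nat \<Rightarrow> real set \<Rightarrow> (real \<Rightarrow> real Matrix.mat) \<Rightarrow> bool" where
  "mat_integrable r c S F \<longleftrightarrow> (\<forall>s\<in>S. F s \<in> carrier_mat r c) \<and>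
     (\<forall>i<r. \<forall>j<c. integrable (lebesgue_on S) (\<lambda>s. F s $$ (i,j)))"

lemma vec_integrableD:
  assumes "vec_integrable m S f"
  shows "s \<in> S \<Longrightarrow> f s \<in> carrier_vec m" and "s \<in> S \<Longrightarrow> dim_vec (f s) = m"
    and "i < m \<Longrightarrow> integrable (lebesgue_on S) (\<lambda>s. f s $ i)"
  using assms unfolding vec_integrable_def by (blast, blast intro: carrier_vecD, blast)

lemma mat_integrableD:
  assumes "mat_integrable r c S F"
  shows "s \<in> S \<Longrightarrow> F s \<in> carrier_mat r c"
    and "i < r \<Longrightarrow> j < c \<Longrightarrow> integrable (lebesgue_on S) (\<lambda>s. F s $$ (i,j))"
  using assms unfolding mat_integrable_def by blast+

lemma vec_integral_carrier [simp]: "vec_integral m S f \<in> carrier_vec m"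
  and vec_integral_dim [simp]: "dim_vec (vec_integral m S f) = m"
  and vec_integral_index [simp]: "i < m \<Longrightarrow> vec_integral m S f $ i = (LINT s|lebesgue_on S. f s $ i)"
  by (auto simp: vec_integral_def)

lemma mat_integral_carrier [simp]: "mat_integral r c S F \<in> carrier_mat r c"
  and mat_integral_dim [simp]: "dim_row (mat_integral r c S F) = r" "dim_col (mat_integral r c S F) = c"
  and mat_integral_index [simp]: "i < r \<Longrightarrow> j < c \<Longrightarrow>
        mat_integral r c S F $$ (i,j) = (LINT s|lebesgue_on S. F s $$ (i,j))"
  by (auto simp: mat_integral_def)

lemma integrable_on_cong:
  fixes f g :: "real \<Rightarrow> real"
  assumes "\<And>s. s \<in> S \<Longrightarrow> f s = g s"
  shows "integrable (lebesgue_on S) f = integrable (lebesgue_on S) g"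
  by (rule Bochner_Integration.integrable_cong) (use assms in auto)

lemma LINT_cong:
  fixes f g :: "real \<Rightarrow> real"
  assumes "\<And>s. s \<in> S \<Longrightarrow> f s = g s"
  shows "integral\<^sup>L (lebesgue_on S) f = integral\<^sup>L (lebesgue_on S) g"
  by (rule Bochner_Integration.integral_cong) (use assms in auto)

lemma vec_integral_cong:
  assumes "\<And>s. s \<in> S \<Longrightarrow> f s = g s"
  shows "vec_integral m S f = vec_integral m S g"
  unfolding vec_integral_def by (intro vec_eq_iff[THEN iffD2] conjI allI impI)
    (simp_all add: LINT_cong[of S, OF arg_cong[of _ _ "\<lambda>u. u $ _"], OF assms])

lemma vec_integral_cong_AE:
  assumes "AE s in lebesgue_on S. f s = g s" "S \<in> sets lebesgue"
  shows "vec_integral m S f = vec_integral m S g"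
proof (intro eq_vecI)
  fix i assume i: "i < dim_vec (vec_integral m S g)"
  have "AE s in lebesgue_on S. f s $ i = g s $ i"
    using assms(1) by (elim eventually_mono) simp
  then show "vec_integral m S f $ i = vec_integral m S g $ i"
    using i by (simp add: LINT_cong_AE(1)[OF _ assms(2)])
qed simp

lemma vec_integrable_cong:
  assumes "\<And>s. s \<in> S \<Longrightarrow> f s = g s"
  shows "vec_integrable m S f = vec_integrable m S g"
  unfolding vec_integrable_def using assms
  by (simp add: integrable_on_cong[of S "\<lambda>s. f s $ _" "\<lambda>s. g s $ _"])

lemma vec_integrable_cong_AE:
  assumes "AE s in lebesgue_on S. f s = g s" "S \<in> sets lebesgue" "vec_integrable m S g"
    and "\<And>s. s \<in> S \<Longrightarrow> f s \<in> carrier_vec m"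
  shows "vec_integrable m S f"
  unfolding vec_integrable_def
proof (intro conjI ballI allI impI)
  fix i assume i: "i < m"
  have ae: "AE s in lebesgue_on S. f s $ i = g s $ i"
    using assms(1) by (elim eventually_mono) simp
  show "integrable (lebesgue_on S) (\<lambda>s. f s $ i)"
    by (rule LINT_cong_AE(2)[THEN iffD2, OF ae assms(2) vec_integrableD(3)[OF assms(3) i]])
qed (rule assms)

lemma vec_integral_add:
  assumes f: "vec_integrable m S f" and g: "vec_integrable m S g"
  shows "vec_integral m S (\<lambda>s. f s + g s) = vec_integral m S f + vec_integral m S g"
    and "vec_integrable m S (\<lambda>s. f s + g s)"
proof -
  have idx: "(f s + g s) $ i = f s $ i + g s $ i" if "s \<in> S" "i < m" for s i
    using that vec_integrableD(2)[OF g] by simp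
  show "vec_integrable m S (\<lambda>s. f s + g s)"
    unfolding vec_integrable_def
    by (simp add: integrable_on_cong[OF idx] vec_integrableD[OF f] vec_integrableD[OF g])
  show "vec_integral m S (\<lambda>s. f s + g s) = vec_integral m S f + vec_integral m S g"
    by (intro eq_vecI) (simp_all add: LINT_cong[OF idx] vec_integrableD[OF f] vec_integrableD[OF g])
qed

lemma vec_integral_mult_mat:
  assumes f: "vec_integrable m S f" and M: "M \<in> carrier_mat r m"
  shows "vec_integral r S (\<lambda>s. M *\<^sub>v f s) = M *\<^sub>v vec_integral m S f"
    and "vec_integrable r S (\<lambda>s. M *\<^sub>v f s)"
proof -
  have idx: "(M *\<^sub>v f s) $ i = (\<Sum>j<m. M $$ (i,j) * f s $ j)" if "s \<in> S" "i < r" for s i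
    using mult_mat_vec_index[OF M] vec_integrableD[OF f] that by blast
  show "vec_integrable r S (\<lambda>s. M *\<^sub>v f s)"
    unfolding vec_integrable_def
  proof (intro conjI ballI allI impI)
    fix i assume i: "i < r"
    show "integrable (lebesgue_on S) (\<lambda>s. (M *\<^sub>v f s) $ i)"
      by (rule integrable_on_cong[THEN iffD2, OF idx[OF _ i]], assumption,
        intro Bochner_Integration.integrable_sum integrable_mult_right vec_integrableD(3)[OF f]) simp
  qed (rule mult_mat_vec_carrier[OF M vec_integrableD(1)[OF f]])
  show "vec_integral r S (\<lambda>s. M *\<^sub>v f s) = M *\<^sub>v vec_integral m S f"
    using M by (intro eq_vecI) (simp_all add: LINT_cong[OF idx] vec_integrableD[OF f]
        mult_mat_vec_index[OF M vec_integral_carrier] del: index_mult_mat_vec)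
qed

lemma mat_integral_mult_vec:
  assumes F: "mat_integrable r c S F" and v: "v \<in> carrier_vec c"
  shows "vec_integral r S (\<lambda>s. F s *\<^sub>v v) = mat_integral r c S F *\<^sub>v v"
    and "vec_integrable r S (\<lambda>s. F s *\<^sub>v v)"
proof -
  have idx: "(F s *\<^sub>v v) $ i = (\<Sum>j<c. F s $$ (i,j) * v $ j)" if "s \<in> S" "i < r" for s i
    using mult_mat_vec_index[OF _ v] mat_integrableD[OF F] that by blast
  show "vec_integrable r S (\<lambda>s. F s *\<^sub>v v)"
    unfolding vec_integrable_def
  proof (intro conjI ballI allI impI)
    fix i assume i: "i < r"
    show "integrable (lebesgue_on S) (\<lambda>s. (F s *\<^sub>v v) $ i)"
      by (rule integrable_on_cong[THEN iffD2, OF idx[OF _ i]], assumption,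
        intro Bochner_Integration.integrable_sum integrable_mult_left mat_integrableD(2)[OF F] i) simp
  qed (rule mult_mat_vec_carrier[OF mat_integrableD(1)[OF F] v])
  show "vec_integral r S (\<lambda>s. F s *\<^sub>v v) = mat_integral r c S F *\<^sub>v v"
    by (intro eq_vecI) (simp_all add: LINT_cong[OF idx] mat_integrableD[OF F]
        mult_mat_vec_index[OF mat_integral_carrier v] del: index_mult_mat_vec)
qed

lemma if_vec_index: "(if P then u else w) $ i = (if P then u $ i else w $ i)"
  and if_mat_index: "(if P then M else N) $$ ij = (if P then M $$ ij else N $$ ij)"
  by simp_all

lemma vec_integral_split:
  assumes s: "s \<in> {a..b}" and int: "vec_integrable m {a..b} (\<lambda>\<theta>. if \<theta> \<le> s then g \<theta> else h \<theta>)"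
  shows "vec_integral m {a..b} (\<lambda>\<theta>. if \<theta> \<le> s then g \<theta> else h \<theta>)
    = vec_integral m {a..s} g + vec_integral m {s..b} h"
proof (intro eq_vecI)
  fix i assume "i < dim_vec (vec_integral m {a..s} g + vec_integral m {s..b} h)"
  then have i: "i < m" by simp
  show "vec_integral m {a..b} (\<lambda>\<theta>. if \<theta> \<le> s then g \<theta> else h \<theta>) $ i
    = (vec_integral m {a..s} g + vec_integral m {s..b} h) $ i"
    using integral_split_at(1)[OF s vec_integrableD(3)[OF int i, unfolded if_vec_index]] i by (simp add: if_vec_index)
qed simp

lemma mat_integral_split:
  assumes s: "s \<in> {a..b}" and int: "mat_integrable r c {a..b} (\<lambda>\<theta>. if \<theta> \<le> s then G \<theta> else H \<theta>)"
  shows "mat_integral r c {a..b} (\<lambda>\<theta>. if \<theta> \<le> s then G \<theta> else H \<theta>)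
    = mat_integral r c {a..s} G + mat_integral r c {s..b} H"
    and "mat_integrable r c {a..s} G"
proof -
  note I = integral_split_at[OF s mat_integrableD(2)[OF int, unfolded if_mat_index]]
  show "mat_integral r c {a..b} (\<lambda>\<theta>. if \<theta> \<le> s then G \<theta> else H \<theta>)
    = mat_integral r c {a..s} G + mat_integral r c {s..b} H"
    using I(1) by (intro eq_matI) (auto simp: if_mat_index)
  have "G \<theta> \<in> carrier_mat r c" if "\<theta> \<in> {a..s}" for \<theta>
    using mat_integrableD(1)[OF int, of \<theta>] that s by auto
  then show "mat_integrable r c {a..s} G"
    unfolding mat_integrable_def using I(2) by blast
qed

section \<open>Square integrable functions and kernels\<close>

lemma L2D:
  assumes "u \<in> L2 a b m"
  shows "s \<in> {a..b} \<Longrightarrow> u s \<in> carrier_vec m"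
    and "i < m \<Longrightarrow> (\<lambda>s. u s $ i) \<in> borel_measurable (lebesgue_on {a..b})"
    and "i < m \<Longrightarrow> integrable (lebesgue_on {a..b}) (\<lambda>s. (u s $ i)\<^sup>2)"
  using assms by (auto simp: L2_def)

lemma L2_imp_vec_integrable: "u \<in> L2 a b m \<Longrightarrow> vec_integrable m {a..b} u"
  unfolding vec_integrable_def
  using finite_measure.integrable_square_imp_integrable[OF finite_measure_lebesgue_on_Icc] L2D by blast

text \<open>A jointly measurable function of \<open>(t,\<theta>)\<close> is called an \<open>L\<^sub>2\<close> kernel if it is bounded, uniformly in
  \<open>t\<close>, by a square integrable function of \<open>\<theta>\<close>. Multiplied by an \<open>L\<^sub>2\<close> function of \<open>\<theta>\<close> and an
  integrable function of \<open>t\<close> it becomes integrable on the square.\<close>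

definition L2_kernel :: "real \<Rightarrow> real \<Rightarrow> (real \<Rightarrow> real \<Rightarrow> real) \<Rightarrow> bool" where
  "L2_kernel a b k \<longleftrightarrow>
     case_prod k \<in> borel_measurable (lebesgue_on {a..b} \<Otimes>\<^sub>M lebesgue_on {a..b}) \<and>
     (\<exists>r. r \<in> borel_measurable (lebesgue_on {a..b}) \<and> integrable (lebesgue_on {a..b}) (\<lambda>\<theta>. (r \<theta>)\<^sup>2) \<and>
        (\<forall>t\<in>{a..b}. \<forall>\<theta>\<in>{a..b}. \<bar>k t \<theta>\<bar> \<le> r \<theta>))"

text \<open>A matrix kernel on the square \<open>[a,b]\<^sup>2\<close> whose entries are \<open>L\<^sub>2\<close> kernels.\<close>

definition mat_kernel :: "real \<Rightarrow> real \<Rightarrow> nat \<Rightarrow> nat \<Rightarrow> (real \<Rightarrow> real \<Rightarrow> real Matrix.mat) \<Rightarrow> bool" where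
  "mat_kernel a b m c K \<longleftrightarrow> (\<forall>t\<in>{a..b}. \<forall>\<theta>\<in>{a..b}. K t \<theta> \<in> carrier_mat m c) \<and>
     (\<forall>j<m. \<forall>k<c. L2_kernel a b (\<lambda>t \<theta>. K t \<theta> $$ (j,k)))"

lemma L2_kernel_dominated:
  assumes k: "L2_kernel a b k" and k': "L2_kernel a b k'"
    and m: "case_prod h \<in> borel_measurable (lebesgue_on {a..b} \<Otimes>\<^sub>M lebesgue_on {a..b})"
    and le: "\<And>t \<theta>. \<bar>h t \<theta>\<bar> \<le> \<bar>k t \<theta>\<bar> + \<bar>k' t \<theta>\<bar>"
  shows "L2_kernel a b h"
proof -
  let ?M = "lebesgue_on {a..b}"
  from k obtain r where r: "r \<in> borel_measurable ?M" "integrable ?M (\<lambda>\<theta>. (r \<theta>)\<^sup>2)"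
      "\<And>t \<theta>. t\<in>{a..b} \<Longrightarrow> \<theta>\<in>{a..b} \<Longrightarrow> \<bar>k t \<theta>\<bar> \<le> r \<theta>"
    unfolding L2_kernel_def by metis
  from k' obtain r' where r': "r' \<in> borel_measurable ?M" "integrable ?M (\<lambda>\<theta>. (r' \<theta>)\<^sup>2)"
      "\<And>t \<theta>. t\<in>{a..b} \<Longrightarrow> \<theta>\<in>{a..b} \<Longrightarrow> \<bar>k' t \<theta>\<bar> \<le> r' \<theta>"
    unfolding L2_kernel_def by metis
  have "\<bar>h t \<theta>\<bar> \<le> r \<theta> + r' \<theta>" if "t\<in>{a..b}" "\<theta>\<in>{a..b}" for t \<theta>
    using le[of t \<theta>] r(3)[OF that] r'(3)[OF that] by linarith
  then show ?thesis
    unfolding L2_kernel_def using m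
      integrable_square_sum[OF r(1) r'(1) r(2) r'(2)] borel_measurable_add[OF r(1) r'(1)] by blast
qed

lemma L2_kernel_add:
  assumes "L2_kernel a b k" "L2_kernel a b k'"
  shows "L2_kernel a b (\<lambda>t \<theta>. k t \<theta> + k' t \<theta>)"
proof (rule L2_kernel_dominated[OF assms])
  show "(\<lambda>(t, \<theta>). k t \<theta> + k' t \<theta>) \<in> borel_measurable (lebesgue_on {a..b} \<Otimes>\<^sub>M lebesgue_on {a..b})"
    using assms[unfolded L2_kernel_def, THEN conjunct1] by measurable
qed (rule abs_triangle_ineq)

lemma L2_kernel_if:
  assumes "L2_kernel a b k" "L2_kernel a b k'"
  shows "L2_kernel a b (\<lambda>t \<theta>. if \<theta> \<le> t then k t \<theta> else k' t \<theta>)"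
proof (rule L2_kernel_dominated[OF assms])
  note [measurable] = assms[unfolded L2_kernel_def, THEN conjunct1]
  show "(\<lambda>(t, \<theta>). if \<theta> \<le> t then k t \<theta> else k' t \<theta>) \<in> borel_measurable (lebesgue_on {a..b} \<Otimes>\<^sub>M lebesgue_on {a..b})"
    unfolding case_prod_beta by measurable
qed simp

lemma L2_kernel_zero: "L2_kernel a b (\<lambda>t \<theta>. 0)"
  unfolding L2_kernel_def by (auto intro!: exI[of _ "\<lambda>_. 0"])

lemma L2_kernel_sum:
  "finite A \<Longrightarrow> (\<And>i. i \<in> A \<Longrightarrow> L2_kernel a b (k i)) \<Longrightarrow> L2_kernel a b (\<lambda>t \<theta>. \<Sum>i\<in>A. k i t \<theta>)"
  by (induction A rule: finite_induct) (auto intro!: L2_kernel_zero L2_kernel_add)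

lemma L2_kernel_mult:
  assumes p: "continuous_on {a..b} p" and q: "q \<in> borel_measurable (lebesgue_on {a..b})"
    "integrable (lebesgue_on {a..b}) (\<lambda>\<theta>. (q \<theta>)\<^sup>2)"
  shows "L2_kernel a b (\<lambda>t \<theta>. p t * q \<theta>)"
proof -
  let ?M = "lebesgue_on {a..b}"
  have [measurable]: "p \<in> borel_measurable ?M" "q \<in> borel_measurable ?M"
    using continuous_imp_integrable_real[OF p] q by auto
  obtain C where "\<forall>y\<in>p ` {a..b}. norm y \<le> C"
    using compact_imp_bounded[OF compact_continuous_image[OF p compact_Icc]] unfolding bounded_iff by blast
  then have C: "\<And>t. t \<in> {a..b} \<Longrightarrow> \<bar>p t\<bar> \<le> C" by simp
  have "(\<lambda>(t, \<theta>). p t * q \<theta>) \<in> borel_measurable (?M \<Otimes>\<^sub>M ?M)" by measurable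
  moreover have "(\<lambda>\<theta>. C * \<bar>q \<theta>\<bar>) \<in> borel_measurable ?M" by measurable
  moreover have "integrable ?M (\<lambda>\<theta>. (C * \<bar>q \<theta>\<bar>)\<^sup>2)" using q(2) by (simp add: power_mult_distrib)
  moreover have "\<bar>p t * q \<theta>\<bar> \<le> C * \<bar>q \<theta>\<bar>" if "t \<in> {a..b}" for t \<theta>
    using C[OF that] by (simp add: abs_mult mult_right_mono)
  ultimately show ?thesis unfolding L2_kernel_def
    by (intro conjI exI[of _ "\<lambda>\<theta>. C * \<bar>q \<theta>\<bar>"]) auto
qed

lemma continuous_imp_measurable_square_integrable:
  fixes q :: "real \<Rightarrow> real"
  assumes "continuous_on {a..b} q"
  shows "q \<in> borel_measurable (lebesgue_on {a..b})" "integrable (lebesgue_on {a..b}) (\<lambda>\<theta>. (q \<theta>)\<^sup>2)"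
  using continuous_imp_integrable_real[OF assms] continuous_imp_integrable_real[OF continuous_on_power[OF assms]]
  by auto

lemma L2_kernel_difference: "L2_kernel a b (\<lambda>t \<theta>. p + (t - \<theta>) * q)"
proof -
  have "L2_kernel a b (\<lambda>t \<theta>. (p + t * q) * 1 + 1 * (- \<theta> * q))"
    by (intro L2_kernel_add L2_kernel_mult continuous_imp_measurable_square_integrable continuous_intros)
  then show ?thesis by (simp add: algebra_simps)
qed

lemma L2_kernel_cmult:
  assumes "L2_kernel a b k" shows "L2_kernel a b (\<lambda>t \<theta>. c * k t \<theta>)"
proof -
  let ?M = "lebesgue_on {a..b}"
  from assms obtain r where [measurable]: "case_prod k \<in> borel_measurable (?M \<Otimes>\<^sub>M ?M)" "r \<in> borel_measurable ?M"
    and r: "integrable ?M (\<lambda>\<theta>. (r \<theta>)\<^sup>2)"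
      "\<And>t \<theta>. t\<in>{a..b} \<Longrightarrow> \<theta>\<in>{a..b} \<Longrightarrow> \<bar>k t \<theta>\<bar> \<le> r \<theta>"
    unfolding L2_kernel_def by metis
  have "(\<lambda>(t, \<theta>). c * k t \<theta>) \<in> borel_measurable (?M \<Otimes>\<^sub>M ?M)" by measurable
  moreover have "(\<lambda>\<theta>. \<bar>c\<bar> * r \<theta>) \<in> borel_measurable ?M" by measurable
  moreover have "integrable ?M (\<lambda>\<theta>. (\<bar>c\<bar> * r \<theta>)\<^sup>2)" using r by (simp add: power_mult_distrib)
  moreover have "\<bar>c * k t \<theta>\<bar> \<le> \<bar>c\<bar> * r \<theta>" if "t\<in>{a..b}" "\<theta>\<in>{a..b}" for t \<theta>
    using r(2)[OF that] by (simp add: abs_mult mult_left_mono)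
  ultimately show ?thesis unfolding L2_kernel_def
    by (intro conjI exI[of _ "\<lambda>\<theta>. \<bar>c\<bar> * r \<theta>"]) auto
qed

lemma L2_kernel_cong:
  assumes "\<And>t \<theta>. t \<in> {a..b} \<Longrightarrow> \<theta> \<in> {a..b} \<Longrightarrow> k t \<theta> = k' t \<theta>"
  shows "L2_kernel a b k = L2_kernel a b k'"
proof -
  have "case_prod k \<in> borel_measurable (lebesgue_on {a..b} \<Otimes>\<^sub>M lebesgue_on {a..b})
    \<longleftrightarrow> case_prod k' \<in> borel_measurable (lebesgue_on {a..b} \<Otimes>\<^sub>M lebesgue_on {a..b})"
    by (rule measurable_cong) (use assms in \<open>auto simp: space_pair_measure\<close>)
  then show ?thesis unfolding L2_kernel_def using assms by simp
qed

lemma mat_kernelD: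
  assumes "mat_kernel a b m c K"
  shows "t \<in> {a..b} \<Longrightarrow> \<theta> \<in> {a..b} \<Longrightarrow> K t \<theta> \<in> carrier_mat m c"
    and "j < m \<Longrightarrow> k < c \<Longrightarrow> L2_kernel a b (\<lambda>t \<theta>. K t \<theta> $$ (j,k))"
  using assms unfolding mat_kernel_def by blast+

lemma mat_kernel_add:
  assumes K: "mat_kernel a b m c K" and K': "mat_kernel a b m c K'"
  shows "mat_kernel a b m c (\<lambda>t \<theta>. K t \<theta> + K' t \<theta>)"
  unfolding mat_kernel_def
proof (intro conjI ballI allI impI)
  fix j k assume jk: "j < m" "k < c"
  have e: "(K t \<theta> + K' t \<theta>) $$ (j,k) = K t \<theta> $$ (j,k) + K' t \<theta> $$ (j,k)"
    if "t \<in> {a..b}" "\<theta> \<in> {a..b}" for t \<theta>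
    using jk mat_kernelD(1)[OF K' that] by (intro index_add_mat) auto
  show "L2_kernel a b (\<lambda>t \<theta>. (K t \<theta> + K' t \<theta>) $$ (j,k))"
    by (rule L2_kernel_cong[THEN iffD2, OF _ L2_kernel_add[OF mat_kernelD(2)[OF K jk] mat_kernelD(2)[OF K' jk]]])
      (rule e)
next
  fix t \<theta> assume "t \<in> {a..b}" "\<theta> \<in> {a..b}"
  then show "K t \<theta> + K' t \<theta> \<in> carrier_mat m c"
    by (intro add_carrier_mat mat_kernelD(1)[OF K'])
qed

lemma mat_kernel_if:
  assumes K: "mat_kernel a b m c K" and K': "mat_kernel a b m c K'"
  shows "mat_kernel a b m c (\<lambda>t \<theta>. if \<theta> \<le> t then K t \<theta> else K' t \<theta>)"
  unfolding mat_kernel_def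
proof (intro conjI ballI allI impI)
  fix j k assume jk: "j < m" "k < c"
  show "L2_kernel a b (\<lambda>t \<theta>. (if \<theta> \<le> t then K t \<theta> else K' t \<theta>) $$ (j,k))"
    using L2_kernel_if[OF mat_kernelD(2)[OF K jk] mat_kernelD(2)[OF K' jk]]
    by (simp only: if_mat_index)
qed (use mat_kernelD(1)[OF K] mat_kernelD(1)[OF K'] in simp)

lemma mat_kernel_mult_left:
  assumes K: "mat_kernel a b m c K" and M: "M \<in> carrier_mat r m"
  shows "mat_kernel a b r c (\<lambda>t \<theta>. M * K t \<theta>)"
  unfolding mat_kernel_def
proof (intro conjI ballI allI impI)
  fix i k assume ik: "i < r" "k < c"
  have e: "(M * K t \<theta>) $$ (i,k) = (\<Sum>j<m. M $$ (i,j) * K t \<theta> $$ (j,k))"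
    if "t \<in> {a..b}" "\<theta> \<in> {a..b}" for t \<theta>
    using ik by (intro mult_mat_index[OF M mat_kernelD(1)[OF K that]])
  have "L2_kernel a b (\<lambda>t \<theta>. \<Sum>j<m. M $$ (i,j) * K t \<theta> $$ (j,k))"
    using ik by (intro L2_kernel_sum L2_kernel_cmult mat_kernelD(2)[OF K]) auto
  then show "L2_kernel a b (\<lambda>t \<theta>. (M * K t \<theta>) $$ (i,k))"
    by (rule L2_kernel_cong[THEN iffD2, rotated]) (rule e)
next
  fix t \<theta> assume "t \<in> {a..b}" "\<theta> \<in> {a..b}"
  then show "M * K t \<theta> \<in> carrier_mat r c"
    by (intro mult_carrier_mat[OF M] mat_kernelD(1)[OF K])
qed

lemma mat_kernel_mult:
  assumes F: "\<And>t. t \<in> {a..b} \<Longrightarrow> F t \<in> carrier_mat r m" "\<And>i j. i < r \<Longrightarrow> j < m \<Longrightarrow> continuous_on {a..b} (\<lambda>t. F t $$ (i,j))"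
    and G: "square_integrable_mat a b m c G"
  shows "mat_kernel a b r c (\<lambda>t \<theta>. F t * G \<theta>)"
  unfolding mat_kernel_def
proof (intro conjI ballI allI impI)
  fix i k assume ik: "i < r" "k < c"
  have e: "(F t * G \<theta>) $$ (i,k) = (\<Sum>j<m. F t $$ (i,j) * G \<theta> $$ (j,k))"
    if "t \<in> {a..b}" "\<theta> \<in> {a..b}" for t \<theta>
    using that G ik by (intro mult_mat_index[OF F(1)]) (auto simp: square_integrable_mat_def)
  have "L2_kernel a b (\<lambda>t \<theta>. \<Sum>j<m. F t $$ (i,j) * G \<theta> $$ (j,k))"
    using ik G by (intro L2_kernel_sum L2_kernel_mult F(2)) (auto simp: square_integrable_mat_def)
  then show "L2_kernel a b (\<lambda>t \<theta>. (F t * G \<theta>) $$ (i,k))"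
    by (rule L2_kernel_cong[THEN iffD2, rotated]) (rule e)
next
  fix t \<theta> assume "t \<in> {a..b}" "\<theta> \<in> {a..b}"
  then show "F t * G \<theta> \<in> carrier_mat r c"
    using G by (intro mult_carrier_mat[OF F(1)]) (auto simp: square_integrable_mat_def)
qed

text \<open>Fubini's theorem for the product of a function of \<open>t\<close>, a kernel, and an \<open>L\<^sub>2\<close> function of \<open>\<theta>\<close>.\<close>

lemma L2_kernel_fubini:
  assumes k: "L2_kernel a b k" and p: "integrable (lebesgue_on {a..b}) p"
    and h: "h \<in> borel_measurable (lebesgue_on {a..b})" "integrable (lebesgue_on {a..b}) (\<lambda>\<theta>. (h \<theta>)\<^sup>2)"
  shows "(LINT t|lebesgue_on {a..b}. p t * (LINT \<theta>|lebesgue_on {a..b}. k t \<theta> * h \<theta>))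
       = (LINT \<theta>|lebesgue_on {a..b}. (LINT t|lebesgue_on {a..b}. p t * k t \<theta>) * h \<theta>)"
    and "\<And>t. t \<in> {a..b} \<Longrightarrow> integrable (lebesgue_on {a..b}) (\<lambda>\<theta>. k t \<theta> * h \<theta>)"
    and "integrable (lebesgue_on {a..b}) (\<lambda>t. p t * (LINT \<theta>|lebesgue_on {a..b}. k t \<theta> * h \<theta>))"
    and "integrable (lebesgue_on {a..b}) (\<lambda>\<theta>. (LINT t|lebesgue_on {a..b}. p t * k t \<theta>) * h \<theta>)"
proof -
  let ?M = "lebesgue_on {a..b}"
  from k obtain r where [measurable]: "case_prod k \<in> borel_measurable (?M \<Otimes>\<^sub>M ?M)"
    and r: "r \<in> borel_measurable ?M" "integrable ?M (\<lambda>\<theta>. (r \<theta>)\<^sup>2)"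
      "\<And>t \<theta>. t\<in>{a..b} \<Longrightarrow> \<theta>\<in>{a..b} \<Longrightarrow> \<bar>k t \<theta>\<bar> \<le> r \<theta>"
    unfolding L2_kernel_def by metis
  note [measurable] = h(1)
  have m: "(\<lambda>(t, \<theta>). k t \<theta> * h \<theta>) \<in> borel_measurable (?M \<Otimes>\<^sub>M ?M)" by measurable
  have g: "integrable ?M (\<lambda>\<theta>. \<bar>r \<theta> * h \<theta>\<bar>)"
    using integrable_mult_square[OF r(1) h(1) r(2) h(2)] by simp
  have "\<bar>k t \<theta> * h \<theta>\<bar> \<le> \<bar>r \<theta> * h \<theta>\<bar>" if "t\<in>{a..b}" "\<theta>\<in>{a..b}" for t \<theta>
    using r(3)[OF that] by (simp add: abs_mult mult_right_mono)
  note F = fubini_dominated[OF p g m this]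
  have e: "(LINT t|?M. p t * (k t \<theta> * h \<theta>)) = (LINT t|?M. p t * k t \<theta>) * h \<theta>" for \<theta>
    by (simp flip: mult.assoc)
  show "(LINT t|?M. p t * (LINT \<theta>|?M. k t \<theta> * h \<theta>)) = (LINT \<theta>|?M. (LINT t|?M. p t * k t \<theta>) * h \<theta>)"
    "\<And>t. t \<in> {a..b} \<Longrightarrow> integrable ?M (\<lambda>\<theta>. k t \<theta> * h \<theta>)"
    "integrable ?M (\<lambda>t. p t * (LINT \<theta>|?M. k t \<theta> * h \<theta>))"
    "integrable ?M (\<lambda>\<theta>. (LINT t|?M. p t * k t \<theta>) * h \<theta>)"
    using F(1,2,3,4) unfolding e by simp_all
qed

text \<open>Integrating an \<open>L\<^sub>2\<close> kernel against an integrable function of its first variable gives a square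
  integrable function of the second.\<close>

lemma L2_kernel_integral:
  assumes k: "L2_kernel a b k" and p: "integrable (lebesgue_on {a..b}) p"
  shows "(\<lambda>\<theta>. LINT t|lebesgue_on {a..b}. p t * k t \<theta>) \<in> borel_measurable (lebesgue_on {a..b})"
    and "integrable (lebesgue_on {a..b}) (\<lambda>\<theta>. (LINT t|lebesgue_on {a..b}. p t * k t \<theta>)\<^sup>2)"
    and "\<And>\<theta>. \<theta> \<in> {a..b} \<Longrightarrow> integrable (lebesgue_on {a..b}) (\<lambda>t. p t * k t \<theta>)"
proof -
  let ?M = "lebesgue_on {a..b}"
  interpret M: finite_measure ?M by (rule finite_measure_lebesgue_on_Icc)
  from k obtain r where m [measurable]: "case_prod k \<in> borel_measurable (?M \<Otimes>\<^sub>M ?M)"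
    and r: "r \<in> borel_measurable ?M" "integrable ?M (\<lambda>\<theta>. (r \<theta>)\<^sup>2)"
      "\<And>t \<theta>. t\<in>{a..b} \<Longrightarrow> \<theta>\<in>{a..b} \<Longrightarrow> \<bar>k t \<theta>\<bar> \<le> r \<theta>"
    unfolding L2_kernel_def by metis
  have [measurable]: "p \<in> borel_measurable ?M" using p by simp
  have "(\<lambda>(t, \<theta>). p t * k t \<theta>) \<in> borel_measurable (?M \<Otimes>\<^sub>M ?M)" by measurable
  from measurable_pair_swap[OF this]
  have "(\<lambda>(\<theta>, t). p t * k t \<theta>) \<in> borel_measurable (?M \<Otimes>\<^sub>M ?M)" by (simp add: case_prod_beta)
  then show meas: "(\<lambda>\<theta>. LINT t|?M. p t * k t \<theta>) \<in> borel_measurable ?M"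
    by (rule M.borel_measurable_lebesgue_integral)
  show int: "integrable ?M (\<lambda>t. p t * k t \<theta>)" if \<theta>: "\<theta> \<in> {a..b}" for \<theta>
  proof -
    have "(\<lambda>t. k t \<theta>) \<in> borel_measurable ?M"
      using measurable_Pair1[OF m, of \<theta>] \<theta> by simp
    moreover have "AE t in ?M. \<bar>k t \<theta>\<bar> \<le> r \<theta>"
      by (rule AE_I2) (simp only: space_lebesgue_on r(3) \<theta>)
    ultimately have "integrable ?M (\<lambda>t. k t \<theta> * p t)"
      by (rule integrable_bounded_mult[OF p])
    then show ?thesis by (simp only: mult.commute)
  qed
  define C where "C = (LINT t|?M. \<bar>p t\<bar>)"
  show "integrable ?M (\<lambda>\<theta>. (LINT t|?M. p t * k t \<theta>)\<^sup>2)"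
  proof (rule Bochner_Integration.integrable_bound)
    show "integrable ?M (\<lambda>\<theta>. (C * r \<theta>)\<^sup>2)"
      using r(2) by (simp add: power_mult_distrib)
    show "AE \<theta> in ?M. norm ((LINT t|?M. p t * k t \<theta>)\<^sup>2) \<le> norm ((C * r \<theta>)\<^sup>2)"
    proof (rule AE_I2)
      fix \<theta> assume "\<theta> \<in> space ?M"
      then have \<theta>: "\<theta> \<in> {a..b}" by simp
      have "\<bar>LINT t|?M. p t * k t \<theta>\<bar> \<le> (LINT t|?M. \<bar>p t * k t \<theta>\<bar>)"
        by (rule integral_abs_bound)
      also have "\<dots> \<le> (LINT t|?M. \<bar>p t\<bar> * r \<theta>)"
      proof (rule integral_mono)
        fix t assume "t \<in> space ?M"
        then show "\<bar>p t * k t \<theta>\<bar> \<le> \<bar>p t\<bar> * r \<theta>"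
          using r(3)[OF _ \<theta>, of t] by (simp add: abs_mult mult_left_mono)
      qed (use int[OF \<theta>] p in simp_all)
      also have "\<dots> = C * r \<theta>" by (simp add: C_def)
      finally have "\<bar>LINT t|?M. p t * k t \<theta>\<bar>\<^sup>2 \<le> (C * r \<theta>)\<^sup>2"
        by (rule power_mono) simp
      then show "norm ((LINT t|?M. p t * k t \<theta>)\<^sup>2) \<le> norm ((C * r \<theta>)\<^sup>2)" by simp
    qed
  qed (use meas in measurable)
qed

lemma mat_kernel_mult_vec_integrable:
  assumes K: "mat_kernel a b m c K" and f: "f \<in> L2 a b c" and t: "t \<in> {a..b}"
  shows "vec_integrable m {a..b} (\<lambda>\<theta>. K t \<theta> *\<^sub>v f \<theta>)"
  unfolding vec_integrable_def
proof (intro conjI ballI allI impI)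
  fix j assume j: "j < m"
  have z: "integrable (lebesgue_on {a..b}) (\<lambda>_. 0::real)" by simp
  have "integrable (lebesgue_on {a..b}) (\<lambda>\<theta>. \<Sum>k<c. K t \<theta> $$ (j,k) * f \<theta> $ k)"
    by (intro Bochner_Integration.integrable_sum
        L2_kernel_fubini(2)[OF mat_kernelD(2)[OF K j] z L2D(2,3)[OF f] t]) simp_all
  then show "integrable (lebesgue_on {a..b}) (\<lambda>\<theta>. (K t \<theta> *\<^sub>v f \<theta>) $ j)"
    by (rule integrable_on_cong[THEN iffD2, rotated])
      (rule mult_mat_vec_index[OF mat_kernelD(1)[OF K t] L2D(1)[OF f] j])
qed (rule mult_mat_vec_carrier[OF mat_kernelD(1)[OF K t] L2D(1)[OF f]])

lemma mat_kernel_integral_index: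
  assumes K: "mat_kernel a b m c K" and P: "mat_integrable r m {a..b} P" and \<theta>: "\<theta> \<in> {a..b}"
    and ik: "i < r" "k < c"
  shows "integrable (lebesgue_on {a..b}) (\<lambda>t. (P t * K t \<theta>) $$ (i,k))"
    and "mat_integral r c {a..b} (\<lambda>t. P t * K t \<theta>) $$ (i,k)
      = (\<Sum>j<m. LINT t|lebesgue_on {a..b}. P t $$ (i,j) * K t \<theta> $$ (j,k))"
proof -
  let ?M = "lebesgue_on {a..b}"
  note idx = mult_mat_index[OF mat_integrableD(1)[OF P] mat_kernelD(1)[OF K _ \<theta>] ik]
  have int: "integrable ?M (\<lambda>t. P t $$ (i,j) * K t \<theta> $$ (j,k))" if "j < m" for j
    using that ik by (intro L2_kernel_integral(3)[OF mat_kernelD(2)[OF K] mat_integrableD(2)[OF P] \<theta>])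
  show "integrable ?M (\<lambda>t. (P t * K t \<theta>) $$ (i,k))"
    by (rule integrable_on_cong[THEN iffD2, OF idx], assumption+,
        intro Bochner_Integration.integrable_sum int) simp
  have "(LINT t|?M. (P t * K t \<theta>) $$ (i,k)) = (LINT t|?M. (\<Sum>j<m. P t $$ (i,j) * K t \<theta> $$ (j,k)))"
    by (rule LINT_cong) (rule idx)
  also have "\<dots> = (\<Sum>j<m. LINT t|?M. P t $$ (i,j) * K t \<theta> $$ (j,k))"
    by (intro Bochner_Integration.integral_sum int) simp
  finally show "mat_integral r c {a..b} (\<lambda>t. P t * K t \<theta>) $$ (i,k)
      = (\<Sum>j<m. LINT t|?M. P t $$ (i,j) * K t \<theta> $$ (j,k))"
    using ik by simp
qed

lemma mat_kernel_mult_mat_integrable: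
  assumes K: "mat_kernel a b m c K" and P: "mat_integrable r m {a..b} P" and \<theta>: "\<theta> \<in> {a..b}"
  shows "mat_integrable r c {a..b} (\<lambda>t. P t * K t \<theta>)"
  unfolding mat_integrable_def
  using mat_kernel_integral_index(1)[OF K P \<theta>] mult_carrier_mat[OF mat_integrableD(1)[OF P] mat_kernelD(1)[OF K _ \<theta>]]
  by blast

lemma integral_double_sum:
  fixes h :: "nat \<Rightarrow> nat \<Rightarrow> 'a \<Rightarrow> real"
  assumes "\<And>j k. j < m \<Longrightarrow> k < c \<Longrightarrow> integrable M (h j k)"
  shows "(LINT x|M. (\<Sum>j<m. \<Sum>k<c. h j k x)) = (\<Sum>j<m. \<Sum>k<c. LINT x|M. h j k x)"
    and "integrable M (\<lambda>x. \<Sum>j<m. \<Sum>k<c. h j k x)"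
proof -
  have i: "integrable M (\<lambda>x. \<Sum>k<c. h j k x)" if "j < m" for j
    using that assms by (intro Bochner_Integration.integrable_sum) simp
  show "integrable M (\<lambda>x. \<Sum>j<m. \<Sum>k<c. h j k x)"
    by (rule Bochner_Integration.integrable_sum, rule i) simp
  have "(LINT x|M. (\<Sum>j<m. \<Sum>k<c. h j k x)) = (\<Sum>j<m. LINT x|M. (\<Sum>k<c. h j k x))"
    using i by (intro Bochner_Integration.integral_sum) simp
  also have "\<dots> = (\<Sum>j<m. \<Sum>k<c. LINT x|M. h j k x)"
    by (intro sum.cong refl Bochner_Integration.integral_sum) (rule assms, simp_all)
  finally show "(LINT x|M. (\<Sum>j<m. \<Sum>k<c. h j k x)) = (\<Sum>j<m. \<Sum>k<c. LINT x|M. h j k x)" .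
qed

text \<open>The matrix form of \<open>L2_kernel_fubini\<close>: integrals of \<open>P(t) K(t,\<theta>) f(\<theta>)\<close> may be exchanged.\<close>

lemma mat_kernel_fubini:
  assumes K: "mat_kernel a b m c K" and f: "f \<in> L2 a b c" and P: "mat_integrable r m {a..b} P"
  shows "vec_integrable r {a..b} (\<lambda>t. P t *\<^sub>v vec_integral m {a..b} (\<lambda>\<theta>. K t \<theta> *\<^sub>v f \<theta>))"
    and "vec_integrable r {a..b} (\<lambda>\<theta>. mat_integral r c {a..b} (\<lambda>t. P t * K t \<theta>) *\<^sub>v f \<theta>)"
    and "vec_integral r {a..b} (\<lambda>t. P t *\<^sub>v vec_integral m {a..b} (\<lambda>\<theta>. K t \<theta> *\<^sub>v f \<theta>))
       = vec_integral r {a..b} (\<lambda>\<theta>. mat_integral r c {a..b} (\<lambda>t. P t * K t \<theta>) *\<^sub>v f \<theta>)"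
      (is "vec_integral r {a..b} ?L = vec_integral r {a..b} ?R")
proof -
  let ?M = "lebesgue_on {a..b}"
  note Kc = mat_kernelD(1)[OF K] and Pc = mat_integrableD(1)[OF P] and fc = L2D(1)[OF f]
  let ?l = "\<lambda>i j k t. P t $$ (i,j) * (LINT \<theta>|?M. K t \<theta> $$ (j,k) * f \<theta> $ k)"
  let ?r = "\<lambda>i j k \<theta>. (LINT t|?M. P t $$ (i,j) * K t \<theta> $$ (j,k)) * f \<theta> $ k"
  have F: "integral\<^sup>L ?M (?l i j k) = integral\<^sup>L ?M (?r i j k)" "integrable ?M (?l i j k)" "integrable ?M (?r i j k)"
    "\<And>t. t \<in> {a..b} \<Longrightarrow> integrable ?M (\<lambda>\<theta>. K t \<theta> $$ (j,k) * f \<theta> $ k)"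
    if "i < r" "j < m" "k < c" for i j k
    using L2_kernel_fubini[OF mat_kernelD(2)[OF K that(2,3)] mat_integrableD(2)[OF P that(1,2)] L2D(2,3)[OF f that(3)]]
    by simp_all
  have L: "?L t $ i = (\<Sum>j<m. \<Sum>k<c. ?l i j k t)" if i: "i < r" and t: "t \<in> {a..b}" for i t
  proof -
    have "(LINT \<theta>|?M. (K t \<theta> *\<^sub>v f \<theta>) $ j) = (\<Sum>k<c. LINT \<theta>|?M. K t \<theta> $$ (j,k) * f \<theta> $ k)" if j: "j < m" for j
    proof -
      have "(LINT \<theta>|?M. (K t \<theta> *\<^sub>v f \<theta>) $ j) = (LINT \<theta>|?M. (\<Sum>k<c. K t \<theta> $$ (j,k) * f \<theta> $ k))"
        by (rule LINT_cong) (rule mult_mat_vec_index[OF Kc[OF t] fc j])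
      also have "\<dots> = (\<Sum>k<c. LINT \<theta>|?M. K t \<theta> $$ (j,k) * f \<theta> $ k)"
        by (rule Bochner_Integration.integral_sum) (rule F(4)[OF i j _ t], simp)
      finally show ?thesis .
    qed
    then show ?thesis
      by (subst mult_mat_vec_index[OF Pc[OF t] vec_integral_carrier i]) (simp add: sum_distrib_left)
  qed
  have R: "?R \<theta> $ i = (\<Sum>j<m. \<Sum>k<c. ?r i j k \<theta>)" if i: "i < r" and \<theta>: "\<theta> \<in> {a..b}" for i \<theta>
  proof -
    have "?R \<theta> $ i = (\<Sum>k<c. (\<Sum>j<m. LINT t|?M. P t $$ (i,j) * K t \<theta> $$ (j,k)) * f \<theta> $ k)"
      unfolding mult_mat_vec_index[OF mat_integral_carrier fc[OF \<theta>] i]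
      by (intro sum.cong refl arg_cong2[of _ _ _ _ "(*)"] mat_kernel_integral_index(2)[OF K P \<theta> i]) simp
    also have "\<dots> = (\<Sum>k<c. \<Sum>j<m. ?r i j k \<theta>)" by (simp only: sum_distrib_right)
    finally show ?thesis by (subst sum.swap)
  qed
  show "vec_integrable r {a..b} ?L"
    unfolding vec_integrable_def
  proof (intro conjI ballI allI impI mult_mat_vec_carrier[OF Pc vec_integral_carrier])
    fix i assume i: "i < r"
    show "integrable ?M (\<lambda>t. ?L t $ i)"
      by (rule integrable_on_cong[THEN iffD2, OF L[OF i]], assumption) (rule integral_double_sum(2), rule F(2)[OF i])
  qed
  show "vec_integrable r {a..b} ?R"
    unfolding vec_integrable_def
  proof (intro conjI ballI allI impI mult_mat_vec_carrier[OF mat_integral_carrier fc])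
    fix i assume i: "i < r"
    show "integrable ?M (\<lambda>\<theta>. ?R \<theta> $ i)"
      by (rule integrable_on_cong[THEN iffD2, OF R[OF i]], assumption) (rule integral_double_sum(2), rule F(3)[OF i])
  qed
  show "vec_integral r {a..b} ?L = vec_integral r {a..b} ?R"
  proof (intro eq_vecI)
    fix i assume "i < dim_vec (vec_integral r {a..b} ?R)"
    then have i: "i < r" by simp
    have "(LINT t|?M. ?L t $ i) = (LINT t|?M. (\<Sum>j<m. \<Sum>k<c. ?l i j k t))"
      by (rule LINT_cong) (rule L[OF i])
    also have "\<dots> = (\<Sum>j<m. \<Sum>k<c. integral\<^sup>L ?M (?l i j k))"
      by (rule integral_double_sum(1)) (rule F(2)[OF i])
    also have "\<dots> = (\<Sum>j<m. \<Sum>k<c. integral\<^sup>L ?M (?r i j k))"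
      by (intro sum.cong refl F(1)[OF i]) simp_all
    also have "\<dots> = (LINT \<theta>|?M. (\<Sum>j<m. \<Sum>k<c. ?r i j k \<theta>))"
      by (rule integral_double_sum(1)[symmetric]) (rule F(3)[OF i])
    also have "\<dots> = (LINT \<theta>|?M. ?R \<theta> $ i)"
      by (rule LINT_cong[symmetric]) (rule R[OF i])
    finally show "vec_integral r {a..b} ?L $ i = vec_integral r {a..b} ?R $ i"
      unfolding vec_integral_index[OF i] .
  qed simp
qed

lemma mat_integral_cong_AE:
  assumes "AE s in lebesgue_on S. F s = G s" "S \<in> sets lebesgue"
  shows "mat_integral r c S F = mat_integral r c S G"
proof (intro eq_matI)
  fix i j assume ij: "i < dim_row (mat_integral r c S G)" "j < dim_col (mat_integral r c S G)"
  have ae: "AE s in lebesgue_on S. F s $$ (i,j) = G s $$ (i,j)"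
    using assms(1) by (elim eventually_mono) simp
  show "mat_integral r c S F $$ (i,j) = mat_integral r c S G $$ (i,j)"
    using ij LINT_cong_AE(1)[OF ae assms(2)] by simp
qed simp_all

lemma mat_integrable_cong_AE:
  assumes "AE s in lebesgue_on S. F s = G s" "S \<in> sets lebesgue" "mat_integrable r c S G"
    and "\<And>s. s \<in> S \<Longrightarrow> F s \<in> carrier_mat r c"
  shows "mat_integrable r c S F"
  unfolding mat_integrable_def
proof (intro conjI ballI allI impI)
  fix i j assume ij: "i < r" "j < c"
  have ae: "AE s in lebesgue_on S. F s $$ (i,j) = G s $$ (i,j)"
    using assms(1) by (elim eventually_mono) simp
  show "integrable (lebesgue_on S) (\<lambda>s. F s $$ (i,j))"
    by (rule LINT_cong_AE(2)[THEN iffD2, OF ae assms(2) mat_integrableD(2)[OF assms(3) ij]])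
qed (rule assms)

lemma square_integrable_matD:
  assumes "square_integrable_mat a b r c F"
  shows "s \<in> {a..b} \<Longrightarrow> F s \<in> carrier_mat r c"
    and "i < r \<Longrightarrow> j < c \<Longrightarrow> (\<lambda>s. F s $$ (i,j)) \<in> borel_measurable (lebesgue_on {a..b})"
    and "i < r \<Longrightarrow> j < c \<Longrightarrow> integrable (lebesgue_on {a..b}) (\<lambda>s. (F s $$ (i,j))\<^sup>2)"
  using assms unfolding square_integrable_mat_def by blast+

lemma square_integrable_imp_mat_integrable:
  assumes "square_integrable_mat a b r c F" shows "mat_integrable r c {a..b} F"
  unfolding mat_integrable_def
  using finite_measure.integrable_square_imp_integrable[OF finite_measure_lebesgue_on_Icc]
    square_integrable_matD[OF assms] by blast

lemma square_integrable_mult_L2: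
  assumes F: "square_integrable_mat a b r m F" and f: "f \<in> L2 a b m"
  shows "vec_integrable r {a..b} (\<lambda>s. F s *\<^sub>v f s)"
  unfolding vec_integrable_def
proof (intro conjI ballI allI impI)
  fix i assume i: "i < r"
  have idx: "(F s *\<^sub>v f s) $ i = (\<Sum>j<m. F s $$ (i,j) * f s $ j)" if "s \<in> {a..b}" for s
    by (rule mult_mat_vec_index[OF square_integrable_matD(1)[OF F that] L2D(1)[OF f that] i])
  have "integrable (lebesgue_on {a..b}) (\<lambda>s. \<Sum>j<m. F s $$ (i,j) * f s $ j)"
    using i by (intro Bochner_Integration.integrable_sum integrable_mult_square
        square_integrable_matD(2,3)[OF F] L2D(2,3)[OF f]) simp_all
  then show "integrable (lebesgue_on {a..b}) (\<lambda>s. (F s *\<^sub>v f s) $ i)"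
    by (rule integrable_on_cong[THEN iffD2, rotated]) (rule idx)
qed (rule mult_mat_vec_carrier[OF square_integrable_matD(1)[OF F] L2D(1)[OF f]])

lemma square_integrable_linear_combination:
  fixes g :: "'i \<Rightarrow> real \<Rightarrow> real"
  assumes "finite A" "\<And>i. i \<in> A \<Longrightarrow> g i \<in> borel_measurable M" "\<And>i. i \<in> A \<Longrightarrow> integrable M (\<lambda>s. (g i s)\<^sup>2)"
  shows "(\<lambda>s. \<Sum>i\<in>A. c i * g i s) \<in> borel_measurable M \<and> integrable M (\<lambda>s. (\<Sum>i\<in>A. c i * g i s)\<^sup>2)"
  using assms
proof (induction A rule: finite_induct)
  case (insert i A)
  have m: "(\<lambda>s. c i * g i s) \<in> borel_measurable M" "integrable M (\<lambda>s. (c i * g i s)\<^sup>2)"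
    using insert.prems[of i] by (auto simp: power_mult_distrib)
  have IH: "(\<lambda>s. \<Sum>i\<in>A. c i * g i s) \<in> borel_measurable M" "integrable M (\<lambda>s. (\<Sum>i\<in>A. c i * g i s)\<^sup>2)"
    using insert.IH insert.prems by auto
  show ?case
    unfolding sum.insert[OF insert.hyps]
    using borel_measurable_add[OF m(1) IH(1)] integrable_square_sum[OF m(1) IH(1) m(2) IH(2)] by blast
qed simp

lemma L2_cong:
  assumes "\<And>s i. s \<in> {a..b} \<Longrightarrow> i < m \<Longrightarrow> u s $ i = v s $ i"
    and "\<And>s. s \<in> {a..b} \<Longrightarrow> u s \<in> carrier_vec m"
    and "\<And>i. i < m \<Longrightarrow> (\<lambda>s. v s $ i) \<in> borel_measurable (lebesgue_on {a..b}) \<and>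
       integrable (lebesgue_on {a..b}) (\<lambda>s. (v s $ i)\<^sup>2)"
  shows "u \<in> L2 a b m"
  unfolding L2_def mem_Collect_eq
proof (intro conjI ballI allI impI)
  fix i assume i: "i < m"
  show "(\<lambda>s. u s $ i) \<in> borel_measurable (lebesgue_on {a..b})"
    by (rule measurable_cong[THEN iffD2, OF _ conjunct1[OF assms(3)[OF i]]]) (use assms(1) i in simp)
  show "integrable (lebesgue_on {a..b}) (\<lambda>s. (u s $ i)\<^sup>2)"
    by (rule integrable_on_cong[THEN iffD2, OF _ conjunct2[OF assms(3)[OF i]]]) (use assms(1) i in simp)
qed (rule assms(2))

lemma L2_mult_mat:
  assumes M: "M \<in> carrier_mat r m" and f: "f \<in> L2 a b m"
  shows "(\<lambda>s. M *\<^sub>v f s) \<in> L2 a b r"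
proof (rule L2_cong[where v = "\<lambda>s. Matrix.vec r (\<lambda>i. \<Sum>j<m. M $$ (i,j) * f s $ j)"])
  show "(M *\<^sub>v f s) $ i = Matrix.vec r (\<lambda>i. \<Sum>j<m. M $$ (i,j) * f s $ j) $ i" if "s \<in> {a..b}" "i < r" for s i
    using mult_mat_vec_index[OF M L2D(1)[OF f that(1)] that(2)] that(2) by (simp only: index_vec)
  fix i assume "i < r"
  then show "(\<lambda>s. Matrix.vec r (\<lambda>i. \<Sum>j<m. M $$ (i,j) * f s $ j) $ i) \<in> borel_measurable (lebesgue_on {a..b}) \<and>
       integrable (lebesgue_on {a..b}) (\<lambda>s. (Matrix.vec r (\<lambda>i. \<Sum>j<m. M $$ (i,j) * f s $ j) $ i)\<^sup>2)"
    using square_integrable_linear_combination[of "{..<m}" "\<lambda>j s. f s $ j"] L2D(2,3)[OF f] by simp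
qed (rule mult_mat_vec_carrier[OF M L2D(1)[OF f]])

lemma square_integrable_mat_if:
  assumes F: "square_integrable_mat a b r c F" and G: "square_integrable_mat a b r c G"
  shows "square_integrable_mat a b r c (\<lambda>\<theta>. if \<theta> \<le> s then F \<theta> else G \<theta>)"
  unfolding square_integrable_mat_def
proof (intro conjI ballI allI impI)
  fix i j assume ij: "i < r" "j < c"
  note [measurable] = square_integrable_matD(2)[OF F ij] square_integrable_matD(2)[OF G ij]
  have m: "(\<lambda>\<theta>. if \<theta> \<le> s then F \<theta> $$ (i,j) else G \<theta> $$ (i,j)) \<in> borel_measurable (lebesgue_on {a..b})"
    by measurable
  then show "(\<lambda>\<theta>. (if \<theta> \<le> s then F \<theta> else G \<theta>) $$ (i,j)) \<in> borel_measurable (lebesgue_on {a..b})"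
    by (simp only: if_mat_index)
  have "integrable (lebesgue_on {a..b}) (\<lambda>\<theta>. (if \<theta> \<le> s then F \<theta> $$ (i,j) else G \<theta> $$ (i,j))\<^sup>2)"
  proof (rule Bochner_Integration.integrable_bound)
    show "integrable (lebesgue_on {a..b}) (\<lambda>\<theta>. (F \<theta> $$ (i,j))\<^sup>2 + (G \<theta> $$ (i,j))\<^sup>2)"
      by (intro Bochner_Integration.integrable_add square_integrable_matD(3)[OF F ij] square_integrable_matD(3)[OF G ij])
    show "AE \<theta> in lebesgue_on {a..b}. norm ((if \<theta> \<le> s then F \<theta> $$ (i,j) else G \<theta> $$ (i,j))\<^sup>2)
        \<le> norm ((F \<theta> $$ (i,j))\<^sup>2 + (G \<theta> $$ (i,j))\<^sup>2)"
      by (intro AE_I2) simp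
  qed (use m in measurable)
  then show "integrable (lebesgue_on {a..b}) (\<lambda>\<theta>. ((if \<theta> \<le> s then F \<theta> else G \<theta>) $$ (i,j))\<^sup>2)"
    by (simp only: if_mat_index)
qed (use square_integrable_matD(1)[OF F] square_integrable_matD(1)[OF G] in simp)

lemma vec_integral_split_integrable:
  assumes s: "s \<in> {a..b}" and int: "vec_integrable m {a..b} (\<lambda>\<theta>. if \<theta> \<le> s then g \<theta> else h \<theta>)"
    and c: "\<And>\<theta>. \<theta> \<in> {a..s} \<Longrightarrow> g \<theta> \<in> carrier_vec m" "\<And>\<theta>. \<theta> \<in> {s..b} \<Longrightarrow> h \<theta> \<in> carrier_vec m"
  shows "vec_integrable m {a..s} g" "vec_integrable m {s..b} h"
proof -
  note I = integral_split_at(2,3)[OF s vec_integrableD(3)[OF int, unfolded if_vec_index]]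
  show "vec_integrable m {a..s} g" "vec_integrable m {s..b} h"
    unfolding vec_integrable_def using I c by blast+
qed

lemma mat_integral_split_integrable:
  assumes s: "s \<in> {a..b}" and int: "mat_integrable r c {a..b} (\<lambda>\<theta>. if \<theta> \<le> s then G \<theta> else H \<theta>)"
    and c: "\<And>\<theta>. \<theta> \<in> {s..b} \<Longrightarrow> H \<theta> \<in> carrier_mat r c"
  shows "mat_integrable r c {s..b} H"
proof -
  note I = integral_split_at(3)[OF s mat_integrableD(2)[OF int, unfolded if_mat_index]]
  show ?thesis
    unfolding mat_integrable_def using I c by blast
qed

section \<open>Composition of partial integral operators\<close>

text \<open>A partial integral operator is a multiplication operator plus one integral operator on \<open>[a,b]\<close>.\<close>

lemma PI_op_kernel:
  assumes K: "mat_kernel a b m c (\<lambda>t \<theta>. if \<theta> \<le> t then R1 t \<theta> else R2 t \<theta>)" and f: "f \<in> L2 a b c"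
    and s: "s \<in> {a..b}" and R0: "R0 s \<in> carrier_mat m c"
  shows "PI_op a b m R0 R1 R2 f s = R0 s *\<^sub>v f s
     + vec_integral m {a..b} (\<lambda>\<theta>. (if \<theta> \<le> s then R1 s \<theta> else R2 s \<theta>) *\<^sub>v f \<theta>)"
proof -
  from mat_kernel_mult_vec_integrable[OF K f s]
  have int: "vec_integrable m {a..b} (\<lambda>\<theta>. if \<theta> \<le> s then R1 s \<theta> *\<^sub>v f \<theta> else R2 s \<theta> *\<^sub>v f \<theta>)"
    by (simp only: if_distrib[of "\<lambda>M. M *\<^sub>v _"])
  show ?thesis
    unfolding PI_op_def if_distrib[of "\<lambda>M. M *\<^sub>v _"] vec_integral_split[OF s int]
    by (intro assoc_add_vec[of _ m] mult_mat_vec_carrier[OF R0] L2D(1)[OF f s] vec_integral_carrier)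
qed

text \<open>The composition of the partial integral operator with multiplier \<open>A0\<close> and kernels \<open>A1\<close>, \<open>A2\<close> with the
  one with constant multiplier \<open>U\<close> and kernels \<open>R1\<close>, \<open>R2\<close>. The function \<open>y\<close> need be given by the inner
  operator only almost everywhere, but at the point \<open>s\<close> it must be.\<close>

lemma PI_op_compose:
  fixes s :: real
  assumes s: "s \<in> {a..b}" and f: "f \<in> L2 a b c" and U: "U \<in> carrier_mat m c"
    and R1: "mat_kernel a b m c R1" and R2: "mat_kernel a b m c R2"
    and y: "\<And>t. t \<in> {a..b} \<Longrightarrow> y t \<in> carrier_vec m"
      "AE t in lebesgue_on {a..b}. y t = PI_op a b m (\<lambda>_. U) R1 R2 f t"
      "y s = PI_op a b m (\<lambda>_. U) R1 R2 f s"
    and A0: "A0 s \<in> carrier_mat r m" and A1: "square_integrable_mat a b r m (A1 s)"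
    and A2: "square_integrable_mat a b r m (A2 s)"
  defines "C0 \<equiv> \<lambda>s. A0 s * U"
    and "C1 \<equiv> \<lambda>s \<theta>. A0 s * R1 s \<theta> + A1 s \<theta> * U
       + mat_integral r c {a..\<theta>} (\<lambda>t. A1 s t * R2 t \<theta>)
       + mat_integral r c {\<theta>..s} (\<lambda>t. A1 s t * R1 t \<theta>)
       + mat_integral r c {s..b} (\<lambda>t. A2 s t * R1 t \<theta>)"
    and "C2 \<equiv> \<lambda>s \<theta>. A0 s * R2 s \<theta> + A2 s \<theta> * U
       + mat_integral r c {a..s} (\<lambda>t. A1 s t * R2 t \<theta>)
       + mat_integral r c {s..\<theta>} (\<lambda>t. A2 s t * R2 t \<theta>)
       + mat_integral r c {\<theta>..b} (\<lambda>t. A2 s t * R1 t \<theta>)"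
  shows "PI_op a b r A0 A1 A2 y s = PI_op a b r C0 C1 C2 f s"
proof -
  let ?M = "lebesgue_on {a..b}"
  define K where "K = (\<lambda>t \<theta>. if \<theta> \<le> t then R1 t \<theta> else R2 t \<theta>)"
  define P where "P = (\<lambda>t. if t \<le> s then A1 s t else A2 s t)"
  define w where "w = (\<lambda>t. vec_integral m {a..b} (\<lambda>\<theta>. K t \<theta> *\<^sub>v f \<theta>))"
  define I where "I = (\<lambda>\<theta>. mat_integral r c {a..b} (\<lambda>t. P t * K t \<theta>))"
  have K: "mat_kernel a b m c K"
    unfolding K_def by (rule mat_kernel_if[OF R1 R2])
  note R1c = mat_kernelD(1)[OF R1] and R2c = mat_kernelD(1)[OF R2] and Kc = mat_kernelD(1)[OF K]
  note A1c = square_integrable_matD(1)[OF A1] and A2c = square_integrable_matD(1)[OF A2]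
  note fc = L2D(1)[OF f]
  have P: "square_integrable_mat a b r m P"
    unfolding P_def by (rule square_integrable_mat_if[OF A1 A2])
  note Pc = square_integrable_matD(1)[OF P] and Pi = square_integrable_imp_mat_integrable[OF P]
  have Uf: "(\<lambda>t. U *\<^sub>v f t) \<in> L2 a b m" by (rule L2_mult_mat[OF U f])
  note Ufc = L2D(1)[OF Uf]
  have wc: "w t \<in> carrier_vec m" for t by (simp add: w_def)
  have PI_y: "PI_op a b m (\<lambda>_. U) R1 R2 f t = U *\<^sub>v f t + w t" if "t \<in> {a..b}" for t
    unfolding w_def K_def by (rule PI_op_kernel[OF K[unfolded K_def] f that]) (rule U)
  note MK = mat_kernel_fubini[OF K f Pi]
  have iPw: "vec_integrable r {a..b} (\<lambda>t. P t *\<^sub>v w t)"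
    unfolding w_def by (rule MK(1))
  have iIf: "vec_integrable r {a..b} (\<lambda>\<theta>. I \<theta> *\<^sub>v f \<theta>)"
    unfolding I_def by (rule MK(2))
  have Pw: "vec_integral r {a..b} (\<lambda>t. P t *\<^sub>v w t) = vec_integral r {a..b} (\<lambda>\<theta>. I \<theta> *\<^sub>v f \<theta>)"
    unfolding w_def I_def by (rule MK(3))
  \<comment> \<open>the outer integrals, merged into one over \<open>[a,b]\<close>\<close>
  have i1: "vec_integrable r {a..b} (\<lambda>t. P t *\<^sub>v (U *\<^sub>v f t))"
    by (rule square_integrable_mult_L2[OF P Uf])
  have ae: "AE t in ?M. P t *\<^sub>v y t = P t *\<^sub>v (U *\<^sub>v f t) + P t *\<^sub>v w t"
    using y(2) AE_space[of ?M]
  proof eventually_elim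
    case (elim t)
    then have b: "t \<in> {a..b}" by simp
    show ?case unfolding elim(1) PI_y[OF b]
      by (rule mult_add_distrib_mat_vec[OF Pc[OF b] Ufc[OF b] wc])
  qed
  have iPy: "vec_integrable r {a..b} (\<lambda>t. P t *\<^sub>v y t)"
    by (rule vec_integrable_cong_AE[OF ae _ vec_integral_add(2)[OF i1 iPw]])
      (auto intro: mult_mat_vec_carrier[OF Pc y(1)])
  have if_mult: "P t *\<^sub>v v = (if t \<le> s then A1 s t *\<^sub>v v else A2 s t *\<^sub>v v)" for t v
    by (simp add: P_def)
  have "vec_integral r {a..s} (\<lambda>t. A1 s t *\<^sub>v y t) + vec_integral r {s..b} (\<lambda>t. A2 s t *\<^sub>v y t)
      = vec_integral r {a..b} (\<lambda>t. P t *\<^sub>v y t)"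
    using vec_integral_split[OF s iPy[unfolded if_mult]] unfolding if_mult by simp
  also have "\<dots> = vec_integral r {a..b} (\<lambda>t. P t *\<^sub>v (U *\<^sub>v f t) + P t *\<^sub>v w t)"
    by (rule vec_integral_cong_AE[OF ae]) simp
  also have "\<dots> = vec_integral r {a..b} (\<lambda>\<theta>. P \<theta> *\<^sub>v (U *\<^sub>v f \<theta>)) + vec_integral r {a..b} (\<lambda>\<theta>. I \<theta> *\<^sub>v f \<theta>)"
    unfolding vec_integral_add(1)[OF i1 iPw] Pw ..
  also have "\<dots> = vec_integral r {a..b} (\<lambda>\<theta>. P \<theta> *\<^sub>v (U *\<^sub>v f \<theta>) + I \<theta> *\<^sub>v f \<theta>)"
    unfolding vec_integral_add(1)[OF i1 iIf] ..
  finally have lhs: "vec_integral r {a..s} (\<lambda>t. A1 s t *\<^sub>v y t) + vec_integral r {s..b} (\<lambda>t. A2 s t *\<^sub>v y t)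
      = vec_integral r {a..b} (\<lambda>\<theta>. P \<theta> *\<^sub>v (U *\<^sub>v f \<theta>) + I \<theta> *\<^sub>v f \<theta>)" .
  \<comment> \<open>the kernel of the composition on either side of the diagonal\<close>
  define D1 where "D1 = (\<lambda>\<theta>. mat_integral r c {a..\<theta>} (\<lambda>t. A1 s t * R2 t \<theta>)
       + mat_integral r c {\<theta>..s} (\<lambda>t. A1 s t * R1 t \<theta>)
       + mat_integral r c {s..b} (\<lambda>t. A2 s t * R1 t \<theta>))"
  define D2 where "D2 = (\<lambda>\<theta>. mat_integral r c {a..s} (\<lambda>t. A1 s t * R2 t \<theta>)
       + mat_integral r c {s..\<theta>} (\<lambda>t. A2 s t * R2 t \<theta>)
       + mat_integral r c {\<theta>..b} (\<lambda>t. A2 s t * R1 t \<theta>))"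
  \<comment> \<open>on the diagonal \<open>t = \<theta>\<close>, a null set, the two sides may differ\<close>
  have diag: "AE t in lebesgue_on {p..q}. F t * K t \<theta> = (if t \<le> \<theta> then F t * R2 t \<theta> else F t * R1 t \<theta>)"
    for F :: "real \<Rightarrow> real Matrix.mat" and p q \<theta> :: real
    using AE_lebesgue_on_neq[of "{p..q}" \<theta>, simplified] by eventually_elim (auto simp: K_def)
  have below: "I \<theta> = D1 \<theta>" if \<theta>: "\<theta> \<in> {a..s}" for \<theta>
  proof -
    have \<theta>': "\<theta> \<in> {a..b}" using \<theta> s by auto
    have e: "P t * K t \<theta> = (if t \<le> s then A1 s t * K t \<theta> else A2 s t * R1 t \<theta>)" for t
      using \<theta> by (auto simp: P_def K_def)
    have int: "mat_integrable r c {a..b} (\<lambda>t. if t \<le> s then A1 s t * K t \<theta> else A2 s t * R1 t \<theta>)"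
      using mat_kernel_mult_mat_integrable[OF K Pi \<theta>'] unfolding e .
    have int': "mat_integrable r c {a..s} (\<lambda>t. if t \<le> \<theta> then A1 s t * R2 t \<theta> else A1 s t * R1 t \<theta>)"
    proof (rule mat_integrable_cong_AE[OF _ _ mat_integral_split(2)[OF s int]])
      show "AE t in lebesgue_on {a..s}. (if t \<le> \<theta> then A1 s t * R2 t \<theta> else A1 s t * R1 t \<theta>) = A1 s t * K t \<theta>"
        using diag[of "A1 s" \<theta> a s] by eventually_elim simp
      fix t assume "t \<in> {a..s}"
      then have "t \<in> {a..b}" using s by auto
      then show "(if t \<le> \<theta> then A1 s t * R2 t \<theta> else A1 s t * R1 t \<theta>) \<in> carrier_mat r c"
        using mult_carrier_mat[OF A1c R1c[OF _ \<theta>']] mult_carrier_mat[OF A1c R2c[OF _ \<theta>']] by simp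
    qed simp
    show ?thesis
      unfolding I_def D1_def e mat_integral_split(1)[OF s int]
      unfolding mat_integral_cong_AE[OF diag[of "A1 s" \<theta> a s], simplified] mat_integral_split(1)[OF \<theta> int'] ..
  qed
  have above: "I \<theta> = D2 \<theta>" if \<theta>: "\<theta> \<in> {s..b}" "s < \<theta>" for \<theta>
  proof -
    have \<theta>': "\<theta> \<in> {a..b}" using \<theta> s by auto
    have e: "P t * K t \<theta> = (if t \<le> s then A1 s t * R2 t \<theta> else A2 s t * K t \<theta>)" for t
      using \<theta> by (auto simp: P_def K_def)
    have int: "mat_integrable r c {a..b} (\<lambda>t. if t \<le> s then A1 s t * R2 t \<theta> else A2 s t * K t \<theta>)"
      using mat_kernel_mult_mat_integrable[OF K Pi \<theta>'] unfolding e .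
    have sub: "t \<in> {a..b}" if "t \<in> {s..b}" for t using s that by auto
    have int1: "mat_integrable r c {s..b} (\<lambda>t. A2 s t * K t \<theta>)"
      by (rule mat_integral_split_integrable[OF s int]) (rule mult_carrier_mat[OF A2c[OF sub] Kc[OF sub \<theta>']])
    have int': "mat_integrable r c {s..b} (\<lambda>t. if t \<le> \<theta> then A2 s t * R2 t \<theta> else A2 s t * R1 t \<theta>)"
    proof (rule mat_integrable_cong_AE[OF _ _ int1])
      show "AE t in lebesgue_on {s..b}. (if t \<le> \<theta> then A2 s t * R2 t \<theta> else A2 s t * R1 t \<theta>) = A2 s t * K t \<theta>"
        using diag[of "A2 s" \<theta> s b] by eventually_elim simp
      fix t assume "t \<in> {s..b}"
      then have "t \<in> {a..b}" by (rule sub)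
      then show "(if t \<le> \<theta> then A2 s t * R2 t \<theta> else A2 s t * R1 t \<theta>) \<in> carrier_mat r c"
        using mult_carrier_mat[OF A2c R1c[OF _ \<theta>']] mult_carrier_mat[OF A2c R2c[OF _ \<theta>']] by simp
    qed simp
    show ?thesis
      unfolding I_def D2_def e mat_integral_split(1)[OF s int]
      unfolding mat_integral_cong_AE[OF diag[of "A2 s" \<theta> s b], simplified] mat_integral_split(1)[OF \<theta>(1) int']
      by (rule assoc_add_mat[symmetric, of _ r c]) simp_all
  qed
  have Dc: "D1 \<theta> \<in> carrier_mat r c" "D2 \<theta> \<in> carrier_mat r c" for \<theta>
    unfolding D1_def D2_def by (intro add_carrier_mat mat_integral_carrier)+
  define E1 where "E1 = (\<lambda>\<theta>. (A1 s \<theta> * U + D1 \<theta>) *\<^sub>v f \<theta>)"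
  define E2 where "E2 = (\<lambda>\<theta>. (A2 s \<theta> * U + D2 \<theta>) *\<^sub>v f \<theta>)"
  have E: "P \<theta> *\<^sub>v (U *\<^sub>v f \<theta>) + I \<theta> *\<^sub>v f \<theta> = (if \<theta> \<le> s then E1 \<theta> else E2 \<theta>)" if \<theta>: "\<theta> \<in> {a..b}" for \<theta>
  proof -
    have "P \<theta> *\<^sub>v (U *\<^sub>v f \<theta>) + I \<theta> *\<^sub>v f \<theta> = (P \<theta> * U + I \<theta>) *\<^sub>v f \<theta>"
      using assoc_mult_mat_vec[OF Pc[OF \<theta>] U fc[OF \<theta>]]
        add_mult_distrib_mat_vec[OF mult_carrier_mat[OF Pc[OF \<theta>] U] _ fc[OF \<theta>], of "I \<theta>"] by (simp add: I_def)
    also have "\<dots> = (if \<theta> \<le> s then E1 \<theta> else E2 \<theta>)"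
      using below[of \<theta>] above[of \<theta>] \<theta> by (auto simp: P_def E1_def E2_def)
    finally show ?thesis .
  qed
  have Ec: "E1 \<theta> \<in> carrier_vec r" "E2 \<theta> \<in> carrier_vec r" if "\<theta> \<in> {a..b}" for \<theta>
    unfolding E1_def E2_def by (intro mult_mat_vec_carrier[of _ r c] add_carrier_mat Dc fc that)+
  have intE: "vec_integrable r {a..b} (\<lambda>\<theta>. if \<theta> \<le> s then E1 \<theta> else E2 \<theta>)"
    using vec_integral_add(2)[OF i1 iIf] by (rule vec_integrable_cong[THEN iffD1, rotated]) (rule E)
  have intE': "vec_integrable r {a..s} E1" "vec_integrable r {s..b} E2"
    using s by (auto intro!: vec_integral_split_integrable[OF s intE] Ec)
  have lhs': "vec_integral r {a..s} (\<lambda>t. A1 s t *\<^sub>v y t) + vec_integral r {s..b} (\<lambda>t. A2 s t *\<^sub>v y t)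
      = vec_integral r {a..s} E1 + vec_integral r {s..b} E2"
    unfolding lhs vec_integral_split[OF s intE, symmetric] by (rule vec_integral_cong) (rule E)
  \<comment> \<open>the multiplication operator applied to the inner operator\<close>
  have intR: "vec_integrable m {a..b} (\<lambda>\<theta>. if \<theta> \<le> s then R1 s \<theta> *\<^sub>v f \<theta> else R2 s \<theta> *\<^sub>v f \<theta>)"
    using mat_kernel_mult_vec_integrable[OF K f s] unfolding K_def if_distrib[of "\<lambda>M. M *\<^sub>v _"] .
  have intR': "vec_integrable m {a..s} (\<lambda>\<theta>. R1 s \<theta> *\<^sub>v f \<theta>)" "vec_integrable m {s..b} (\<lambda>\<theta>. R2 s \<theta> *\<^sub>v f \<theta>)"
    using s by (auto intro!: vec_integral_split_integrable[OF s intR] mult_mat_vec_carrier[OF R1c[OF s] fc]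
        mult_mat_vec_carrier[OF R2c[OF s] fc])
  have sub: "\<theta> \<in> {a..b}" if "\<theta> \<in> {a..s} \<or> \<theta> \<in> {s..b}" for \<theta> using s that by auto
  have c1: "C1 s \<theta> *\<^sub>v f \<theta> = A0 s *\<^sub>v (R1 s \<theta> *\<^sub>v f \<theta>) + E1 \<theta>" if "\<theta> \<in> {a..s}" for \<theta>
  proof -
    have \<theta>: "\<theta> \<in> {a..b}" using sub that by blast
    have "C1 s \<theta> = A0 s * R1 s \<theta> + (A1 s \<theta> * U + D1 \<theta>)"
      unfolding C1_def D1_def using A0 R1c[OF s \<theta>] A1c[OF \<theta>] U
      by (intro eq_matI) (auto simp: algebra_simps)
    then show ?thesis
      using add_mult_distrib_mat_vec[OF mult_carrier_mat[OF A0 R1c[OF s \<theta>]]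
          add_carrier_mat[OF Dc(1), of "A1 s \<theta> * U" \<theta>] fc[OF \<theta>]]
        assoc_mult_mat_vec[OF A0 R1c[OF s \<theta>] fc[OF \<theta>]] by (simp add: E1_def)
  qed
  have c2: "C2 s \<theta> *\<^sub>v f \<theta> = A0 s *\<^sub>v (R2 s \<theta> *\<^sub>v f \<theta>) + E2 \<theta>" if "\<theta> \<in> {s..b}" for \<theta>
  proof -
    have \<theta>: "\<theta> \<in> {a..b}" using sub that by blast
    have "C2 s \<theta> = A0 s * R2 s \<theta> + (A2 s \<theta> * U + D2 \<theta>)"
      unfolding C2_def D2_def using A0 R2c[OF s \<theta>] A2c[OF \<theta>] U
      by (intro eq_matI) (auto simp: algebra_simps)
    then show ?thesis
      using add_mult_distrib_mat_vec[OF mult_carrier_mat[OF A0 R2c[OF s \<theta>]]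
          add_carrier_mat[OF Dc(2), of "A2 s \<theta> * U" \<theta>] fc[OF \<theta>]]
        assoc_mult_mat_vec[OF A0 R2c[OF s \<theta>] fc[OF \<theta>]] by (simp add: E2_def)
  qed
  let ?r1 = "vec_integral m {a..s} (\<lambda>\<theta>. R1 s \<theta> *\<^sub>v f \<theta>)" and ?r2 = "vec_integral m {s..b} (\<lambda>\<theta>. R2 s \<theta> *\<^sub>v f \<theta>)"
  have v1: "vec_integral r {a..s} (\<lambda>\<theta>. C1 s \<theta> *\<^sub>v f \<theta>) = A0 s *\<^sub>v ?r1 + vec_integral r {a..s} E1"
    unfolding vec_integral_mult_mat(1)[OF intR'(1) A0, symmetric]
      vec_integral_add(1)[OF vec_integral_mult_mat(2)[OF intR'(1) A0] intE'(1), symmetric]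
    by (rule vec_integral_cong) (rule c1)
  have v2: "vec_integral r {s..b} (\<lambda>\<theta>. C2 s \<theta> *\<^sub>v f \<theta>) = A0 s *\<^sub>v ?r2 + vec_integral r {s..b} E2"
    unfolding vec_integral_mult_mat(1)[OF intR'(2) A0, symmetric]
      vec_integral_add(1)[OF vec_integral_mult_mat(2)[OF intR'(2) A0] intE'(2), symmetric]
    by (rule vec_integral_cong) (rule c2)
  have A0y: "A0 s *\<^sub>v y s = A0 s *\<^sub>v (U *\<^sub>v f s) + A0 s *\<^sub>v ?r1 + A0 s *\<^sub>v ?r2"
    unfolding y(3) PI_op_def
    by (simp add: mult_add_distrib_mat_vec[OF A0] Ufc[OF s] add_carrier_vec[of _ m])
  have "PI_op a b r A0 A1 A2 y s = A0 s *\<^sub>v y s +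
     (vec_integral r {a..s} (\<lambda>t. A1 s t *\<^sub>v y t) + vec_integral r {s..b} (\<lambda>t. A2 s t *\<^sub>v y t))"
    unfolding PI_op_def by (rule assoc_add_vec[of _ r]) (simp_all add: mult_mat_vec_carrier[OF A0 y(1)[OF s]])
  also have "\<dots> = A0 s *\<^sub>v (U *\<^sub>v f s) + A0 s *\<^sub>v ?r1 + A0 s *\<^sub>v ?r2 + (vec_integral r {a..s} E1 + vec_integral r {s..b} E2)"
    unfolding lhs' A0y ..
  also have "\<dots> = A0 s *\<^sub>v (U *\<^sub>v f s) + (A0 s *\<^sub>v ?r1 + vec_integral r {a..s} E1) + (A0 s *\<^sub>v ?r2 + vec_integral r {s..b} E2)"
    using A0 by (intro eq_vecI) auto
  also have "\<dots> = PI_op a b r C0 C1 C2 f s"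
    unfolding PI_op_def v1 v2 C0_def assoc_mult_mat_vec[OF A0 U fc[OF s]] ..
  finally show ?thesis .
qed

section \<open>Weak derivatives of vector valued functions\<close>

lemma L2_append:
  assumes u: "u \<in> L2 a b m" and v: "v \<in> L2 a b k"
  shows "(\<lambda>s. u s @\<^sub>v v s) \<in> L2 a b (m + k)"
proof (rule L2_cong[where v = "\<lambda>s. Matrix.vec (m+k) (\<lambda>i. if i < m then u s $ i else v s $ (i - m))"])
  show "(u s @\<^sub>v v s) $ i = Matrix.vec (m+k) (\<lambda>i. if i < m then u s $ i else v s $ (i - m)) $ i"
    if "s \<in> {a..b}" "i < m + k" for s i
    using L2D(1)[OF u that(1)] L2D(1)[OF v that(1)] that(2) by simp
  show "u s @\<^sub>v v s \<in> carrier_vec (m + k)" if "s \<in> {a..b}" for s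
    using L2D(1)[OF u that] L2D(1)[OF v that] by simp
  fix i assume i: "i < m + k"
  show "(\<lambda>s. Matrix.vec (m+k) (\<lambda>i. if i < m then u s $ i else v s $ (i - m)) $ i) \<in> borel_measurable (lebesgue_on {a..b}) \<and>
       integrable (lebesgue_on {a..b}) (\<lambda>s. (Matrix.vec (m+k) (\<lambda>i. if i < m then u s $ i else v s $ (i - m)) $ i)\<^sup>2)"
  proof (cases "i < m")
    case True
    then show ?thesis using L2D(2,3)[OF u True] by simp
  next
    case False
    then have "i - m < k" using i by simp
    then show ?thesis using L2D(2,3)[OF v, of "i - m"] i False by simp
  qed
qed

lemma vec_integral_append:
  assumes u: "\<And>s. s \<in> S \<Longrightarrow> u s \<in> carrier_vec m" and v: "\<And>s. s \<in> S \<Longrightarrow> v s \<in> carrier_vec k"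
  shows "vec_integral (m + k) S (\<lambda>s. u s @\<^sub>v v s) = vec_integral m S u @\<^sub>v vec_integral k S v"
proof (intro eq_vecI)
  fix i assume "i < dim_vec (vec_integral m S u @\<^sub>v vec_integral k S v)"
  then have i: "i < m + k" by simp
  have "(u s @\<^sub>v v s) $ i = (if i < m then u s $ i else v s $ (i - m))" if "s \<in> S" for s
    using u[OF that] v[OF that] i by simp
  then have "(LINT s|lebesgue_on S. (u s @\<^sub>v v s) $ i)
      = (LINT s|lebesgue_on S. (if i < m then u s $ i else v s $ (i - m)))"
    by (rule LINT_cong)
  then show "vec_integral (m + k) S (\<lambda>s. u s @\<^sub>v v s) $ i = (vec_integral m S u @\<^sub>v vec_integral k S v) $ i"
    using i by (cases "i < m") simp_all
qed simp

lemma AE_all_less: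
  fixes P :: "nat \<Rightarrow> 'a \<Rightarrow> bool"
  assumes "\<And>i. i < m \<Longrightarrow> AE s in M. P i s"
  shows "AE s in M. \<forall>i<m. P i s"
proof -
  have "AE s in M. i < m \<longrightarrow> P i s" for i
    using assms[of i] by (cases "i < m") simp_all
  then show ?thesis by (simp add: AE_all_countable)
qed

lemma has_weak_derivD:
  assumes "has_weak_deriv a b m u v"
  shows "u \<in> L2 a b m" "v \<in> L2 a b m"
    and "i < m \<Longrightarrow> test_function a b \<phi> \<phi>' \<Longrightarrow>
        (LINT s|lebesgue_on {a..b}. u s $ i * \<phi>' s) = - (LINT s|lebesgue_on {a..b}. v s $ i * \<phi> s)"
  using assms unfolding has_weak_deriv_def by blast+

lemma has_weak_deriv_primitive:
  assumes "a < b" and w: "has_weak_deriv a b m u v"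
  shows "\<exists>c\<in>carrier_vec m. AE s in lebesgue_on {a..b}. u s = c + vec_integral m {a..s} v"
proof -
  note u = has_weak_derivD(1)[OF w] and v = has_weak_derivD(2)[OF w]
  note ui = vec_integrableD(3)[OF L2_imp_vec_integrable[OF u]]
  note vi = vec_integrableD(3)[OF L2_imp_vec_integrable[OF v]]
  have "\<exists>C. AE s in lebesgue_on {a..b}. u s $ i = C + (LINT \<theta>|lebesgue_on {a..s}. v \<theta> $ i)" if "i < m" for i
    by (rule weak_derivative_primitive[OF \<open>a < b\<close> ui[OF that] vi[OF that]]) (rule has_weak_derivD(3)[OF w that])
  then obtain C where C: "\<And>i. i < m \<Longrightarrow> AE s in lebesgue_on {a..b}. u s $ i = C i + (LINT \<theta>|lebesgue_on {a..s}. v \<theta> $ i)"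
    by metis
  have "AE s in lebesgue_on {a..b}. \<forall>i<m. u s $ i = C i + (LINT \<theta>|lebesgue_on {a..s}. v \<theta> $ i)"
    by (rule AE_all_less) (rule C)
  then have "AE s in lebesgue_on {a..b}. u s = Matrix.vec m C + vec_integral m {a..s} v"
    using AE_space[of "lebesgue_on {a..b}"]
  proof eventually_elim
    case (elim s)
    then have "u s \<in> carrier_vec m" using L2D(1)[OF u] by simp
    then show ?case using elim(1) by (intro eq_vecI) simp_all
  qed
  then show ?thesis by (intro bexI[of _ "Matrix.vec m C"]) simp_all
qed

lemma has_weak_deriv_unique:
  assumes "a < b" and w: "has_weak_deriv a b m u v" and w': "has_weak_deriv a b m u v'"
  shows "AE s in lebesgue_on {a..b}. v s = v' s"
proof -
  note v = has_weak_derivD(2)[OF w] and v' = has_weak_derivD(2)[OF w']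
  note vi = vec_integrableD(3)[OF L2_imp_vec_integrable[OF v]]
  note vi' = vec_integrableD(3)[OF L2_imp_vec_integrable[OF v']]
  obtain c where c: "c \<in> carrier_vec m" "AE s in lebesgue_on {a..b}. u s = c + vec_integral m {a..s} v"
    using has_weak_deriv_primitive[OF \<open>a < b\<close> w] by blast
  obtain c' where c': "c' \<in> carrier_vec m" "AE s in lebesgue_on {a..b}. u s = c' + vec_integral m {a..s} v'"
    using has_weak_deriv_primitive[OF \<open>a < b\<close> w'] by blast
  have "AE s in lebesgue_on {a..b}. v s $ i = v' s $ i" if i: "i < m" for i
  proof (rule primitive_unique[OF \<open>a < b\<close> vi[OF i] vi'[OF i]])
    show "AE s in lebesgue_on {a..b}. c $ i + (LINT \<theta>|lebesgue_on {a..s}. v \<theta> $ i)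
        = c' $ i + (LINT \<theta>|lebesgue_on {a..s}. v' \<theta> $ i)"
      using c(2) c'(2)
    proof eventually_elim
      case (elim s)
      then have "(c + vec_integral m {a..s} v) $ i = (c' + vec_integral m {a..s} v') $ i" by simp
      then show ?case using i by simp
    qed
  qed
  then have "AE s in lebesgue_on {a..b}. \<forall>i<m. v s $ i = v' s $ i"
    by (rule AE_all_less)
  then show ?thesis using AE_space[of "lebesgue_on {a..b}"]
  proof eventually_elim
    case (elim s)
    then have "v s \<in> carrier_vec m" "v' s \<in> carrier_vec m" using L2D(1)[OF v] L2D(1)[OF v'] by simp_all
    then show ?case using elim(1) by (intro eq_vecI) simp_all
  qed
qed

lemma has_weak_deriv_cong_AE:
  assumes w: "has_weak_deriv a b m u v" and u': "u' \<in> L2 a b m" and v': "v' \<in> L2 a b m"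
    and eu: "AE s in lebesgue_on {a..b}. u s = u' s" and ev: "AE s in lebesgue_on {a..b}. v s = v' s"
  shows "has_weak_deriv a b m u' v'"
  unfolding has_weak_deriv_def
proof (intro conjI allI impI)
  fix i \<phi> \<phi>' assume i: "i < m" and t: "test_function a b \<phi> \<phi>'"
  have "(LINT s|lebesgue_on {a..b}. u' s $ i * \<phi>' s) = (LINT s|lebesgue_on {a..b}. u s $ i * \<phi>' s)"
    by (rule LINT_cong_AE(1)) (use eu in eventually_elim, simp_all)
  also have "\<dots> = - (LINT s|lebesgue_on {a..b}. v s $ i * \<phi> s)"
    by (rule has_weak_derivD(3)[OF w i t])
  also have "(LINT s|lebesgue_on {a..b}. v s $ i * \<phi> s) = (LINT s|lebesgue_on {a..b}. v' s $ i * \<phi> s)"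
    by (rule LINT_cong_AE(1)) (use ev in eventually_elim, simp_all)
  finally show "(LINT s|lebesgue_on {a..b}. u' s $ i * \<phi>' s) = - (LINT s|lebesgue_on {a..b}. v' s $ i * \<phi> s)" .
qed (rule u' v')+

lemma has_weak_deriv_weak_deriv:
  "has_weak_deriv a b m u v \<Longrightarrow> has_weak_deriv a b m u (weak_deriv a b m u)"
  unfolding weak_deriv_def by (rule someI[of "\<lambda>v. has_weak_deriv a b m u v"])

text \<open>Functions that agree almost everywhere have the same weak derivatives, hence the same chosen one.\<close>

lemma weak_deriv_cong_AE:
  assumes "u \<in> L2 a b m" "u' \<in> L2 a b m" "AE s in lebesgue_on {a..b}. u s = u' s"
  shows "weak_deriv a b m u = weak_deriv a b m u'"
proof -
  have e: "AE s in lebesgue_on {a..b}. u' s = u s" using assms(3) by eventually_elim simp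
  have "has_weak_deriv a b m u v = has_weak_deriv a b m u' v" for v
    using has_weak_deriv_cong_AE[OF _ assms(2) _ assms(3), of v v] has_weak_deriv_cong_AE[OF _ assms(1) _ e, of v v]
      has_weak_derivD(2) by (metis AE_I2)
  then have "has_weak_deriv a b m u = has_weak_deriv a b m u'" by (rule ext)
  then show ?thesis unfolding weak_deriv_def by (rule arg_cong)
qed

text \<open>Two-fold integration: \<open>\<integral>\<^sub>a\<^sup>s \<integral>\<^sub>a\<^sup>t v(\<theta>) d\<theta> dt = \<integral>\<^sub>a\<^sup>s (s-\<theta>) v(\<theta>) d\<theta>\<close>.\<close>

lemma vec_integral_primitive:
  assumes "a \<le> s" and v: "vec_integrable m {a..s} v"
  shows "vec_integral m {a..s} (\<lambda>t. vec_integral m {a..t} v) = vec_integral m {a..s} (\<lambda>\<theta>. (s - \<theta>) \<cdot>\<^sub>v v \<theta>)"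
    and "vec_integrable m {a..s} (\<lambda>t. vec_integral m {a..t} v)"
    and "vec_integrable m {a..s} (\<lambda>\<theta>. (s - \<theta>) \<cdot>\<^sub>v v \<theta>)"
proof -
  have P: "(LINT t|lebesgue_on {a..s}. (LINT \<theta>|lebesgue_on {a..t}. v \<theta> $ i))
      = (LINT \<theta>|lebesgue_on {a..s}. v \<theta> $ i * (s - \<theta>))"
    "integrable (lebesgue_on {a..s}) (\<lambda>t. LINT \<theta>|lebesgue_on {a..t}. v \<theta> $ i)"
    "integrable (lebesgue_on {a..s}) (\<lambda>\<theta>. v \<theta> $ i * (s - \<theta>))" if i: "i < m" for i
    using integral_primitive_mult_deriv[OF vec_integrableD(3)[OF v i], of "\<lambda>t. t" "\<lambda>_. 1"] by simp_all
  have idx: "((s - \<theta>) \<cdot>\<^sub>v v \<theta>) $ i = v \<theta> $ i * (s - \<theta>)" if "\<theta> \<in> {a..s}" "i < m" for \<theta> i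
    using vec_integrableD(2)[OF v that(1)] that(2) by simp
  show "vec_integrable m {a..s} (\<lambda>t. vec_integral m {a..t} v)"
    unfolding vec_integrable_def using P(2) by simp
  show "vec_integrable m {a..s} (\<lambda>\<theta>. (s - \<theta>) \<cdot>\<^sub>v v \<theta>)"
    unfolding vec_integrable_def
  proof (intro conjI ballI allI impI)
    fix i assume i: "i < m"
    show "integrable (lebesgue_on {a..s}) (\<lambda>\<theta>. ((s - \<theta>) \<cdot>\<^sub>v v \<theta>) $ i)"
      by (rule integrable_on_cong[THEN iffD2, OF _ P(3)[OF i]]) (rule idx[OF _ i])
  qed (intro smult_carrier_vec[THEN iffD2] vec_integrableD(1)[OF v])
  show "vec_integral m {a..s} (\<lambda>t. vec_integral m {a..t} v) = vec_integral m {a..s} (\<lambda>\<theta>. (s - \<theta>) \<cdot>\<^sub>v v \<theta>)"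
  proof (intro eq_vecI)
    fix i assume "i < dim_vec (vec_integral m {a..s} (\<lambda>\<theta>. (s - \<theta>) \<cdot>\<^sub>v v \<theta>))"
    then have i: "i < m" by simp
    have "(LINT \<theta>|lebesgue_on {a..s}. ((s - \<theta>) \<cdot>\<^sub>v v \<theta>) $ i) = (LINT \<theta>|lebesgue_on {a..s}. v \<theta> $ i * (s - \<theta>))"
      by (rule LINT_cong) (rule idx[OF _ i])
    then show "vec_integral m {a..s} (\<lambda>t. vec_integral m {a..t} v) $ i
        = vec_integral m {a..s} (\<lambda>\<theta>. (s - \<theta>) \<cdot>\<^sub>v v \<theta>) $ i"
      using P(1)[OF i] i by simp
  qed simp
qed

lemma vec_integral_const:
  assumes "c \<in> carrier_vec m" "a \<le> s"
  shows "vec_integral m {a..s} (\<lambda>_. c) = (s - a) \<cdot>\<^sub>v c" "vec_integrable m {a..s} (\<lambda>_. c)"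
proof -
  interpret finite_measure "lebesgue_on {a..s}" by (rule finite_measure_lebesgue_on_Icc)
  show "vec_integral m {a..s} (\<lambda>_. c) = (s - a) \<cdot>\<^sub>v c"
    using assms by (intro eq_vecI) (simp_all add: measure_restrict_space)
  show "vec_integrable m {a..s} (\<lambda>_. c)"
    unfolding vec_integrable_def using assms by simp
qed

lemma vec_integral_singleton: "vec_integral m {a} f = 0\<^sub>v m"
proof (intro eq_vecI)
  fix i assume "i < dim_vec (0\<^sub>v m :: real Matrix.vec)"
  then show "vec_integral m {a} f $ i = (0\<^sub>v m) $ i"
    by (simp add: integral_eq_zero_null_sets)
qed simp

lemma vec_integrable_subinterval:
  "vec_integrable m {a..b} f \<Longrightarrow> {c..d} \<subseteq> {a..b} \<Longrightarrow> vec_integrable m {c..d} f"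
  unfolding vec_integrable_def using integrable_subinterval[of a b _ c d] by blast

section \<open>Square integrable matrix functions\<close>

lemma square_integrable_mat_cong:
  assumes "\<And>s i j. s \<in> {a..b} \<Longrightarrow> i < r \<Longrightarrow> j < c \<Longrightarrow> F s $$ (i,j) = g i j s"
    and "\<And>s. s \<in> {a..b} \<Longrightarrow> F s \<in> carrier_mat r c"
    and "\<And>i j. i < r \<Longrightarrow> j < c \<Longrightarrow> g i j \<in> borel_measurable (lebesgue_on {a..b}) \<and>
       integrable (lebesgue_on {a..b}) (\<lambda>s. (g i j s)\<^sup>2)"
  shows "square_integrable_mat a b r c F"
  unfolding square_integrable_mat_def
proof (intro conjI ballI allI impI)
  fix i j assume ij: "i < r" "j < c"
  show "(\<lambda>s. F s $$ (i,j)) \<in> borel_measurable (lebesgue_on {a..b})"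
    by (rule measurable_cong[THEN iffD2, OF _ conjunct1[OF assms(3)[OF ij]]]) (use assms(1) ij in simp)
  show "integrable (lebesgue_on {a..b}) (\<lambda>s. (F s $$ (i,j))\<^sup>2)"
    by (rule integrable_on_cong[THEN iffD2, OF _ conjunct2[OF assms(3)[OF ij]]]) (use assms(1) ij in simp)
qed (rule assms(2))

lemma mat_kernel_integral_square_integrable:
  assumes K: "mat_kernel a b m c K" and P: "mat_integrable r m {a..b} P"
  shows "square_integrable_mat a b r c (\<lambda>\<theta>. mat_integral r c {a..b} (\<lambda>t. P t * K t \<theta>))"
proof (rule square_integrable_mat_cong)
  fix \<theta> i k assume "\<theta> \<in> {a..b}" "i < r" "k < c"
  then show "mat_integral r c {a..b} (\<lambda>t. P t * K t \<theta>) $$ (i,k)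
     = (\<Sum>j<m. 1 * (LINT t|lebesgue_on {a..b}. P t $$ (i,j) * K t \<theta> $$ (j,k)))"
    using mat_kernel_integral_index(2)[OF K P] by simp
next
  fix i k assume ik: "i < r" "k < c"
  show "(\<lambda>\<theta>. (\<Sum>j<m. 1 * (LINT t|lebesgue_on {a..b}. P t $$ (i,j) * K t \<theta> $$ (j,k)))) \<in> borel_measurable (lebesgue_on {a..b}) \<and>
    integrable (lebesgue_on {a..b}) (\<lambda>\<theta>. (\<Sum>j<m. 1 * (LINT t|lebesgue_on {a..b}. P t $$ (i,j) * K t \<theta> $$ (j,k)))\<^sup>2)"
    using ik by (intro square_integrable_linear_combination L2_kernel_integral(1,2)[OF mat_kernelD(2)[OF K]
          mat_integrableD(2)[OF P]]) simp_all
qed simp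

lemma square_integrable_mat_add:
  assumes F: "square_integrable_mat a b r c F" and G: "square_integrable_mat a b r c G"
  shows "square_integrable_mat a b r c (\<lambda>s. F s + G s)"
proof (rule square_integrable_mat_cong[where g = "\<lambda>i j s. F s $$ (i,j) + G s $$ (i,j)"])
  show "(F s + G s) $$ (i,j) = F s $$ (i,j) + G s $$ (i,j)" if "s \<in> {a..b}" "i < r" "j < c" for s i j
    using square_integrable_matD(1)[OF G that(1)] that(2,3) by simp
  show "(\<lambda>s. F s $$ (i,j) + G s $$ (i,j)) \<in> borel_measurable (lebesgue_on {a..b}) \<and>
       integrable (lebesgue_on {a..b}) (\<lambda>s. (F s $$ (i,j) + G s $$ (i,j))\<^sup>2)" if ij: "i < r" "j < c" for i j
    using borel_measurable_add[OF square_integrable_matD(2)[OF F ij] square_integrable_matD(2)[OF G ij]]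
      integrable_square_sum[OF square_integrable_matD(2)[OF F ij] square_integrable_matD(2)[OF G ij]
        square_integrable_matD(3)[OF F ij] square_integrable_matD(3)[OF G ij]] by blast
qed (rule add_carrier_mat[OF square_integrable_matD(1)[OF G]])

lemma square_integrable_mat_mult_left:
  assumes M: "M \<in> carrier_mat r m" and F: "square_integrable_mat a b m c F"
  shows "square_integrable_mat a b r c (\<lambda>s. M * F s)"
proof (rule square_integrable_mat_cong[where g = "\<lambda>i k s. \<Sum>j<m. M $$ (i,j) * F s $$ (j,k)"])
  show "(M * F s) $$ (i,k) = (\<Sum>j<m. M $$ (i,j) * F s $$ (j,k))" if "s \<in> {a..b}" "i < r" "k < c" for s i k
    by (rule mult_mat_index[OF M square_integrable_matD(1)[OF F that(1)] that(2,3)])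
  show "(\<lambda>s. \<Sum>j<m. M $$ (i,j) * F s $$ (j,k)) \<in> borel_measurable (lebesgue_on {a..b}) \<and>
    integrable (lebesgue_on {a..b}) (\<lambda>s. (\<Sum>j<m. M $$ (i,j) * F s $$ (j,k))\<^sup>2)" if "i < r" "k < c" for i k
    using that by (intro square_integrable_linear_combination square_integrable_matD(2,3)[OF F]) simp_all
qed (rule mult_carrier_mat[OF M square_integrable_matD(1)[OF F]])

lemma square_integrable_mat_mult_right:
  assumes F: "square_integrable_mat a b r m F" and M: "M \<in> carrier_mat m c"
  shows "square_integrable_mat a b r c (\<lambda>s. F s * M)"
proof (rule square_integrable_mat_cong[where g = "\<lambda>i k s. \<Sum>j<m. M $$ (j,k) * F s $$ (i,j)"])
  show "(F s * M) $$ (i,k) = (\<Sum>j<m. M $$ (j,k) * F s $$ (i,j))" if "s \<in> {a..b}" "i < r" "k < c" for s i k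
    unfolding mult_mat_index[OF square_integrable_matD(1)[OF F that(1)] M that(2,3)] by (simp only: mult.commute)
  show "(\<lambda>s. \<Sum>j<m. M $$ (j,k) * F s $$ (i,j)) \<in> borel_measurable (lebesgue_on {a..b}) \<and>
    integrable (lebesgue_on {a..b}) (\<lambda>s. (\<Sum>j<m. M $$ (j,k) * F s $$ (i,j))\<^sup>2)" if "i < r" "k < c" for i k
    using that by (intro square_integrable_linear_combination square_integrable_matD(2,3)[OF F]) simp_all
qed (rule mult_carrier_mat[OF square_integrable_matD(1)[OF F] M])

lemma square_integrable_mat_eq:
  assumes G: "square_integrable_mat a b r c G" and eq: "\<And>s. s \<in> {a..b} \<Longrightarrow> F s = G s"
  shows "square_integrable_mat a b r c F"
proof (rule square_integrable_mat_cong[where g = "\<lambda>i j s. G s $$ (i,j)"])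
  show "F s $$ (i,j) = G s $$ (i,j)" if "s \<in> {a..b}" for s i j using eq[OF that] by simp
  show "F s \<in> carrier_mat r c" if "s \<in> {a..b}" for s
    unfolding eq[OF that] by (rule square_integrable_matD(1)[OF G that])
qed (intro conjI square_integrable_matD(2,3)[OF G])

lemma square_integrable_mat_diff:
  assumes F: "square_integrable_mat a b r c F" and G: "square_integrable_mat a b r c G"
  shows "square_integrable_mat a b r c (\<lambda>s. F s - G s)"
proof (rule square_integrable_mat_eq)
  show "square_integrable_mat a b r c (\<lambda>s. F s + (- 1\<^sub>m r) * G s)"
    by (intro square_integrable_mat_add[OF F] square_integrable_mat_mult_left[OF _ G]) simp
  show "F s - G s = F s + (- 1\<^sub>m r) * G s" if "s \<in> {a..b}" for s
    using square_integrable_matD(1)[OF G that] square_integrable_matD(1)[OF F that]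
    by (simp add: minus_add_uminus_mat)
qed

lemma square_integrable_mat_mult:
  assumes F: "square_integrable_mat a b r m F" and G: "square_integrable_mat a b m c G"
  shows "mat_integrable r c {a..b} (\<lambda>s. F s * G s)"
  unfolding mat_integrable_def
proof (intro conjI ballI allI impI)
  fix i k assume ik: "i < r" "k < c"
  have "integrable (lebesgue_on {a..b}) (\<lambda>s. \<Sum>j<m. F s $$ (i,j) * G s $$ (j,k))"
    using ik by (intro Bochner_Integration.integrable_sum integrable_mult_square
        square_integrable_matD(2,3)[OF F] square_integrable_matD(2,3)[OF G]) simp_all
  then show "integrable (lebesgue_on {a..b}) (\<lambda>s. (F s * G s) $$ (i,k))"
    by (rule integrable_on_cong[THEN iffD2, rotated])
      (rule mult_mat_index[OF square_integrable_matD(1)[OF F] square_integrable_matD(1)[OF G] ik])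
qed (rule mult_carrier_mat[OF square_integrable_matD(1)[OF F] square_integrable_matD(1)[OF G]])

lemma continuous_imp_square_integrable_mat:
  assumes "\<And>s. s \<in> {a..b} \<Longrightarrow> F s \<in> carrier_mat r c"
    and "\<And>i j. i < r \<Longrightarrow> j < c \<Longrightarrow> continuous_on {a..b} (\<lambda>s. F s $$ (i,j))"
  shows "square_integrable_mat a b r c F"
  unfolding square_integrable_mat_def
  using assms continuous_imp_measurable_square_integrable by blast

lemma ess_bounded_imp_square_integrable:
  assumes "ess_bounded_mat a b r c F"
  shows "square_integrable_mat a b r c F"
  unfolding square_integrable_mat_def
proof (intro conjI ballI allI impI)
  fix i j assume ij: "i < r" "j < c"
  then show m: "(\<lambda>s. F s $$ (i,j)) \<in> borel_measurable (lebesgue_on {a..b})"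
    using assms unfolding ess_bounded_mat_def by blast
  obtain K where K: "AE s in lebesgue_on {a..b}. \<bar>F s $$ (i,j)\<bar> \<le> K"
    using assms ij unfolding ess_bounded_mat_def by blast
  interpret finite_measure "lebesgue_on {a..b}" by (rule finite_measure_lebesgue_on_Icc)
  show "integrable (lebesgue_on {a..b}) (\<lambda>s. (F s $$ (i,j))\<^sup>2)"
  proof (rule integrable_const_bound[where B = "K\<^sup>2"])
    show "AE s in lebesgue_on {a..b}. norm ((F s $$ (i,j))\<^sup>2) \<le> K\<^sup>2"
      using K
    proof eventually_elim
      case (elim s)
      then have "\<bar>F s $$ (i,j)\<bar>\<^sup>2 \<le> K\<^sup>2" by (rule power_mono) simp
      then show ?case by simp
    qed
  qed (use m in measurable)
qed (use assms in \<open>simp add: ess_bounded_mat_def\<close>)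

lemma separable_imp_square_integrable:
  assumes R: "separable_mat a b r c R" and s: "s \<in> {a..b}"
  shows "square_integrable_mat a b r c (R s)"
proof -
  obtain k F G where F: "ess_bounded_mat a b k r F" and G: "ess_bounded_mat a b k c G"
    and eq: "\<And>\<theta>. \<theta> \<in> {a..b} \<Longrightarrow> R s \<theta> = transpose_mat (F s) * G \<theta>"
    using R s unfolding separable_mat_def by blast
  have "F s \<in> carrier_mat k r" using F s by (simp add: ess_bounded_mat_def)
  then have "transpose_mat (F s) \<in> carrier_mat r k" by simp
  from square_integrable_mat_mult_left[OF this ess_bounded_imp_square_integrable[OF G]]
  have S: "square_integrable_mat a b r c (\<lambda>\<theta>. transpose_mat (F s) * G \<theta>)" .
  show ?thesis by (rule square_integrable_mat_eq[OF S eq])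
qed

section \<open>Block matrices\<close>

lemma append_vec_assoc: "(u @\<^sub>v v) @\<^sub>v w = u @\<^sub>v (v @\<^sub>v (w :: 'a Matrix.vec))"
  by (intro eq_vecI) (auto simp: less_diff_conv2)

lemma append_vec_empty: "dim_vec w = 0 \<Longrightarrow> v @\<^sub>v w = v"
  by (intro eq_vecI) auto

lemma vec_minus_add_cancel:
  fixes u v :: "real Matrix.vec"
  shows "u \<in> carrier_vec n \<Longrightarrow> v \<in> carrier_vec n \<Longrightarrow> u - v + v = u"
  by (intro eq_vecI) auto

lemma append_cols_carrier:
  assumes "M \<in> carrier_mat r c" "N \<in> carrier_mat r d"
  shows "M @\<^sub>c N \<in> carrier_mat r (c + d)"
  using assms unfolding append_cols_def by (intro carrier_matI) auto

lemma zero_mat_mult_vec: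
  fixes u :: "real Matrix.vec"
  shows "u \<in> carrier_vec n \<Longrightarrow> 0\<^sub>m k n *\<^sub>v u = 0\<^sub>v k"
  by (intro eq_vecI) auto

lemma append_cols_mult_vec:
  assumes M: "M \<in> carrier_mat r c" and N: "N \<in> carrier_mat r d" and v: "v \<in> carrier_vec c" and w: "w \<in> carrier_vec d"
  shows "(M @\<^sub>c N) *\<^sub>v (v @\<^sub>v w) = M *\<^sub>v v + N *\<^sub>v w"
proof -
  have "(M @\<^sub>c N) *\<^sub>v (v @\<^sub>v w) = (M *\<^sub>v v + N *\<^sub>v w) @\<^sub>v (0\<^sub>m 0 c *\<^sub>v v + 0\<^sub>m 0 d *\<^sub>v w)"
    unfolding append_cols_def carrier_matD(2)[OF M] carrier_matD(2)[OF N]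
    by (rule four_block_mat_mult_vec[OF M N zero_carrier_mat zero_carrier_mat v w])
  then show ?thesis by (simp add: append_vec_empty)
qed

lemma append_cols3_mult_vec:
  assumes M: "M1 \<in> carrier_mat r c1" "M2 \<in> carrier_mat r c2" "M3 \<in> carrier_mat r c3"
    and v: "v1 \<in> carrier_vec c1" "v2 \<in> carrier_vec c2" "v3 \<in> carrier_vec c3"
  shows "(M1 @\<^sub>c M2 @\<^sub>c M3) *\<^sub>v (v1 @\<^sub>v v2 @\<^sub>v v3) = M1 *\<^sub>v v1 + (M2 *\<^sub>v v2 + M3 *\<^sub>v v3)"
  using append_cols_mult_vec[OF M(1) append_cols_carrier[OF M(2,3)] v(1) append_carrier_vec[OF v(2,3)]]
    append_cols_mult_vec[OF M(2,3) v(2,3)] by simp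

lemma append_rows3_mult_vec:
  assumes M: "M1 \<in> carrier_mat r1 c" "M2 \<in> carrier_mat r2 c" "M3 \<in> carrier_mat r3 c"
    and v: "v \<in> carrier_vec c"
  shows "(M1 @\<^sub>r M2 @\<^sub>r M3) *\<^sub>v v = (M1 *\<^sub>v v) @\<^sub>v (M2 *\<^sub>v v) @\<^sub>v (M3 *\<^sub>v v)"
  using mat_mult_append[OF M(1) carrier_append_rows[OF M(2,3)] v] mat_mult_append[OF M(2,3) v] by simp

lemma append_rows_mult:
  assumes A: "A \<in> carrier_mat r m" and A': "A' \<in> carrier_mat r' m" and C: "C \<in> carrier_mat m c"
  shows "(A @\<^sub>r A') * C = (A * C) @\<^sub>r (A' * C)"
proof -
  have dims: "A @\<^sub>r A' \<in> carrier_mat (r + r') m" "(A * C) @\<^sub>r (A' * C) \<in> carrier_mat (r + r') c"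
    using A A' C by auto
  show ?thesis
  proof (intro eq_matI)
    fix i j assume "i < dim_row ((A * C) @\<^sub>r (A' * C))" "j < dim_col ((A * C) @\<^sub>r (A' * C))"
    then have ij: "i < r + r'" "j < c" using dims(2) by auto
    have col: "col ((A @\<^sub>r A') * C) j = col ((A * C) @\<^sub>r (A' * C)) j"
    proof -
      have "col ((A @\<^sub>r A') * C) j = (A @\<^sub>r A') *\<^sub>v col C j"
        by (rule col_mult2[OF dims(1) C ij(2)])
      also have "\<dots> = (A *\<^sub>v col C j) @\<^sub>v (A' *\<^sub>v col C j)"
        using C by (intro mat_mult_append[OF A A']) auto
      also have "\<dots> = col (A * C) j @\<^sub>v col (A' * C) j"
        using col_mult2[OF A C ij(2)] col_mult2[OF A' C ij(2)] by simp
      also have "\<dots> = col ((A * C) @\<^sub>r (A' * C)) j"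
        unfolding append_rows_def using A A' C ij by (subst col_four_block_mat[of _ r c _ 0 _ r']) auto
      finally show ?thesis .
    qed
    show "((A @\<^sub>r A') * C) $$ (i,j) = ((A * C) @\<^sub>r (A' * C)) $$ (i,j)"
      using arg_cong[OF col, of "\<lambda>u. u $ i"] ij dims C by simp
  qed (use dims C in auto)
qed

lemma diag_block_mat_Cons_carrier:
  assumes "A \<in> carrier_mat r c" "diag_block_mat As \<in> carrier_mat r' c'"
  shows "diag_block_mat (A # As) \<in> carrier_mat (r + r') (c + c')"
  using assms by (simp add: Let_def)

lemma diag_block_mat_Cons_mult_vec:
  fixes A :: "real Matrix.mat"
  assumes A: "A \<in> carrier_mat r c" and As: "diag_block_mat As \<in> carrier_mat r' c'"
    and v: "v \<in> carrier_vec c" and w: "w \<in> carrier_vec c'"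
  shows "diag_block_mat (A # As) *\<^sub>v (v @\<^sub>v w) = (A *\<^sub>v v) @\<^sub>v (diag_block_mat As *\<^sub>v w)"
proof -
  have "diag_block_mat (A # As) = four_block_mat A (0\<^sub>m r c') (0\<^sub>m r' c) (diag_block_mat As)"
    using A As by (simp add: Let_def)
  then show ?thesis
    using four_block_mat_mult_vec[OF A _ _ As v w, of "0\<^sub>m r c'" "0\<^sub>m r' c"] A As
    by (simp add: zero_mat_mult_vec[OF v] zero_mat_mult_vec[OF w] mult_mat_vec_carrier[OF A v] mult_mat_vec_carrier[OF As w])
qed

lemma first_rows_mult:
  assumes "N \<in> carrier_mat r m" "M \<in> carrier_mat m c" "k \<le> r"
  shows "first_rows k (N * M) = first_rows k N * M"
  using assms by (intro eq_matI) (auto simp: first_rows_def scalar_prod_def)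

lemma first_rows_carrier: "first_rows k M \<in> carrier_mat k (dim_col M)"
  by (simp add: first_rows_def)

lemma first_rows_one_mult_vec:
  assumes "u \<in> carrier_vec k" "v \<in> carrier_vec m"
  shows "first_rows k (1\<^sub>m (k + m)) *\<^sub>v (u @\<^sub>v v) = u"
proof (intro eq_vecI)
  fix i assume "i < dim_vec u"
  then have i: "i < k" using assms by simp
  have "row (first_rows k (1\<^sub>m (k + m))) i = unit_vec (k + m) i"
    using i by (intro eq_vecI) (auto simp: first_rows_def)
  then show "(first_rows k (1\<^sub>m (k + m)) *\<^sub>v (u @\<^sub>v v)) $ i = u $ i"
    using i assms by (simp add: first_rows_def)
qed (use assms in \<open>simp add: first_rows_def\<close>)

lemma smult_one_mult_vec:
  fixes v :: "real Matrix.vec"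
  shows "v \<in> carrier_vec n \<Longrightarrow> (s \<cdot>\<^sub>m 1\<^sub>m n) *\<^sub>v v = s \<cdot>\<^sub>v v"
  by (intro eq_vecI) (auto simp: smult_scalar_prod_distrib[of _ n])

lemma mat_inverse_invertible:
  fixes M :: "real Matrix.mat"
  assumes M: "M \<in> carrier_mat n n" and inv: "invertible_mat M"
  shows "the (mat_inverse M) \<in> carrier_mat n n" "the (mat_inverse M) * M = 1\<^sub>m n"
proof -
  obtain C where C: "M * C = 1\<^sub>m n" "C * M = 1\<^sub>m (dim_row C)"
    using inv M unfolding invertible_mat_def inverts_mat_def by auto
  have "dim_col C = n" using arg_cong[OF C(1), of dim_col] by simp
  moreover have "dim_row C = n" using arg_cong[OF C(2), of dim_col] M by simp
  ultimately have Cc: "C \<in> carrier_mat n n" by auto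
  have "M \<in> Units (ring_mat TYPE(real) n ())"
    unfolding Units_def using M Cc C by (auto simp: ring_mat_def)
  then obtain N where "mat_inverse M = Some N"
    using mat_inverse(1)[OF M, of "()"] by (cases "mat_inverse M") auto
  then show "the (mat_inverse M) \<in> carrier_mat n n" "the (mat_inverse M) * M = 1\<^sub>m n"
    using mat_inverse(2)[OF M] by auto
qed

lemma cont_rep_eq:
  assumes "a < b" and Z: "\<And>s. s \<in> {a..b} \<Longrightarrow> Z s \<in> carrier_vec m"
    "\<And>i. i < m \<Longrightarrow> continuous_on {a..b} (\<lambda>s. Z s $ i)"
    and ae: "AE s in lebesgue_on {a..b}. Z s = u s" and s: "s \<in> {a..b}"
  shows "cont_rep a b m u s = Z s"
proof -
  let ?C = "\<lambda>v. (\<forall>s\<in>{a..b}. v s \<in> carrier_vec m) \<and>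
     (\<forall>i<m. continuous_on {a..b} (\<lambda>s. v s $ i)) \<and> L2_eq a b v u"
  have "?C Z" using Z ae by (simp add: L2_eq_def)
  then have C: "?C (cont_rep a b m u)" unfolding cont_rep_def by (rule someI[of ?C])
  then have "AE s in lebesgue_on {a..b}. cont_rep a b m u s = u s" by (simp add: L2_eq_def)
  then have ae': "AE s in lebesgue_on {a..b}. cont_rep a b m u s = Z s"
    using ae by eventually_elim simp
  show ?thesis
  proof (intro eq_vecI)
    fix i assume "i < dim_vec (Z s)"
    then have i: "i < m" using Z(1)[OF s] by simp
    show "cont_rep a b m u s $ i = Z s $ i"
    proof (rule continuous_AE_eq_imp_eq[OF \<open>a < b\<close> _ Z(2)[OF i] _ s])
      show "continuous_on {a..b} (\<lambda>s. cont_rep a b m u s $ i)" using C i by blast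
      show "AE s in lebesgue_on {a..b}. cont_rep a b m u s $ i = Z s $ i"
        using ae' by eventually_elim simp
    qed
  qed (use C s Z(1)[OF s] in force)
qed

section \<open>The state and its boundary conditions\<close>

context pde
begin

lemma nS_alt: "nS = n1 + (n2 + n2)" by (simp add: nS_def)
lemma nx_alt: "nx = n0 + (n1 + n2)" by (simp add: nx_def)

lemma Tmat_carrier: "Tmat s \<in> carrier_mat nS nS"
  unfolding Tmat_def nS_alt
  by (intro carrier_append_rows append_cols_carrier one_carrier_mat zero_carrier_mat smult_carrier_mat)

lemma Qmat_carrier: "Qmat s \<in> carrier_mat nS nx"
  unfolding Qmat_def nS_alt nx_alt
  by (intro carrier_append_rows append_cols_carrier one_carrier_mat zero_carrier_mat smult_carrier_mat)

lemma Tmat_mult_vec: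
  assumes u: "u1 \<in> carrier_vec n1" "u2 \<in> carrier_vec n2" "u3 \<in> carrier_vec n2"
  shows "Tmat s *\<^sub>v (u1 @\<^sub>v u2 @\<^sub>v u3) = u1 @\<^sub>v (u2 + s \<cdot>\<^sub>v u3) @\<^sub>v u3"
proof -
  note car = append_cols_carrier one_carrier_mat zero_carrier_mat smult_carrier_mat append_carrier_vec u
  show ?thesis
    unfolding Tmat_def
    by (subst append_rows3_mult_vec[of _ n1 "n1 + (n2 + n2)" _ n2 _ n2]; (intro car)?)
      (simp add: append_cols3_mult_vec[of _ n1 n1 _ n2 _ n2] append_cols3_mult_vec[of _ n2 n1 _ n2 _ n2] u
        zero_mat_mult_vec smult_one_mult_vec)
qed

lemma Qmat_mult_vec:
  assumes u: "u0 \<in> carrier_vec n0" "u1 \<in> carrier_vec n1" "u2 \<in> carrier_vec n2"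
  shows "Qmat s *\<^sub>v (u0 @\<^sub>v u1 @\<^sub>v u2) = u1 @\<^sub>v (s \<cdot>\<^sub>v u2) @\<^sub>v u2"
proof -
  note car = append_cols_carrier one_carrier_mat zero_carrier_mat smult_carrier_mat append_carrier_vec u
  show ?thesis
    unfolding Qmat_def
    by (subst append_rows3_mult_vec[of _ n1 "n0 + (n1 + n2)" _ n2 _ n2]; (intro car)?)
      (simp add: append_cols3_mult_vec[of _ n1 n0 _ n1 _ n2] append_cols3_mult_vec[of _ n2 n0 _ n1 _ n2] u
        zero_mat_mult_vec smult_one_mult_vec)
qed

lemma Tmat_continuous:
  assumes "i < nS" "j < nS" shows "continuous_on S (\<lambda>s. Tmat s $$ (i,j))"
proof -
  have "Tmat s $$ (i,j) = Tmat 0 $$ (i,j) + s * (Tmat 1 $$ (i,j) - Tmat 0 $$ (i,j))" for s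
    using assms unfolding Tmat_def append_rows_def append_cols_def nS_alt by auto
  then have "(\<lambda>s. Tmat s $$ (i,j)) = (\<lambda>s. Tmat 0 $$ (i,j) + s * (Tmat 1 $$ (i,j) - Tmat 0 $$ (i,j)))"
    by (rule ext)
  then show ?thesis by (simp only:) (intro continuous_intros)
qed

lemma Qmat_affine:
  assumes "i < nS" "j < nx"
  shows "Qmat s $$ (i,j) = Qmat 0 $$ (i,j) + s * (Qmat 1 $$ (i,j) - Qmat 0 $$ (i,j))"
  using assms unfolding Qmat_def append_rows_def append_cols_def nS_alt nx_alt by auto

text \<open>The chosen weak derivative \<open>dx2\<close> agrees almost everywhere with the one that the definition of
  \<open>W\<^sub>2\<close> provides, so it has a weak derivative itself.\<close>

lemma Wn_weak_derivs:
  assumes "a < b" and x: "x \<in> Wn"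
  shows "x0_part x \<in> L2 a b n0"
    and "has_weak_deriv a b n1 (x1_part x) (dx1 x)"
    and "has_weak_deriv a b n2 (x2_part x) (dx2 x)"
    and "has_weak_deriv a b n2 (dx2 x) (ddx2 x)"
proof -
  show "x0_part x \<in> L2 a b n0" using x by (simp add: Wn_def)
  obtain v1 where "has_weak_deriv a b n1 (x1_part x) v1"
    using x unfolding Wn_def by auto
  then show "has_weak_deriv a b n1 (x1_part x) (dx1 x)"
    unfolding dx1_def by (rule has_weak_deriv_weak_deriv)
  obtain v w where v: "has_weak_deriv a b n2 (x2_part x) v" and w: "has_weak_deriv a b n2 v w"
    using x unfolding Wn_def numeral_2_eq_2 by auto
  show dx2: "has_weak_deriv a b n2 (x2_part x) (dx2 x)"
    unfolding dx2_def by (rule has_weak_deriv_weak_deriv[OF v])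
  have "has_weak_deriv a b n2 (dx2 x) w"
    by (rule has_weak_deriv_cong_AE[OF w has_weak_derivD(2)[OF dx2] has_weak_derivD(2)[OF w]
          has_weak_deriv_unique[OF \<open>a < b\<close> v dx2]]) simp
  then show "has_weak_deriv a b n2 (dx2 x) (ddx2 x)"
    unfolding ddx2_def by (rule has_weak_deriv_weak_deriv)
qed

lemma Wn_carriers:
  assumes "a < b" and x: "x \<in> Wn" and s: "s \<in> {a..b}"
  shows "x0_part x s \<in> carrier_vec n0" "x1_part x s \<in> carrier_vec n1" "x2_part x s \<in> carrier_vec n2"
    "dx1 x s \<in> carrier_vec n1" "dx2 x s \<in> carrier_vec n2" "ddx2 x s \<in> carrier_vec n2"
    "xc x s \<in> carrier_vec nS" "xD x s \<in> carrier_vec (nx + nS)" "D_op x s \<in> carrier_vec nx"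
    and "x s = x0_part x s @\<^sub>v x1_part x s @\<^sub>v x2_part x s"
proof -
  note W = Wn_weak_derivs[OF \<open>a < b\<close> x]
  show c: "x0_part x s \<in> carrier_vec n0" "x1_part x s \<in> carrier_vec n1" "x2_part x s \<in> carrier_vec n2"
    "dx1 x s \<in> carrier_vec n1" "dx2 x s \<in> carrier_vec n2" "ddx2 x s \<in> carrier_vec n2"
    using L2D(1)[OF W(1) s] L2D(1)[OF has_weak_derivD(1)[OF W(2)] s] L2D(1)[OF has_weak_derivD(2)[OF W(2)] s]
      L2D(1)[OF has_weak_derivD(1)[OF W(3)] s] L2D(1)[OF has_weak_derivD(2)[OF W(3)] s]
      L2D(1)[OF has_weak_derivD(2)[OF W(4)] s] by simp_all
  show "xc x s \<in> carrier_vec nS"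
    unfolding xc_def nS_alt by (intro append_carrier_vec c)
  show "D_op x s \<in> carrier_vec nx"
    unfolding D_op_def nx_alt by (intro append_carrier_vec c)
  have e: "nx + nS = n0 + (n1 + (n2 + (n1 + (n2 + n2))))" by (simp add: nx_def nS_def)
  show "xD x s \<in> carrier_vec (nx + nS)"
    unfolding xD_def e by (intro append_carrier_vec c)
  have "dim_vec (x s) = nx" using x s by (auto simp: Wn_def)
  then show "x s = x0_part x s @\<^sub>v x1_part x s @\<^sub>v x2_part x s"
    by (intro eq_vecI) (auto simp: x0_part_def x1_part_def x2_part_def slice_def nx_def)
qed

lemma D_op_L2:
  assumes "a < b" and x: "x \<in> Wn"
  shows "D_op x \<in> L2 a b nx"
  unfolding D_op_def nx_alt
  by (intro L2_append Wn_weak_derivs(1)[OF assms] has_weak_derivD(2)[OF Wn_weak_derivs(2)[OF assms]]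
      has_weak_derivD(2)[OF Wn_weak_derivs(4)[OF assms]])

end

context pde
begin

lemma U1_carrier: "U1 \<in> carrier_mat (nx + nS) nx"
  and U1_mult_vec: "\<lbrakk>u0 \<in> carrier_vec n0; u1 \<in> carrier_vec n1; u2 \<in> carrier_vec n2\<rbrakk> \<Longrightarrow>
    U1 *\<^sub>v (u0 @\<^sub>v u1 @\<^sub>v u2) = (u0 @\<^sub>v 0\<^sub>v (n1 + n2)) @\<^sub>v (u1 @\<^sub>v 0\<^sub>v n2) @\<^sub>v u2"
proof -
  let ?A = "1\<^sub>m n0 @\<^sub>r 0\<^sub>m (n1 + n2) n0 :: real Matrix.mat" and ?B = "1\<^sub>m n1 @\<^sub>r 0\<^sub>m n2 n1 :: real Matrix.mat"
  have A: "?A \<in> carrier_mat (n0 + (n1 + n2)) n0" and B: "?B \<in> carrier_mat (n1 + n2) n1" by auto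
  have C: "diag_block_mat [1\<^sub>m n2 :: real Matrix.mat] \<in> carrier_mat n2 n2"
    unfolding diag_block_mat_singleton by simp
  note BC = diag_block_mat_Cons_carrier[OF B C]
  show "U1 \<in> carrier_mat (nx + nS) nx"
  proof -
    have "n0 + (n1 + n2) + (n1 + n2 + n2) = nx + nS" "n0 + (n1 + n2) = nx"
      by (simp_all add: nx_def nS_def)
    then show ?thesis using diag_block_mat_Cons_carrier[OF A BC] unfolding U1_def by metis
  qed
  assume u: "u0 \<in> carrier_vec n0" "u1 \<in> carrier_vec n1" "u2 \<in> carrier_vec n2"
  have a: "?A *\<^sub>v u0 = u0 @\<^sub>v 0\<^sub>v (n1 + n2)" and b: "?B *\<^sub>v u1 = u1 @\<^sub>v 0\<^sub>v n2"
    using u by (simp_all add: mat_mult_append[of _ n0 n0 _ "n1 + n2"] mat_mult_append[of _ n1 n1 _ n2] zero_mat_mult_vec)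
  show "U1 *\<^sub>v (u0 @\<^sub>v u1 @\<^sub>v u2) = (u0 @\<^sub>v 0\<^sub>v (n1 + n2)) @\<^sub>v (u1 @\<^sub>v 0\<^sub>v n2) @\<^sub>v u2"
    unfolding U1_def diag_block_mat_Cons_mult_vec[OF A BC u(1) append_carrier_vec[OF u(2,3)]]
      diag_block_mat_Cons_mult_vec[OF B C u(2,3)] a b diag_block_mat_singleton one_mult_mat_vec[OF u(3)] ..
qed

lemma U2_carrier: "U2 \<in> carrier_mat (nx + nS) nS"
  and U2_mult_vec: "\<lbrakk>u1 \<in> carrier_vec n1; u2 \<in> carrier_vec n2; u3 \<in> carrier_vec n2\<rbrakk> \<Longrightarrow>
    U2 *\<^sub>v (u1 @\<^sub>v u2 @\<^sub>v u3) = (0\<^sub>v n0 @\<^sub>v u1 @\<^sub>v u2) @\<^sub>v (0\<^sub>v n1 @\<^sub>v u3) @\<^sub>v 0\<^sub>v n2"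
proof -
  let ?A = "0\<^sub>m n0 (n1 + n2) @\<^sub>r 1\<^sub>m (n1 + n2) :: real Matrix.mat" and ?B = "0\<^sub>m n1 n2 @\<^sub>r 1\<^sub>m n2 :: real Matrix.mat"
  have A: "?A \<in> carrier_mat (n0 + (n1 + n2)) (n1 + n2)" and B: "?B \<in> carrier_mat (n1 + n2) n2" by auto
  have B': "diag_block_mat [?B] \<in> carrier_mat (n1 + n2) n2"
    using B by (simp only: diag_block_mat_singleton)
  have D: "diag_block_mat [?A, ?B] \<in> carrier_mat (n0 + (n1 + n2) + (n1 + n2)) nS"
    using diag_block_mat_Cons_carrier[OF A B'] by (simp only: nS_alt add.assoc)
  have Z: "0\<^sub>m n2 nS \<in> carrier_mat n2 nS" by simp
  show "U2 \<in> carrier_mat (nx + nS) nS"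
  proof -
    have "n0 + (n1 + n2) + (n1 + n2) + n2 = nx + nS" by (simp add: nx_def nS_def)
    then show ?thesis using carrier_append_rows[OF D Z] unfolding U2_def by metis
  qed
  assume u: "u1 \<in> carrier_vec n1" "u2 \<in> carrier_vec n2" "u3 \<in> carrier_vec n2"
  note u12 = append_carrier_vec[OF u(1,2)]
  have a: "?A *\<^sub>v (u1 @\<^sub>v u2) = 0\<^sub>v n0 @\<^sub>v u1 @\<^sub>v u2" and b: "?B *\<^sub>v u3 = 0\<^sub>v n1 @\<^sub>v u3"
    using u u12 by (simp_all add: mat_mult_append[of _ n0 "n1 + n2" _ "n1 + n2"] mat_mult_append[of _ n1 n2 _ n2] zero_mat_mult_vec)
  have car: "(u1 @\<^sub>v u2) @\<^sub>v u3 \<in> carrier_vec nS"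
    using append_carrier_vec[OF u12 u(3)] by (simp only: nS_alt add.assoc)
  show "U2 *\<^sub>v (u1 @\<^sub>v u2 @\<^sub>v u3) = (0\<^sub>v n0 @\<^sub>v u1 @\<^sub>v u2) @\<^sub>v (0\<^sub>v n1 @\<^sub>v u3) @\<^sub>v 0\<^sub>v n2"
    unfolding U2_def append_vec_assoc[of u1 u2 u3, symmetric] mat_mult_append[OF D Z car]
      diag_block_mat_Cons_mult_vec[OF A B' u12 u(3)] diag_block_mat_singleton a b zero_mat_mult_vec[OF car]
    by (simp only: append_vec_assoc)
qed

lemma G0_carrier: "G0 s \<in> carrier_mat nx nx"
  and G0_mult_vec: "\<lbrakk>u0 \<in> carrier_vec n0; w \<in> carrier_vec (n1 + n2)\<rbrakk> \<Longrightarrow>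
    G0 s *\<^sub>v (u0 @\<^sub>v w) = u0 @\<^sub>v 0\<^sub>v (n1 + n2)"
proof -
  have n: "nx - n0 = n1 + n2" by (simp add: nx_def)
  have A: "1\<^sub>m n0 \<in> carrier_mat n0 n0" by simp
  have B: "diag_block_mat [0\<^sub>m (n1 + n2) (n1 + n2)] \<in> carrier_mat (n1 + n2) (n1 + n2)"
    unfolding diag_block_mat_singleton by simp
  show "G0 s \<in> carrier_mat nx nx"
    unfolding G0_def n using diag_block_mat_Cons_carrier[OF A B] by (simp only: nx_alt)
  assume u: "u0 \<in> carrier_vec n0" "w \<in> carrier_vec (n1 + n2)"
  show "G0 s *\<^sub>v (u0 @\<^sub>v w) = u0 @\<^sub>v 0\<^sub>v (n1 + n2)"
    unfolding G0_def n diag_block_mat_Cons_mult_vec[OF A B u] diag_block_mat_singleton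
      one_mult_mat_vec[OF u(1)] zero_mat_mult_vec[OF u(2)] ..
qed

text \<open>The matrix that maps \<open>col(x1, x2, d x2)\<close> to \<open>col(0, x1, x2)\<close>. The kernels \<open>G1\<close> and \<open>G2\<close> arise from
  it in the same way as \<open>RD1\<close> and \<open>RD2\<close> arise from \<open>U2\<close>.\<close>

definition E12 :: "real Matrix.mat" where
  "E12 = 0\<^sub>m n0 nS @\<^sub>r first_rows (n1 + n2) (1\<^sub>m nS)"

lemma first_rows_one_carrier: "first_rows (n1 + n2) (1\<^sub>m nS) \<in> carrier_mat (n1 + n2) nS"
  using first_rows_carrier[of "n1 + n2" "1\<^sub>m nS"] by simp

lemma E12_carrier: "E12 \<in> carrier_mat nx nS"
  unfolding E12_def nx_alt by (intro carrier_append_rows zero_carrier_mat first_rows_one_carrier)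

lemma E12_mult_vec:
  assumes u: "u1 \<in> carrier_vec n1" "u2 \<in> carrier_vec n2" "u3 \<in> carrier_vec n2"
  shows "E12 *\<^sub>v (u1 @\<^sub>v u2 @\<^sub>v u3) = 0\<^sub>v n0 @\<^sub>v u1 @\<^sub>v u2"
proof -
  note u12 = append_carrier_vec[OF u(1,2)]
  have n: "nS = (n1 + n2) + n2" by (simp add: nS_def)
  have car: "(u1 @\<^sub>v u2) @\<^sub>v u3 \<in> carrier_vec nS"
    using append_carrier_vec[OF u12 u(3)] by (simp only: nS_alt add.assoc)
  show ?thesis
    unfolding E12_def append_vec_assoc[of u1 u2 u3, symmetric]
      mat_mult_append[OF zero_carrier_mat first_rows_one_carrier car] zero_mat_mult_vec[OF car]
    using first_rows_one_mult_vec[OF u12 u(3)] by (simp only: n)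
qed

lemma E12_mult_mat:
  assumes M: "M \<in> carrier_mat nS c"
  shows "E12 * M = 0\<^sub>m n0 c @\<^sub>r first_rows (n1 + n2) M"
proof -
  have "first_rows (n1 + n2) (1\<^sub>m nS) * M = first_rows (n1 + n2) M"
    using first_rows_mult[OF one_carrier_mat M, of "n1 + n2"] M by (simp add: nS_def)
  then show ?thesis
    unfolding E12_def append_rows_mult[OF zero_carrier_mat first_rows_one_carrier M]
    using M by simp
qed

lemma xD_decomp:
  assumes "a < b" "x \<in> Wn" "s \<in> {a..b}"
  shows "xD x s = U1 *\<^sub>v D_op x s + U2 *\<^sub>v xc x s"
proof -
  note c = Wn_carriers[OF assms]
  have "U1 *\<^sub>v D_op x s + U2 *\<^sub>v xc x s
     = (x0_part x s @\<^sub>v x1_part x s @\<^sub>v x2_part x s) @\<^sub>v (dx1 x s @\<^sub>v dx2 x s) @\<^sub>v ddx2 x s"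
    unfolding D_op_def xc_def U1_mult_vec[OF c(1,4,6)] U2_mult_vec[OF c(2,3,5)]
    using c(1-6)
    by (simp add: append_vec_add[of _ "n0 + (n1 + n2)" _ _ "(n1 + n2) + n2"] append_vec_add[of _ "n1 + n2" _ _ n2]
        append_vec_add[of _ n0 _ _ "n1 + n2"] append_vec_add[of _ n1 _ _ n2])
  then show ?thesis unfolding xD_def append_vec_assoc by simp
qed

lemma x_decomp:
  assumes "a < b" "x \<in> Wn" "s \<in> {a..b}"
  shows "x s = G0 s *\<^sub>v D_op x s + E12 *\<^sub>v xc x s"
proof -
  note c = Wn_carriers[OF assms]
  have "G0 s *\<^sub>v D_op x s + E12 *\<^sub>v xc x s = x0_part x s @\<^sub>v x1_part x s @\<^sub>v x2_part x s"
    unfolding D_op_def xc_def G0_mult_vec[OF c(1) append_carrier_vec[OF c(4,6)]] E12_mult_vec[OF c(2,3,5)]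
    using c(1-6) by (simp add: append_vec_add[of _ n0 _ _ "n1 + n2"])
  then show ?thesis using c(10) by simp
qed

text \<open>Taylor's formula with integral remainder for the continuous part of the state.\<close>

lemma xc_representation:
  assumes "a < b" and x: "x \<in> Wn"
  defines "z \<equiv> cont_rep a b nS (xc x) a"
  shows "z \<in> carrier_vec nS"
    and "s \<in> {a..b} \<Longrightarrow> cont_rep a b nS (xc x) s = Tmat (s - a) *\<^sub>v z + vec_integral nS {a..s} (\<lambda>\<theta>. Qmat (s - \<theta>) *\<^sub>v D_op x \<theta>)"
    and "AE s in lebesgue_on {a..b}. xc x s = cont_rep a b nS (xc x) s"
proof -
  note W = Wn_weak_derivs[OF \<open>a < b\<close> x] and c = Wn_carriers[OF \<open>a < b\<close> x]
  obtain c1 where c1: "c1 \<in> carrier_vec n1" "AE s in lebesgue_on {a..b}. x1_part x s = c1 + vec_integral n1 {a..s} (dx1 x)"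
    using has_weak_deriv_primitive[OF \<open>a < b\<close> W(2)] by blast
  obtain c2 where c2: "c2 \<in> carrier_vec n2" "AE s in lebesgue_on {a..b}. x2_part x s = c2 + vec_integral n2 {a..s} (dx2 x)"
    using has_weak_deriv_primitive[OF \<open>a < b\<close> W(3)] by blast
  obtain c3 where c3: "c3 \<in> carrier_vec n2" "AE s in lebesgue_on {a..b}. dx2 x s = c3 + vec_integral n2 {a..s} (ddx2 x)"
    using has_weak_deriv_primitive[OF \<open>a < b\<close> W(4)] by blast
  have int: "vec_integrable n1 {a..b} (dx1 x)" "vec_integrable n2 {a..b} (dx2 x)" "vec_integrable n2 {a..b} (ddx2 x)"
    using L2_imp_vec_integrable has_weak_derivD(2) W(2-4) by blast+
  define Z where "Z = (\<lambda>s. (c1 + vec_integral n1 {a..s} (dx1 x)) @\<^sub>v (c2 + vec_integral n2 {a..s} (dx2 x)) @\<^sub>v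
     (c3 + vec_integral n2 {a..s} (ddx2 x)))"
  have Zc: "Z s \<in> carrier_vec nS" for s
    unfolding Z_def nS_alt by (intro append_carrier_vec add_carrier_vec c1 c2 c3 vec_integral_carrier)
  have cont: "continuous_on {a..b} (\<lambda>s. (c + vec_integral m {a..s} v) $ i)"
    if "i < m" "vec_integrable m {a..b} v" for c m v i
    using that by (simp, intro continuous_intros indefinite_integral_continuous_real vec_integrableD(3))
  have Zcont: "continuous_on {a..b} (\<lambda>s. Z s $ i)" if i: "i < nS" for i
  proof -
    consider "i < n1" | "\<not> i < n1" "i - n1 < n2" | "\<not> i < n1" "\<not> i - n1 < n2" "i - n1 - n2 < n2"
      using i unfolding nS_def by linarith
    then show ?thesis
    proof cases
      case 1
      then have e: "(\<lambda>s. Z s $ i) = (\<lambda>s. (c1 + vec_integral n1 {a..s} (dx1 x)) $ i)"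
        using c1(1) c2(1) c3(1) i by (simp add: Z_def nS_def)
      show ?thesis by (subst e) (rule cont[OF 1 int(1)])
    next
      case 2
      then have e: "(\<lambda>s. Z s $ i) = (\<lambda>s. (c2 + vec_integral n2 {a..s} (dx2 x)) $ (i - n1))"
        using c1(1) c2(1) c3(1) i by (simp add: Z_def nS_def)
      show ?thesis by (subst e) (rule cont[OF 2(2) int(2)])
    next
      case 3
      then have e: "(\<lambda>s. Z s $ i) = (\<lambda>s. (c3 + vec_integral n2 {a..s} (ddx2 x)) $ (i - n1 - n2))"
        using c1(1) c2(1) c3(1) i by (simp add: Z_def nS_def)
      show ?thesis by (subst e) (rule cont[OF 3(3) int(3)])
    qed
  qed
  have ae: "AE s in lebesgue_on {a..b}. Z s = xc x s"
    using c1(2) c2(2) c3(2) by eventually_elim (simp add: Z_def xc_def)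
  have rep: "cont_rep a b nS (xc x) s = Z s" if "s \<in> {a..b}" for s
    by (rule cont_rep_eq[OF \<open>a < b\<close> Zc Zcont ae that])
  have z: "z = c1 @\<^sub>v c2 @\<^sub>v c3"
    unfolding z_def using rep[of a] \<open>a < b\<close> c1(1) c2(1) c3(1) by (simp add: Z_def vec_integral_singleton)
  then show zc: "z \<in> carrier_vec nS"
    unfolding nS_alt by (simp add: append_carrier_vec c1 c2 c3)
  show "AE s in lebesgue_on {a..b}. xc x s = cont_rep a b nS (xc x) s"
    using ae AE_space[of "lebesgue_on {a..b}"] by eventually_elim (simp add: rep)
  fix s assume s: "s \<in> {a..b}"
  then have sub: "{a..s} \<subseteq> {a..b}" by auto
  have ints: "vec_integrable n1 {a..s} (dx1 x)" "vec_integrable n2 {a..s} (dx2 x)" "vec_integrable n2 {a..s} (ddx2 x)"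
    using int vec_integrable_subinterval sub by blast+
  have as: "a \<le> s" using s by simp
  note prim = vec_integral_primitive[OF as ints(3)]
  note const = vec_integral_const[OF c3(1) as]
  have "vec_integral n2 {a..s} (dx2 x) = vec_integral n2 {a..s} (\<lambda>t. c3 + vec_integral n2 {a..t} (ddx2 x))"
    by (rule vec_integral_cong_AE[OF lebesgue_on_AE_subset[OF c3(2) sub]]) simp_all
  then have second: "vec_integral n2 {a..s} (dx2 x) = (s - a) \<cdot>\<^sub>v c3 + vec_integral n2 {a..s} (\<lambda>\<theta>. (s - \<theta>) \<cdot>\<^sub>v ddx2 x \<theta>)"
    using vec_integral_add(1)[OF const(2) prim(2)] prim(1) const(1) by simp
  have QD: "Qmat (s - \<theta>) *\<^sub>v D_op x \<theta> = dx1 x \<theta> @\<^sub>v ((s - \<theta>) \<cdot>\<^sub>v ddx2 x \<theta>) @\<^sub>v ddx2 x \<theta>" if "\<theta> \<in> {a..s}" for \<theta>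
    unfolding D_op_def using c(1,4,6)[of \<theta>] that sub by (intro Qmat_mult_vec) auto
  have QI: "vec_integral nS {a..s} (\<lambda>\<theta>. Qmat (s - \<theta>) *\<^sub>v D_op x \<theta>)
     = vec_integral n1 {a..s} (dx1 x) @\<^sub>v vec_integral n2 {a..s} (\<lambda>\<theta>. (s - \<theta>) \<cdot>\<^sub>v ddx2 x \<theta>) @\<^sub>v vec_integral n2 {a..s} (ddx2 x)"
  proof -
    have "vec_integral (n1 + (n2 + n2)) {a..s} (\<lambda>\<theta>. Qmat (s - \<theta>) *\<^sub>v D_op x \<theta>)
      = vec_integral (n1 + (n2 + n2)) {a..s} (\<lambda>\<theta>. dx1 x \<theta> @\<^sub>v ((s - \<theta>) \<cdot>\<^sub>v ddx2 x \<theta>) @\<^sub>v ddx2 x \<theta>)"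
      by (rule vec_integral_cong) (rule QD)
    also have "\<dots> = vec_integral n1 {a..s} (dx1 x) @\<^sub>v vec_integral (n2 + n2) {a..s} (\<lambda>\<theta>. ((s - \<theta>) \<cdot>\<^sub>v ddx2 x \<theta>) @\<^sub>v ddx2 x \<theta>)"
      by (intro vec_integral_append append_carrier_vec smult_carrier_vec[THEN iffD2] vec_integrableD(1)[OF ints(1)]
          vec_integrableD(1)[OF ints(3)])
    also have "vec_integral (n2 + n2) {a..s} (\<lambda>\<theta>. ((s - \<theta>) \<cdot>\<^sub>v ddx2 x \<theta>) @\<^sub>v ddx2 x \<theta>)
      = vec_integral n2 {a..s} (\<lambda>\<theta>. (s - \<theta>) \<cdot>\<^sub>v ddx2 x \<theta>) @\<^sub>v vec_integral n2 {a..s} (ddx2 x)"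
      by (intro vec_integral_append smult_carrier_vec[THEN iffD2] vec_integrableD(1)[OF ints(3)])
    finally show ?thesis by (simp only: nS_alt)
  qed
  show "cont_rep a b nS (xc x) s = Tmat (s - a) *\<^sub>v z + vec_integral nS {a..s} (\<lambda>\<theta>. Qmat (s - \<theta>) *\<^sub>v D_op x \<theta>)"
    unfolding rep[OF s] Z_def QI z Tmat_mult_vec[OF c1(1) c2(1) c3(1)] second
    using c1(1) c2(1) c3(1)
    by (simp add: append_vec_add[of _ n1 _ _ "n2 + n2"] append_vec_add[of _ n2 _ _ n2] assoc_add_vec[of _ n2])
qed

end

section \<open>The fundamental state determines the state\<close>

text \<open>The standing assumptions on the parameters: a nondegenerate interval, the regularity of the
  coefficients, and admissibility of the boundary conditions.\<close>

locale admissible_pde = pde a b n0 n1 n2 nBC B BI A0 A1 A2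
  for a b :: real and n0 n1 n2 nBC :: nat and B :: "real Matrix.mat" and BI :: "real \<Rightarrow> real Matrix.mat"
    and A0 :: "real \<Rightarrow> real Matrix.mat" and A1 A2 :: "real \<Rightarrow> real \<Rightarrow> real Matrix.mat" +
  assumes ab: "a < b"
    and B: "B \<in> carrier_mat nBC (2 * nS)"
    and BI: "square_integrable_mat a b nBC (nx + nS) BI"
    and A0: "ess_bounded_mat a b nx (nx + nS) A0"
    and A1: "separable_mat a b nx (nx + nS) A1"
    and A2: "separable_mat a b nx (nx + nS) A2"
    and adm: admissible
begin

lemma BT_carrier: "BT \<in> carrier_mat nBC nS" and nBC: "nBC = nS"
proof -
  show BT: "BT \<in> carrier_mat nBC nS"
    unfolding BT_def by (rule minus_carrier_mat) simp
  show "nBC = nS"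
    using adm BT unfolding admissible_def invertible_mat_def by auto
qed

text \<open>The inverse of \<open>BT\<close>.\<close>

abbreviation BTi where "BTi \<equiv> the (mat_inverse BT)"

lemma BTi: "BTi \<in> carrier_mat nS nBC" "BTi * BT = 1\<^sub>m nS"
proof -
  have "BT \<in> carrier_mat nS nS" by (metis BT_carrier nBC)
  note I = mat_inverse_invertible[OF this adm[unfolded admissible_def]]
  show "BTi * BT = 1\<^sub>m nS" by (rule I(2))
  show "BTi \<in> carrier_mat nS nBC" by (metis I(1) nBC)
qed

text \<open>The kernel of the Volterra part of Taylor's formula, as a kernel on the square.\<close>

definition QK :: "real \<Rightarrow> real \<Rightarrow> real Matrix.mat" where
  "QK t \<theta> = (if \<theta> \<le> t then Qmat (t - \<theta>) else 0\<^sub>m nS nx)"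

lemma Qmat_kernel: "mat_kernel a b nS nx (\<lambda>t \<theta>. Qmat (t - \<theta>))"
  unfolding mat_kernel_def
proof (intro conjI ballI allI impI Qmat_carrier)
  fix j k assume jk: "j < nS" "k < nx"
  show "L2_kernel a b (\<lambda>t \<theta>. Qmat (t - \<theta>) $$ (j,k))"
    unfolding Qmat_affine[OF jk, of "_ - _"] by (rule L2_kernel_difference)
qed

lemma QK_kernel: "mat_kernel a b nS nx QK"
proof -
  have "mat_kernel a b nS nx (\<lambda>t \<theta>. 0\<^sub>m nS nx)"
    unfolding mat_kernel_def by (simp add: L2_kernel_zero)
  from mat_kernel_if[OF Qmat_kernel this] show ?thesis
    unfolding QK_def[abs_def] .
qed

lemma QK_integral:
  assumes f: "f \<in> L2 a b nx" and s: "s \<in> {a..b}"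
  shows "vec_integral nS {a..b} (\<lambda>\<theta>. QK s \<theta> *\<^sub>v f \<theta>) = vec_integral nS {a..s} (\<lambda>\<theta>. Qmat (s - \<theta>) *\<^sub>v f \<theta>)"
proof -
  from mat_kernel_mult_vec_integrable[OF QK_kernel f s]
  have int: "vec_integrable nS {a..b} (\<lambda>\<theta>. if \<theta> \<le> s then Qmat (s - \<theta>) *\<^sub>v f \<theta> else 0\<^sub>m nS nx *\<^sub>v f \<theta>)"
    by (simp only: QK_def if_distrib[of "\<lambda>M. M *\<^sub>v _"])
  have "vec_integral nS {s..b} (\<lambda>\<theta>. 0\<^sub>m nS nx *\<^sub>v f \<theta>) = vec_integral nS {s..b} (\<lambda>\<theta>. 0\<^sub>v nS)"
    using L2D(1)[OF f] s by (intro vec_integral_cong zero_mat_mult_vec) auto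
  also have "\<dots> = 0\<^sub>v nS" by (intro eq_vecI) simp_all
  finally show ?thesis
    unfolding QK_def if_distrib[of "\<lambda>M. M *\<^sub>v _"] vec_integral_split[OF s int] by simp
qed

lemma BIU1: "square_integrable_mat a b nBC nx (\<lambda>s. BI s * U1)"
  and BIU2: "square_integrable_mat a b nBC nS (\<lambda>s. BI s * U2)"
  by (rule square_integrable_mat_mult_right[OF BI U1_carrier] square_integrable_mat_mult_right[OF BI U2_carrier])+

lemma boundary_Q_carrier: "0\<^sub>m nS nx @\<^sub>r Qmat (b - s) \<in> carrier_mat (2 * nS) nx"
  using carrier_append_rows[OF zero_carrier_mat[of nS nx] Qmat_carrier[of "b - s"]] by (simp only: mult_2)

lemma boundary_T_carrier: "Tmat 0 @\<^sub>r Tmat (b - a) \<in> carrier_mat (2 * nS) nS"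
  using carrier_append_rows[OF Tmat_carrier[of 0] Tmat_carrier[of "b - a"]] by (simp only: mult_2)

lemma boundary_Q_square_integrable: "square_integrable_mat a b (2 * nS) nx (\<lambda>s. 0\<^sub>m nS nx @\<^sub>r Qmat (b - s))"
proof (rule continuous_imp_square_integrable_mat[OF boundary_Q_carrier])
  fix i j assume ij: "i < 2 * nS" "j < nx"
  have Qd: "dim_row (Qmat t) = nS" "dim_col (Qmat t) = nx" for t using Qmat_carrier by auto
  show "continuous_on {a..b} (\<lambda>s. (0\<^sub>m nS nx @\<^sub>r Qmat (b - s)) $$ (i,j))"
  proof (cases "i < nS")
    case True
    then have "(0\<^sub>m nS nx @\<^sub>r Qmat (b - s)) $$ (i,j) = 0" for s
      using ij by (simp add: append_rows_def Qd)
    then show ?thesis by simp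
  next
    case False
    then have i: "i - nS < nS" using ij by simp
    have e: "(0\<^sub>m nS nx @\<^sub>r Qmat (b - s)) $$ (i,j)
      = Qmat 0 $$ (i - nS,j) + (b - s) * (Qmat 1 $$ (i - nS,j) - Qmat 0 $$ (i - nS,j))" for s
      using ij False Qmat_affine[OF i ij(2), of "b - s"] by (simp add: append_rows_def Qd)
    show ?thesis unfolding e by (intro continuous_intros)
  qed
qed

text \<open>The matrix function in the definition of \<open>BQ\<close> before multiplication by the inverse of \<open>BT\<close>.\<close>

definition BN :: "real \<Rightarrow> real Matrix.mat" where
  "BN s = BI s * U1 - B * (0\<^sub>m nS nx @\<^sub>r Qmat (b - s))
      + mat_integral nBC nx {s..b} (\<lambda>\<theta>. BI \<theta> * U2 * Qmat (\<theta> - s))"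

lemma BQ_BN: "BQ s = BTi * BN s"
  unfolding BQ_def BN_def ..

lemma BIU2_QK_integrable:
  "\<theta> \<in> {a..b} \<Longrightarrow> mat_integrable nBC nx {a..b} (\<lambda>s. (BI s * U2) * QK s \<theta>)"
  by (rule mat_kernel_mult_mat_integrable[OF QK_kernel square_integrable_imp_mat_integrable[OF BIU2]])

lemma BIU2_QK_integral:
  assumes \<theta>: "\<theta> \<in> {a..b}"
  shows "mat_integral nBC nx {a..b} (\<lambda>s. (BI s * U2) * QK s \<theta>)
    = mat_integral nBC nx {\<theta>..b} (\<lambda>s. BI s * U2 * Qmat (s - \<theta>))"
proof -
  note c = square_integrable_matD(1)[OF BIU2]
  have ae: "AE s in lebesgue_on {a..b}. (BI s * U2) * QK s \<theta> = (if s \<le> \<theta> then 0\<^sub>m nBC nx else BI s * U2 * Qmat (s - \<theta>))"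
    using AE_lebesgue_on_neq[of "{a..b}" \<theta>, simplified] AE_space[of "lebesgue_on {a..b}"]
  proof eventually_elim
    case (elim s)
    then have "(BI s * U2) * 0\<^sub>m nS nx = 0\<^sub>m nBC nx"
      using c[of s] by (intro right_mult_zero_mat) simp
    then show ?case using elim by (auto simp: QK_def)
  qed
  have int: "mat_integrable nBC nx {a..b} (\<lambda>s. if s \<le> \<theta> then 0\<^sub>m nBC nx else BI s * U2 * Qmat (s - \<theta>))"
  proof (rule mat_integrable_cong_AE[OF _ _ BIU2_QK_integrable[OF \<theta>]])
    show "AE s in lebesgue_on {a..b}. (if s \<le> \<theta> then 0\<^sub>m nBC nx else BI s * U2 * Qmat (s - \<theta>)) = (BI s * U2) * QK s \<theta>"
      using ae by eventually_elim simp
    show "(if s \<le> \<theta> then 0\<^sub>m nBC nx else BI s * U2 * Qmat (s - \<theta>)) \<in> carrier_mat nBC nx" if "s \<in> {a..b}" for s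
      using mult_carrier_mat[OF c[OF that] Qmat_carrier] by simp
  qed simp
  have "mat_integral nBC nx {a..\<theta>} (\<lambda>s. 0\<^sub>m nBC nx) = 0\<^sub>m nBC nx"
    by (intro eq_matI) simp_all
  then show ?thesis
    unfolding mat_integral_cong_AE[OF ae, simplified] mat_integral_split(1)[OF \<theta> int] by simp
qed

lemma BN_square_integrable: "square_integrable_mat a b nBC nx BN"
proof -
  have "square_integrable_mat a b nBC nx (\<lambda>\<theta>. mat_integral nBC nx {\<theta>..b} (\<lambda>s. BI s * U2 * Qmat (s - \<theta>)))"
    by (rule square_integrable_mat_eq[OF mat_kernel_integral_square_integrable[OF QK_kernel
          square_integrable_imp_mat_integrable[OF BIU2]]]) (rule BIU2_QK_integral[symmetric])
  then show ?thesis
    unfolding BN_def[abs_def]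
    by (intro square_integrable_mat_add square_integrable_mat_diff BIU1
        square_integrable_mat_mult_left[OF B boundary_Q_square_integrable])
qed

lemma BQ_square_integrable: "square_integrable_mat a b nS nx BQ"
  using square_integrable_mat_mult_left[OF BTi(1) BN_square_integrable] by (simp only: BQ_BN[symmetric])

lemma X_imp_Wn: "x \<in> X \<Longrightarrow> x \<in> Wn"
  by (simp add: X_def)

text \<open>Solving the boundary conditions for the value of the continuous part at \<open>a\<close>.\<close>

lemma boundary_value:
  assumes x: "x \<in> X"
  shows "cont_rep a b nS (xc x) a = vec_integral nS {a..b} (\<lambda>\<theta>. BQ \<theta> *\<^sub>v D_op x \<theta>)"
proof -
  note xW = X_imp_Wn[OF x]
  define z where "z = cont_rep a b nS (xc x) a"
  define f where "f = D_op x"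
  define w where "w = (\<lambda>s. vec_integral nS {a..b} (\<lambda>\<theta>. QK s \<theta> *\<^sub>v f \<theta>))"
  have f: "f \<in> L2 a b nx" unfolding f_def by (rule D_op_L2[OF ab xW])
  note fc = L2D(1)[OF f]
  note R = xc_representation[OF ab xW, folded z_def f_def]
  have z: "z \<in> carrier_vec nS" by (rule R(1))
  have wc: "w s \<in> carrier_vec nS" for s by (simp add: w_def)
  have Tx: "Tmat t *\<^sub>v z \<in> carrier_vec nS" for t by (rule mult_mat_vec_carrier[OF Tmat_carrier z])
  have rep: "cont_rep a b nS (xc x) s = Tmat (s - a) *\<^sub>v z + w s" if "s \<in> {a..b}" for s
    unfolding R(2)[OF that] w_def QK_integral[OF f that] ..
  let ?q = "vec_integral (2 * nS) {a..b} (\<lambda>\<theta>. (0\<^sub>m nS nx @\<^sub>r Qmat (b - \<theta>)) *\<^sub>v f \<theta>)"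
  note qi = square_integrable_mult_L2[OF boundary_Q_square_integrable f]
  have q: "?q = 0\<^sub>v nS @\<^sub>v w b"
  proof -
    have "?q = vec_integral (nS + nS) {a..b} (\<lambda>\<theta>. 0\<^sub>v nS @\<^sub>v (Qmat (b - \<theta>) *\<^sub>v f \<theta>))"
      unfolding mult_2 by (intro vec_integral_cong)
        (simp add: mat_mult_append[OF zero_carrier_mat Qmat_carrier fc] zero_mat_mult_vec[OF fc])
    also have "\<dots> = vec_integral nS {a..b} (\<lambda>\<theta>. 0\<^sub>v nS) @\<^sub>v vec_integral nS {a..b} (\<lambda>\<theta>. Qmat (b - \<theta>) *\<^sub>v f \<theta>)"
      by (intro vec_integral_append zero_carrier_vec mult_mat_vec_carrier[OF Qmat_carrier fc])
    also have "vec_integral nS {a..b} (\<lambda>\<theta>. 0\<^sub>v nS) = 0\<^sub>v nS" by (intro eq_vecI) simp_all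
    also have "vec_integral nS {a..b} (\<lambda>\<theta>. Qmat (b - \<theta>) *\<^sub>v f \<theta>) = w b"
      unfolding w_def using ab by (intro QK_integral[OF f, symmetric]) simp
    finally show ?thesis .
  qed
  have "cont_rep a b nS (xc x) a = Tmat 0 *\<^sub>v z"
  proof -
    have "w a = 0\<^sub>v nS" unfolding w_def using QK_integral[OF f, of a] ab by (simp add: vec_integral_singleton)
    then show ?thesis using rep[of a] ab Tx[of 0] by simp
  qed
  then have "cont_rep a b nS (xc x) a @\<^sub>v cont_rep a b nS (xc x) b
      = (Tmat 0 *\<^sub>v z @\<^sub>v Tmat (b - a) *\<^sub>v z) + (0\<^sub>v nS @\<^sub>v w b)"
    using rep[of b] ab Tx wc by (simp add: append_vec_add[of _ nS _ _ nS])
  also have "\<dots> = (Tmat 0 @\<^sub>r Tmat (b - a)) *\<^sub>v z + ?q"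
    unfolding q mat_mult_append[OF Tmat_carrier Tmat_carrier z] ..
  finally have ends: "cont_rep a b nS (xc x) a @\<^sub>v cont_rep a b nS (xc x) b
      = (Tmat 0 @\<^sub>r Tmat (b - a)) *\<^sub>v z + ?q" .
  let ?J = "vec_integral nBC {a..b} (\<lambda>\<theta>. (B * (0\<^sub>m nS nx @\<^sub>r Qmat (b - \<theta>))) *\<^sub>v f \<theta>)"
  note Ji = square_integrable_mult_L2[OF square_integrable_mat_mult_left[OF B boundary_Q_square_integrable] f]
  have J: "B *\<^sub>v ?q = ?J"
    unfolding vec_integral_mult_mat(1)[OF qi B, symmetric]
    by (intro vec_integral_cong assoc_mult_mat_vec[OF B boundary_Q_carrier fc, symmetric])
  have lhs: "B *\<^sub>v (cont_rep a b nS (xc x) a @\<^sub>v cont_rep a b nS (xc x) b)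
      = (B * (Tmat 0 @\<^sub>r Tmat (b - a))) *\<^sub>v z + ?J"
    unfolding ends J[symmetric] assoc_mult_mat_vec[OF B boundary_T_carrier z]
    by (intro mult_add_distrib_mat_vec[OF B] mult_mat_vec_carrier[OF boundary_T_carrier z] vec_integral_carrier)
  let ?T = "\<lambda>s. BI s * U2 * Tmat (s - a)"
  note c1 = square_integrable_matD(1)[OF BIU1] and c2 = square_integrable_matD(1)[OF BIU2]
    and cB = square_integrable_matD(1)[OF BI]
  have Tsq: "square_integrable_mat a b nS nS (\<lambda>s. Tmat (s - a))"
  proof (rule continuous_imp_square_integrable_mat[OF Tmat_carrier])
    fix i j assume ij: "i < nS" "j < nS"
    show "continuous_on {a..b} (\<lambda>s. Tmat (s - a) $$ (i,j))"
      by (rule continuous_on_compose2[OF Tmat_continuous[OF ij, of UNIV]]) (auto intro!: continuous_intros)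
  qed
  note Ti = square_integrable_mat_mult[OF BIU2 Tsq]
  note MK = mat_kernel_fubini[OF QK_kernel f square_integrable_imp_mat_integrable[OF BIU2]]
  let ?I = "\<lambda>\<theta>. mat_integral nBC nx {a..b} (\<lambda>s. (BI s * U2) * QK s \<theta>)"
  have ae: "AE s in lebesgue_on {a..b}. BI s *\<^sub>v xD x s = (BI s * U1) *\<^sub>v f s + (?T s *\<^sub>v z + (BI s * U2) *\<^sub>v w s)"
    using R(3) AE_space[of "lebesgue_on {a..b}"]
  proof eventually_elim
    case (elim s)
    then have s: "s \<in> {a..b}" by simp
    have xcs: "xc x s = Tmat (s - a) *\<^sub>v z + w s" using elim rep[OF s] by simp
    have xcc: "Tmat (s - a) *\<^sub>v z + w s \<in> carrier_vec nS" by (intro add_carrier_vec Tx wc)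
    have "BI s *\<^sub>v xD x s = BI s *\<^sub>v (U1 *\<^sub>v f s + U2 *\<^sub>v (Tmat (s - a) *\<^sub>v z + w s))"
      unfolding xD_decomp[OF ab xW s] f_def xcs ..
    also have "\<dots> = BI s *\<^sub>v (U1 *\<^sub>v f s) + BI s *\<^sub>v (U2 *\<^sub>v (Tmat (s - a) *\<^sub>v z + w s))"
      by (intro mult_add_distrib_mat_vec[OF cB[OF s]] mult_mat_vec_carrier[OF U1_carrier fc[OF s]]
          mult_mat_vec_carrier[OF U2_carrier xcc])
    also have "\<dots> = (BI s * U1) *\<^sub>v f s + (BI s * U2) *\<^sub>v (Tmat (s - a) *\<^sub>v z + w s)"
      unfolding assoc_mult_mat_vec[OF cB[OF s] U1_carrier fc[OF s]] assoc_mult_mat_vec[OF cB[OF s] U2_carrier xcc] ..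
    also have "(BI s * U2) *\<^sub>v (Tmat (s - a) *\<^sub>v z + w s) = ?T s *\<^sub>v z + (BI s * U2) *\<^sub>v w s"
      unfolding mult_add_distrib_mat_vec[OF c2[OF s] Tx wc] assoc_mult_mat_vec[OF c2[OF s] Tmat_carrier z] ..
    finally show ?case .
  qed
  note i1 = square_integrable_mult_L2[OF BIU1 f] and i2 = mat_integral_mult_vec[OF Ti z]
  have i3: "vec_integrable nBC {a..b} (\<lambda>s. (BI s * U2) *\<^sub>v w s)"
    unfolding w_def by (rule MK(1))
  have I3: "vec_integral nBC {a..b} (\<lambda>s. (BI s * U2) *\<^sub>v w s) = vec_integral nBC {a..b} (\<lambda>\<theta>. ?I \<theta> *\<^sub>v f \<theta>)"
    unfolding w_def by (rule MK(3))
  let ?MT = "mat_integral nBC nS {a..b} ?T" and ?I1 = "vec_integral nBC {a..b} (\<lambda>s. (BI s * U1) *\<^sub>v f s)"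
    and ?I3 = "vec_integral nBC {a..b} (\<lambda>\<theta>. ?I \<theta> *\<^sub>v f \<theta>)"
  have rhs: "vec_integral nBC {a..b} (\<lambda>s. BI s *\<^sub>v xD x s) = ?I1 + (?MT *\<^sub>v z + ?I3)"
    unfolding vec_integral_cong_AE[OF ae, simplified] vec_integral_add(1)[OF i1 vec_integral_add(2)[OF i2(2) i3]]
      vec_integral_add(1)[OF i2(2) i3] i2(1) I3 ..
  have BC: "(B * (Tmat 0 @\<^sub>r Tmat (b - a))) *\<^sub>v z + ?J = ?I1 + (?MT *\<^sub>v z + ?I3)"
    using x unfolding X_def mem_Collect_eq lhs rhs by blast
  have Bc: "B * (Tmat 0 @\<^sub>r Tmat (b - a)) \<in> carrier_mat nBC nS"
    by (rule mult_carrier_mat[OF B boundary_T_carrier])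
  have "BT *\<^sub>v z = (B * (Tmat 0 @\<^sub>r Tmat (b - a))) *\<^sub>v z - ?MT *\<^sub>v z"
    unfolding BT_def by (rule minus_mult_distrib_mat_vec[OF Bc mat_integral_carrier z])
  also have "\<dots> = ?I1 - ?J + ?I3"
  proof (rule eq_vecI)
    fix i assume "i < dim_vec (?I1 - ?J + ?I3)"
    then have i: "i < nBC" by simp
    have "((B * (Tmat 0 @\<^sub>r Tmat (b - a))) *\<^sub>v z + ?J) $ i = (?I1 + (?MT *\<^sub>v z + ?I3)) $ i"
      unfolding BC ..
    then show "((B * (Tmat 0 @\<^sub>r Tmat (b - a))) *\<^sub>v z - ?MT *\<^sub>v z) $ i = (?I1 - ?J + ?I3) $ i"
      using i by (simp del: index_mult_mat_vec vec_integral_index)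
  qed simp
  also have "\<dots> = vec_integral nBC {a..b} (\<lambda>\<theta>. BN \<theta> *\<^sub>v f \<theta>)"
  proof -
    let ?b1 = "\<lambda>\<theta>. (BI \<theta> * U1 - B * (0\<^sub>m nS nx @\<^sub>r Qmat (b - \<theta>))) *\<^sub>v f \<theta>"
    have b1: "square_integrable_mat a b nBC nx (\<lambda>\<theta>. BI \<theta> * U1 - B * (0\<^sub>m nS nx @\<^sub>r Qmat (b - \<theta>)))"
      by (intro square_integrable_mat_diff BIU1 square_integrable_mat_mult_left[OF B boundary_Q_square_integrable])
    note b1i = square_integrable_mult_L2[OF b1 f]
    have e: "(BI \<theta> * U1) *\<^sub>v f \<theta> = ?b1 \<theta> + (B * (0\<^sub>m nS nx @\<^sub>r Qmat (b - \<theta>))) *\<^sub>v f \<theta>" if \<theta>: "\<theta> \<in> {a..b}" for \<theta>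
      unfolding minus_mult_distrib_mat_vec[OF c1[OF \<theta>] mult_carrier_mat[OF B boundary_Q_carrier] fc[OF \<theta>]]
      by (rule vec_minus_add_cancel[symmetric, OF mult_mat_vec_carrier[OF c1[OF \<theta>] fc[OF \<theta>]]
            mult_mat_vec_carrier[OF mult_carrier_mat[OF B boundary_Q_carrier] fc[OF \<theta>]]])
    have "?I1 = vec_integral nBC {a..b} ?b1 + ?J"
      unfolding vec_integral_add(1)[OF b1i Ji, symmetric] by (rule vec_integral_cong) (rule e)
    then have "?I1 - ?J + ?I3 = vec_integral nBC {a..b} ?b1 + ?I3"
      by (intro eq_vecI) (simp_all del: index_mult_mat_vec vec_integral_index)
    also have "\<dots> = vec_integral nBC {a..b} (\<lambda>\<theta>. ?b1 \<theta> + ?I \<theta> *\<^sub>v f \<theta>)"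
      by (rule vec_integral_add(1)[OF b1i MK(2), symmetric])
    also have "\<dots> = vec_integral nBC {a..b} (\<lambda>\<theta>. BN \<theta> *\<^sub>v f \<theta>)"
    proof (rule vec_integral_cong)
      fix \<theta> assume \<theta>: "\<theta> \<in> {a..b}"
      show "?b1 \<theta> + ?I \<theta> *\<^sub>v f \<theta> = BN \<theta> *\<^sub>v f \<theta>"
        unfolding BN_def BIU2_QK_integral[OF \<theta>]
        by (rule add_mult_distrib_mat_vec[OF square_integrable_matD(1)[OF b1 \<theta>] mat_integral_carrier fc[OF \<theta>], symmetric])
    qed
    finally show ?thesis .
  qed
  finally have BTxi: "BT *\<^sub>v z = vec_integral nBC {a..b} (\<lambda>\<theta>. BN \<theta> *\<^sub>v f \<theta>)" .
  note BNi = square_integrable_mult_L2[OF BN_square_integrable f]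
  have "z = BTi *\<^sub>v (BT *\<^sub>v z)"
    using assoc_mult_mat_vec[OF BTi(1) BT_carrier z] z by (simp add: BTi(2))
  also have "\<dots> = vec_integral nS {a..b} (\<lambda>\<theta>. BTi *\<^sub>v (BN \<theta> *\<^sub>v f \<theta>))"
    unfolding BTxi by (rule vec_integral_mult_mat(1)[OF BNi BTi(1), symmetric])
  also have "\<dots> = vec_integral nS {a..b} (\<lambda>\<theta>. BQ \<theta> *\<^sub>v f \<theta>)"
    unfolding BQ_BN
    by (intro vec_integral_cong assoc_mult_mat_vec[OF BTi(1) square_integrable_matD(1)[OF BN_square_integrable] fc, symmetric])
  finally show ?thesis unfolding z_def f_def .
qed

end

context admissible_pde
begin

lemma Tmat_shift_continuous:
  assumes V: "V \<in> carrier_mat q nS" and ij: "i < q" "j < nS"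
  shows "continuous_on {a..b} (\<lambda>s. (V * Tmat (s - a)) $$ (i,j))"
  unfolding mult_mat_index[OF V Tmat_carrier ij]
  by (intro continuous_intros continuous_on_compose2[OF Tmat_continuous[of _ j UNIV]]) (use ij in auto)

lemma fundamental_state_kernels:
  assumes V: "V \<in> carrier_mat q nS"
  shows "mat_kernel a b q nx (\<lambda>s \<theta>. V * Tmat (s - a) * BQ \<theta>)"
    and "mat_kernel a b q nx (\<lambda>s \<theta>. V * Tmat (s - a) * BQ \<theta> + V * Qmat (s - \<theta>))"
proof -
  show T: "mat_kernel a b q nx (\<lambda>s \<theta>. V * Tmat (s - a) * BQ \<theta>)"
    by (rule mat_kernel_mult[OF mult_carrier_mat[OF V Tmat_carrier] Tmat_shift_continuous[OF V] BQ_square_integrable])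
  show "mat_kernel a b q nx (\<lambda>s \<theta>. V * Tmat (s - a) * BQ \<theta> + V * Qmat (s - \<theta>))"
    by (rule mat_kernel_add[OF T mat_kernel_mult_left[OF Qmat_kernel V]])
qed

text \<open>Every constant linear combination of the fundamental state and the continuous part of the state
  is a partial integral operator applied to the fundamental state.\<close>

lemma fundamental_state_PI:
  assumes x: "x \<in> X" and V: "V \<in> carrier_mat q nS" and W: "W \<in> carrier_mat q nx"
  shows "AE s in lebesgue_on {a..b}. W *\<^sub>v D_op x s + V *\<^sub>v xc x s
    = PI_op a b q (\<lambda>_. W) (\<lambda>s \<theta>. V * Tmat (s - a) * BQ \<theta> + V * Qmat (s - \<theta>))
        (\<lambda>s \<theta>. V * Tmat (s - a) * BQ \<theta>) (D_op x) s"
  using xc_representation(3)[OF ab X_imp_Wn[OF x]] AE_space[of "lebesgue_on {a..b}"]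
proof eventually_elim
  case (elim s)
  then have s: "s \<in> {a..b}" by simp
  define f where "f = D_op x"
  have f: "f \<in> L2 a b nx" unfolding f_def by (rule D_op_L2[OF ab X_imp_Wn[OF x]])
  note fc = L2D(1)[OF f]
  have subs: "\<theta> \<in> {a..b}" if "\<theta> \<in> {a..s} \<or> \<theta> \<in> {s..b}" for \<theta> using that s by auto
  let ?K = "\<lambda>\<theta>. V * Tmat (s - a) * BQ \<theta>"
  have VT: "V * Tmat (s - a) \<in> carrier_mat q nS" by (rule mult_carrier_mat[OF V Tmat_carrier])
  note BQc = square_integrable_matD(1)[OF BQ_square_integrable]
  have Kc: "?K \<theta> \<in> carrier_mat q nx" if "\<theta> \<in> {a..b}" for \<theta> by (rule mult_carrier_mat[OF VT BQc[OF that]])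
  have VQ: "V * Qmat t \<in> carrier_mat q nx" for t by (rule mult_carrier_mat[OF V Qmat_carrier])
  note BQi = square_integrable_mult_L2[OF BQ_square_integrable f]
  have K_eq: "(V * Tmat (s - a)) *\<^sub>v (BQ \<theta> *\<^sub>v f \<theta>) = ?K \<theta> *\<^sub>v f \<theta>" if "\<theta> \<in> {a..b}" for \<theta>
    by (rule assoc_mult_mat_vec[OF VT BQc[OF that] fc[OF that], symmetric])
  have Ki: "vec_integrable q {a..b} (\<lambda>\<theta>. ?K \<theta> *\<^sub>v f \<theta>)"
    using vec_integral_mult_mat(2)[OF BQi VT] by (rule vec_integrable_cong[THEN iffD1, rotated]) (rule K_eq)
  have Ki': "vec_integrable q {a..s} (\<lambda>\<theta>. ?K \<theta> *\<^sub>v f \<theta>)"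
    by (rule vec_integrable_subinterval[OF Ki]) (use s in auto)
  from mat_kernel_mult_vec_integrable[OF Qmat_kernel f s]
  have Qi: "vec_integrable nS {a..s} (\<lambda>\<theta>. Qmat (s - \<theta>) *\<^sub>v f \<theta>)"
    by (rule vec_integrable_subinterval) (use s in auto)
  have Q_eq: "V *\<^sub>v (Qmat (s - \<theta>) *\<^sub>v f \<theta>) = (V * Qmat (s - \<theta>)) *\<^sub>v f \<theta>" if "\<theta> \<in> {a..s}" for \<theta>
    using subs that by (intro assoc_mult_mat_vec[OF V Qmat_carrier fc, symmetric]) blast
  have VQi: "vec_integrable q {a..s} (\<lambda>\<theta>. (V * Qmat (s - \<theta>)) *\<^sub>v f \<theta>)"
    using vec_integral_mult_mat(2)[OF Qi V] by (rule vec_integrable_cong[THEN iffD1, rotated]) (rule Q_eq)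
  let ?k1 = "vec_integral q {a..s} (\<lambda>\<theta>. ?K \<theta> *\<^sub>v f \<theta>)" and ?k2 = "vec_integral q {s..b} (\<lambda>\<theta>. ?K \<theta> *\<^sub>v f \<theta>)"
    and ?v = "vec_integral q {a..s} (\<lambda>\<theta>. (V * Qmat (s - \<theta>)) *\<^sub>v f \<theta>)"
  let ?z = "vec_integral nS {a..b} (\<lambda>\<theta>. BQ \<theta> *\<^sub>v f \<theta>)"
  have xc: "xc x s = Tmat (s - a) *\<^sub>v ?z + vec_integral nS {a..s} (\<lambda>\<theta>. Qmat (s - \<theta>) *\<^sub>v f \<theta>)"
    using elim(1) xc_representation(2)[OF ab X_imp_Wn[OF x] s] boundary_value[OF x] by (simp add: f_def)
  have "V *\<^sub>v (Tmat (s - a) *\<^sub>v ?z) = (V * Tmat (s - a)) *\<^sub>v ?z"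
    by (rule assoc_mult_mat_vec[OF V Tmat_carrier vec_integral_carrier, symmetric])
  also have "\<dots> = vec_integral q {a..b} (\<lambda>\<theta>. (V * Tmat (s - a)) *\<^sub>v (BQ \<theta> *\<^sub>v f \<theta>))"
    by (rule vec_integral_mult_mat(1)[OF BQi VT, symmetric])
  also have "\<dots> = vec_integral q {a..b} (\<lambda>\<theta>. ?K \<theta> *\<^sub>v f \<theta>)"
    by (rule vec_integral_cong) (rule K_eq)
  also have "\<dots> = ?k1 + ?k2"
    using vec_integral_split[OF s, of q "\<lambda>\<theta>. ?K \<theta> *\<^sub>v f \<theta>" "\<lambda>\<theta>. ?K \<theta> *\<^sub>v f \<theta>"] Ki by simp
  finally have T: "V *\<^sub>v (Tmat (s - a) *\<^sub>v ?z) = ?k1 + ?k2" .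
  have Q: "V *\<^sub>v vec_integral nS {a..s} (\<lambda>\<theta>. Qmat (s - \<theta>) *\<^sub>v f \<theta>) = ?v"
    unfolding vec_integral_mult_mat(1)[OF Qi V, symmetric] by (rule vec_integral_cong) (rule Q_eq)
  have Vxc: "V *\<^sub>v xc x s = (?k1 + ?k2) + ?v"
    unfolding xc mult_add_distrib_mat_vec[OF V mult_mat_vec_carrier[OF Tmat_carrier vec_integral_carrier] vec_integral_carrier] T Q ..
  have R1: "vec_integral q {a..s} (\<lambda>\<theta>. (?K \<theta> + V * Qmat (s - \<theta>)) *\<^sub>v f \<theta>) = ?k1 + ?v"
    unfolding vec_integral_add(1)[OF Ki' VQi, symmetric]
    using subs by (intro vec_integral_cong add_mult_distrib_mat_vec[OF Kc VQ fc]) blast+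
  have "W *\<^sub>v f s \<in> carrier_vec q" by (rule mult_mat_vec_carrier[OF W fc[OF s]])
  then have "W *\<^sub>v f s + ((?k1 + ?k2) + ?v) = W *\<^sub>v f s + (?k1 + ?v) + ?k2"
    by (intro eq_vecI) (simp_all del: index_mult_mat_vec vec_integral_index)
  then show ?case
    unfolding PI_op_def f_def[symmetric] R1 Vxc .
qed

lemma xD_PI:
  assumes x: "x \<in> X"
  shows "AE s in lebesgue_on {a..b}. xD x s = PI_op a b (nx + nS) (\<lambda>_. U1) RD1 RD2 (D_op x) s"
  using fundamental_state_PI[OF x U2_carrier U1_carrier] AE_space[of "lebesgue_on {a..b}"]
proof eventually_elim
  case (elim s)
  then have s: "s \<in> {a..b}" by simp
  show ?case
    unfolding xD_decomp[OF ab X_imp_Wn[OF x] s] elim(1) RD1_def[abs_def] RD2_def[abs_def] ..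
qed

text \<open>Up to null sets, \<open>T_op\<close> is a left inverse of \<open>D_op\<close> on \<open>X\<close>.\<close>

lemma T_op_D_op:
  assumes x: "x \<in> X"
  shows "AE s in lebesgue_on {a..b}. T_op (D_op x) s = x s"
  using fundamental_state_PI[OF x E12_carrier G0_carrier[of 0]] AE_space[of "lebesgue_on {a..b}"]
proof eventually_elim
  case (elim s)
  then have s: "s \<in> {a..b}" by simp
  note fc = L2D(1)[OF D_op_L2[OF ab X_imp_Wn[OF x]]]
  note BQc = square_integrable_matD(1)[OF BQ_square_integrable]
  have G0: "G0 = (\<lambda>_. G0 0)" by (simp add: fun_eq_iff G0_def)
  have FT: "first_rows (n1 + n2) (Tmat t) \<in> carrier_mat (n1 + n2) nS" for t
    using first_rows_carrier[of "n1 + n2" "Tmat t"] Tmat_carrier[of t] by simp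
  have G2: "G2 s \<theta> = E12 * Tmat (s - a) * BQ \<theta>" if \<theta>: "\<theta> \<in> {a..b}" for \<theta>
    unfolding G2_def E12_mult_mat[OF Tmat_carrier] append_rows_mult[OF zero_carrier_mat FT BQc[OF \<theta>]]
      left_mult_zero_mat[OF BQc[OF \<theta>]] ..
  have G1: "G1 s \<theta> = E12 * Tmat (s - a) * BQ \<theta> + E12 * Qmat (s - \<theta>)" if \<theta>: "\<theta> \<in> {a..b}" for \<theta>
    unfolding G1_def G2[OF \<theta>] E12_mult_mat[OF Qmat_carrier, symmetric]
    by (rule comm_add_mat[OF mult_carrier_mat[OF E12_carrier Qmat_carrier]
          mult_carrier_mat[OF mult_carrier_mat[OF E12_carrier Tmat_carrier] BQc[OF \<theta>]]])
  have i1: "vec_integral nx {a..s} (\<lambda>\<theta>. G1 s \<theta> *\<^sub>v D_op x \<theta>)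
     = vec_integral nx {a..s} (\<lambda>\<theta>. (E12 * Tmat (s - a) * BQ \<theta> + E12 * Qmat (s - \<theta>)) *\<^sub>v D_op x \<theta>)"
    using s by (intro vec_integral_cong arg_cong2[of _ _ _ _ "(*\<^sub>v)"] G1) auto
  have i2: "vec_integral nx {s..b} (\<lambda>\<theta>. G2 s \<theta> *\<^sub>v D_op x \<theta>)
     = vec_integral nx {s..b} (\<lambda>\<theta>. (E12 * Tmat (s - a) * BQ \<theta>) *\<^sub>v D_op x \<theta>)"
    using s by (intro vec_integral_cong arg_cong2[of _ _ _ _ "(*\<^sub>v)"] G2) auto
  have "T_op (D_op x) s = G0 0 *\<^sub>v D_op x s + E12 *\<^sub>v xc x s"
    unfolding elim(1) unfolding T_op_def PI_op_def i1 i2 by (subst G0) (rule refl)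
  also have "\<dots> = x s"
    using x_decomp[OF ab X_imp_Wn[OF x] s] fun_cong[OF G0, of s] by simp
  finally show ?case .
qed

lemma A_op_D_op:
  assumes x: "x \<in> X"
  shows "AE s in lebesgue_on {a..b}. A_op (D_op x) s = PI_op a b nx A0 A1 A2 (xD x) s"
  using xD_PI[OF x] AE_space[of "lebesgue_on {a..b}"]
proof eventually_elim
  case (elim s)
  then have s: "s \<in> {a..b}" by simp
  have R2: "mat_kernel a b (nx + nS) nx RD2"
    using fundamental_state_kernels(1)[OF U2_carrier] unfolding RD2_def[abs_def] .
  have R1: "mat_kernel a b (nx + nS) nx RD1"
    using fundamental_state_kernels(2)[OF U2_carrier] unfolding RD1_def[abs_def] RD2_def[abs_def] .
  have A0s: "A0 s \<in> carrier_mat nx (nx + nS)"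
    using A0 s unfolding ess_bounded_mat_def by blast
  have "PI_op a b nx A0 A1 A2 (xD x) s = A_op (D_op x) s"
    unfolding A_op_def A0_hat_def[abs_def] A1_hat_def[abs_def] A2_hat_def[abs_def]
    by (rule PI_op_compose[where y = "xD x" and ?A0.0 = A0 and ?A1.0 = A1 and ?A2.0 = A2 and ?R1.0 = RD1 and ?R2.0 = RD2,
          OF s D_op_L2[OF ab X_imp_Wn[OF x]] U1_carrier R1 R2
          Wn_carriers(8)[OF ab X_imp_Wn[OF x]] xD_PI[OF x] elim(1) A0s
          separable_imp_square_integrable[OF A1 s] separable_imp_square_integrable[OF A2 s]])
  then show ?case ..
qed

lemma T_op_cong:
  assumes "f \<in> L2 a b nx" and ae: "AE s in lebesgue_on {a..b}. f s = g s"
  shows "AE s in lebesgue_on {a..b}. T_op f s = T_op g s"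
  using ae AE_space[of "lebesgue_on {a..b}"]
proof eventually_elim
  case (elim s)
  then have s: "s \<in> {a..b}" by simp
  have e: "vec_integral nx S (\<lambda>\<theta>. R \<theta> *\<^sub>v f \<theta>) = vec_integral nx S (\<lambda>\<theta>. R \<theta> *\<^sub>v g \<theta>)"
    if "S \<subseteq> {a..b}" "S \<in> sets lebesgue" for S and R :: "real \<Rightarrow> real Matrix.mat"
  proof (rule vec_integral_cong_AE[OF _ that(2)])
    have "AE \<theta> in lebesgue_on S. f \<theta> = g \<theta>" by (rule lebesgue_on_AE_subset[OF ae that(1) _ that(2)]) simp
    then show "AE \<theta> in lebesgue_on S. R \<theta> *\<^sub>v f \<theta> = R \<theta> *\<^sub>v g \<theta>" by eventually_elim simp
  qed
  have "{a..s} \<subseteq> {a..b}" "{s..b} \<subseteq> {a..b}" using s by auto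
  then show ?case
    unfolding T_op_def PI_op_def elim(1) by (simp add: e)
qed

text \<open>Two states in \<open>X\<close> agree almost everywhere exactly if their fundamental states do.\<close>

lemma D_op_L2_eq_iff:
  assumes x: "x \<in> X" and y: "y \<in> X"
  shows "L2_eq a b (D_op x) (D_op y) \<longleftrightarrow> L2_eq a b x y"
proof
  assume "L2_eq a b (D_op x) (D_op y)"
  then have "AE s in lebesgue_on {a..b}. T_op (D_op x) s = T_op (D_op y) s"
    unfolding L2_eq_def by (rule T_op_cong[OF D_op_L2[OF ab X_imp_Wn[OF x]]])
  then show "L2_eq a b x y"
    unfolding L2_eq_def using T_op_D_op[OF x] T_op_D_op[OF y] by eventually_elim simp
next
  assume "L2_eq a b x y"
  then have ae: "AE s in lebesgue_on {a..b}. x s = y s" unfolding L2_eq_def .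
  note Wx = Wn_weak_derivs[OF ab X_imp_Wn[OF x]] and Wy = Wn_weak_derivs[OF ab X_imp_Wn[OF y]]
  have 1: "dx1 x = dx1 y"
    unfolding dx1_def
    by (rule weak_deriv_cong_AE[OF has_weak_derivD(1)[OF Wx(2)] has_weak_derivD(1)[OF Wy(2)]])
      (use ae in eventually_elim, simp add: x1_part_def slice_def)
  have 2: "dx2 x = dx2 y"
    unfolding dx2_def
    by (rule weak_deriv_cong_AE[OF has_weak_derivD(1)[OF Wx(3)] has_weak_derivD(1)[OF Wy(3)]])
      (use ae in eventually_elim, simp add: x2_part_def slice_def)
  have 3: "ddx2 x = ddx2 y" unfolding ddx2_def 2 ..
  show "L2_eq a b (D_op x) (D_op y)"
    unfolding L2_eq_def using ae by eventually_elim (simp add: D_op_def 1 3 x0_part_def slice_def)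
qed

end

section \<open>Equivalence of the two evolution equations\<close>

lemma L2_norm_cong_AE:
  assumes "AE s in lebesgue_on {a..b}. u s = v s"
  shows "L2_norm a b u = L2_norm a b v"
proof -
  have "AE s in lebesgue_on {a..b}. u s \<bullet> u s = v s \<bullet> v s"
    using assms by eventually_elim simp
  then show ?thesis
    unfolding L2_norm_def by (simp add: LINT_cong_AE(1))
qed

text \<open>Curves that agree almost everywhere at each time \<open>t \<ge> 0\<close> satisfy the same derivative predicate, so
  the derivative chosen for one is the derivative chosen for the other.\<close>

lemma L2_derivative_cong_AE:
  assumes eq: "\<And>t. t \<ge> 0 \<Longrightarrow> AE s in lebesgue_on {a..b}. x t s = y t s" and t: "t \<ge> 0"
  shows "L2_differentiable a b m x t = L2_differentiable a b m y t"
    and "L2_deriv a b m x t = L2_deriv a b m y t"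
proof -
  have "has_L2_deriv a b m x v t = has_L2_deriv a b m y v t" for v
  proof -
    have n: "L2_norm a b (\<lambda>s. x \<tau> s - x t s - (\<tau> - t) \<cdot>\<^sub>v v s) = L2_norm a b (\<lambda>s. y \<tau> s - y t s - (\<tau> - t) \<cdot>\<^sub>v v s)"
      if "\<tau> \<ge> 0" for \<tau>
      by (rule L2_norm_cong_AE) (use eq[OF that] eq[OF t] in eventually_elim, simp)
    have "((\<lambda>\<tau>. L2_norm a b (\<lambda>s. x \<tau> s - x t s - (\<tau> - t) \<cdot>\<^sub>v v s) / \<bar>\<tau> - t\<bar>) \<longlongrightarrow> 0) (at t within {0..})
      = ((\<lambda>\<tau>. L2_norm a b (\<lambda>s. y \<tau> s - y t s - (\<tau> - t) \<cdot>\<^sub>v v s) / \<bar>\<tau> - t\<bar>) \<longlongrightarrow> 0) (at t within {0..})"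
      by (rule tendsto_cong) (simp add: eventually_at_filter n)
    then show ?thesis unfolding has_L2_deriv_def by simp
  qed
  then show "L2_differentiable a b m x t = L2_differentiable a b m y t" "L2_deriv a b m x t = L2_deriv a b m y t"
    unfolding L2_differentiable_def L2_deriv_def by simp_all
qed

theorem (in admissible_pde) PDE_iff_PIE:
  assumes x0: "x0 \<in> X" and x: "\<forall>t\<ge>0. x t \<in> X"
  shows "satisfies_PDE x0 x \<longleftrightarrow> satisfies_PIE a b nx T_op A_op (D_op x0) (\<lambda>t. D_op (x t))"
proof -
  have eq: "AE s in lebesgue_on {a..b}. x t s = T_op (D_op (x t)) s" if "t \<ge> 0" for t
  proof -
    have "x t \<in> X" using x that by blast
    then show ?thesis by (rule T_op_D_op[THEN eventually_mono]) simp
  qed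
  have D: "L2_differentiable a b nx x t = L2_differentiable a b nx (\<lambda>t. T_op (D_op (x t))) t"
    "L2_deriv a b nx x t = L2_deriv a b nx (\<lambda>t. T_op (D_op (x t))) t" if "t \<ge> 0" for t
    by (rule L2_derivative_cong_AE[OF _ that], erule eq)+
  have L2: "\<forall>t\<ge>0. D_op (x t) \<in> L2 a b nx"
    using D_op_L2[OF ab X_imp_Wn] x by blast
  have init: "L2_eq a b (x 0) x0 \<longleftrightarrow> L2_eq a b (D_op (x 0)) (D_op x0)"
    using D_op_L2_eq_iff[of "x 0" x0] x x0 by simp
  have diff: "(AE t in lebesgue_on {0..}. L2_differentiable a b nx x t)
    \<longleftrightarrow> (AE t in lebesgue_on {0..}. L2_differentiable a b nx (\<lambda>\<tau>. T_op (D_op (x \<tau>))) t)"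
    by (rule AE_cong) (simp add: D)
  have eqn: "L2_eq a b (L2_deriv a b nx x t) (PI_op a b nx A0 A1 A2 (xD (x t)))
    \<longleftrightarrow> L2_eq a b (L2_deriv a b nx (\<lambda>\<tau>. T_op (D_op (x \<tau>))) t) (A_op (D_op (x t)))" if t: "t \<ge> 0" for t
  proof -
    have "x t \<in> X" using x t by blast
    note A = A_op_D_op[OF this]
    show ?thesis
      unfolding D(2)[OF t] L2_eq_def
    proof
      assume "AE s in lebesgue_on {a..b}. L2_deriv a b nx (\<lambda>t. T_op (D_op (x t))) t s = PI_op a b nx A0 A1 A2 (xD (x t)) s"
      then show "AE s in lebesgue_on {a..b}. L2_deriv a b nx (\<lambda>t. T_op (D_op (x t))) t s = A_op (D_op (x t)) s"
        using A by eventually_elim simp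
    next
      assume "AE s in lebesgue_on {a..b}. L2_deriv a b nx (\<lambda>t. T_op (D_op (x t))) t s = A_op (D_op (x t)) s"
      then show "AE s in lebesgue_on {a..b}. L2_deriv a b nx (\<lambda>t. T_op (D_op (x t))) t s = PI_op a b nx A0 A1 A2 (xD (x t)) s"
        using A by eventually_elim simp
    qed
  qed
  have dyn: "(AE t in lebesgue_on {0..}. L2_eq a b (L2_deriv a b nx x t) (PI_op a b nx A0 A1 A2 (xD (x t))))
    \<longleftrightarrow> (AE t in lebesgue_on {0..}. L2_eq a b (L2_deriv a b nx (\<lambda>\<tau>. T_op (D_op (x \<tau>))) t) (A_op (D_op (x t))))"
    by (rule AE_cong) (simp add: eqn)
  show ?thesis
    unfolding satisfies_PDE_def satisfies_PIE_def using x L2 init diff dyn by blast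
qed

theorem theorem1:
  fixes a b :: real
    and n0 n1 n2 nBC :: nat
    and B :: "real Matrix.mat" and BI :: "real \<Rightarrow> real Matrix.mat"
    and A0 :: "real \<Rightarrow> real Matrix.mat" and A1 A2 :: "real \<Rightarrow> real \<Rightarrow> real Matrix.mat"
    and x0 :: "real \<Rightarrow> real Matrix.vec" and x :: "real \<Rightarrow> real \<Rightarrow> real Matrix.vec"
  defines "nx \<equiv> pde.nx n0 n1 n2" and "nS \<equiv> pde.nS n1 n2"
  assumes "a < b"
    and "B \<in> carrier_mat nBC (2 * nS)"
    and "square_integrable_mat a b nBC (nx + nS) BI"
    and "ess_bounded_mat a b nx (nx + nS) A0"
    and "separable_mat a b nx (nx + nS) A1"
    and "separable_mat a b nx (nx + nS) A2"
    and "pde.admissible a b n0 n1 n2 nBC B BI"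
    and "x0 \<in> pde.X a b n0 n1 n2 nBC B BI"
    and "\<forall>t\<ge>0. x t \<in> pde.X a b n0 n1 n2 nBC B BI"
  shows "pde.D_op a b n0 n1 n2 x0 \<in> L2 a b nx \<and>
    (pde.satisfies_PDE a b n0 n1 n2 nBC B BI A0 A1 A2 x0 x \<longleftrightarrow>
     satisfies_PIE a b nx
       (pde.T_op a b n0 n1 n2 nBC B BI) (pde.A_op a b n0 n1 n2 nBC B BI A0 A1 A2)
       (pde.D_op a b n0 n1 n2 x0) (\<lambda>t. pde.D_op a b n0 n1 n2 (x t)))"
proof -
  note nx_eq = nx_def
  interpret admissible_pde a b n0 n1 n2 nBC B BI A0 A1 A2
    by unfold_locales (use assms in \<open>simp_all only: nx_def nS_def\<close>)
  show ?thesis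
    unfolding nx_eq using D_op_L2[OF \<open>a < b\<close> X_imp_Wn[OF assms(10)]] PDE_iff_PIE[OF assms(10,11)] by blast
qed

end
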